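(* Let $\mathcal C = \{a_j \pmod{m_j} : 1 \le j \le s\}$ be a finite distinct covering system of the integers whose minimum modulus exceeds $4$ (that is, $m_j > 4$ for every $j$). Then $$\sum_{j=1}^{s} \frac{1}{m_j} \;\ge\; 1 + \exp\big(-3.363054 \cdot 10^{21}\big).$$
   Context: A covering system of the integers is a set $\mathcal C = \{a_j \pmod{m_j}\}$ of congruence classes (with $a_j \in \mathbb Z$ and moduli $m_j$ positive integers) such that every integer $x$ satisfies at least one of the congruences $x \equiv a_j \pmod{m_j}$. It is finite if it consists of finitely many congruence classes, and distinct if the moduli $m_j$ are pairwise distinct. *)

theory Defs
  imports Complex_Main "HOL-Number_Theory.Cong"
begin

text \<open>A system of congruence classes is encoded as a family \<open>a j (mod m j)\<close>, \<open>j \<in> I\<close>;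
  finiteness of the system is finiteness of \<open>I\<close>.\<close>

definition covering_system :: "'i set \<Rightarrow> ('i \<Rightarrow> int) \<Rightarrow> ('i \<Rightarrow> nat) \<Rightarrow> bool" where
  "covering_system I a m \<longleftrightarrow>
     (\<forall>j\<in>I. m j > 0) \<and> (\<forall>x::int. \<exists>j\<in>I. [x = a j] (mod int (m j)))"

definition distinct_covering_system :: "'i set \<Rightarrow> ('i \<Rightarrow> int) \<Rightarrow> ('i \<Rightarrow> nat) \<Rightarrow> bool" where
  "distinct_covering_system I a m \<longleftrightarrow> covering_system I a m \<and> inj_on m I"

end

theory Submission
  imports Defs "HOL-Analysis.Analysis"
begin

text \<open>If two classes with moduli \<open>k, n \<le> Y\<close> meet, they meet in a whole class modulo \<open>lcm k n\<close>, and
  the reciprocal sum is at least \<open>1 + 1 / (k n) \<ge> 1 + Y\<^sup>-\<^sup>2\<close>. So it suffices to refute that all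
  classes with moduli up to \<open>Y = exp (80 L\<^sup>2)\<close> are disjoint, where \<open>L = ln P\<close> and \<open>P\<close> is close to
  \<open>exp (10\<^sup>8)\<close>.

  Disjointness makes sieving efficient: if a set of density \<open>\<mu>\<close> contains a class modulo every \<open>k\<close> in a
  set \<open>K\<close> of numbers composed of the primes in \<open>S\<close>, then the sum of \<open>1 / k\<close> over \<open>K\<close> is at most
  \<open>\<mu>\<close> times the product of \<open>p / (p - 1)\<close> over \<open>S\<close>. By this inequality the moduli whose largest prime is
  \<open>p\<close> remove from the set left uncovered by the smaller primes at most a proportion whose sum over \<open>p\<close>
  telescopes. Hence a set of density at least a fixed power of \<open>1 / P\<close> is not covered by the
  \<open>P\<close>-smooth moduli up to \<open>Y\<close>; the condition on the minimum modulus leaves a density of at least \<open>1/12\<close>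
  after the primes 2 and 3.

  Starting from that set, the primes above \<open>P\<close> are treated by the distortion method of Balister,
  Bollobas, Morris, Sahasrabudhe and Tiba. For primes up to \<open>R = P\<^sup>8\<close> the second moments are bounded
  relative to the density of the set, again by the inequality above; for larger primes the absolute
  bounds suffice. The \<open>R\<close>-smooth moduli exceeding \<open>Y\<close> are negligible by Rankin's method.\<close>

subsection \<open>Averages over residue classes\<close>

text \<open>Put \<open>L = ln P\<close> and ignore powers of \<open>L\<close>. The density
  \<open>\<mu>\<close> left by the sieve is at least about P^(-3.025), where 3.025 = 11/10 * 11/4:
  up to a constant the sieve keeps exp (- 11/10 E), with E the Mertens product up to
  \<open>P\<close>, and E \<le> 11/4 * L. The obstacle is that absolute second moments for the
  primes above \<open>P\<close> sum only to about 1/P, far more than \<mu>. A bound proportional to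
  \<mu> needs disjointness, hence moduli up to \<open>Y\<close>, hence a prime bound
  \<open>R\<close> below which larger moduli can be discarded. The losses are then \<mu> * \<Psi> /
  P and P^(-1) * \<Psi>^(-3) from a divisor weight truncated at \<Psi>, R^(-1/2) from the large
  primes, and Y^(-s) from Rankin's method, where R^s = 3/2. With \<Psi> = P^(9/10), R = P^8 and Y =
  exp (80 L^2) they are \<mu> * P^(-1/10), P^(-3.7), P^(-4) and at most P^(-10/3), all small against
  \<mu>. The size 10^8 of \<open>L\<close> makes the powers of \<open>L\<close> harmless: (22 L)^17
  is at most exp (L / 20).\<close>

lemmas int_cong_def = unique_euclidean_semiring_class.cong_def [where 'a = int]

text \<open>For \<open>f\<close> of period dividing \<open>N\<close> this is the density of
  \<open>f\<close>, so limits never occur; \<open>N\<close> is eventually the product of all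
  moduli.\<close>

definition avg :: "nat \<Rightarrow> (int \<Rightarrow> real) \<Rightarrow> real" where
  "avg N f = (\<Sum>x\<in>{0..<int N}. f x) / real N"

definition periodic :: "nat \<Rightarrow> (int \<Rightarrow> 'a) \<Rightarrow> bool" where
  "periodic D f \<longleftrightarrow> (\<forall>x y. [x = y] (mod int D) \<longrightarrow> f x = f y)"

lemma periodicD: "periodic D f \<Longrightarrow> [x = y] (mod int D) \<Longrightarrow> f x = f y"
  by (auto simp: periodic_def)

lemma periodic_dvd: "periodic D f \<Longrightarrow> D dvd N \<Longrightarrow> periodic N f"
  unfolding periodic_def using cong_dvd_modulus by (metis of_nat_dvd_iff)

lemma periodic_mult: "periodic D f \<Longrightarrow> periodic D g \<Longrightarrow> periodic D (\<lambda>x. f x * g x)"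
  unfolding periodic_def by metis

lemma periodic_cong_class: "d dvd D \<Longrightarrow> periodic D (\<lambda>x. [x = c] (mod int d))"
  unfolding periodic_def
  by (metis cong_dvd_modulus cong_sym cong_trans of_nat_dvd_iff)

lemma periodic_comp: "periodic D f \<Longrightarrow> periodic D (\<lambda>x. h (f x))"
  unfolding periodic_def by metis

lemma avg_mono: "(\<And>x. f x \<le> g x) \<Longrightarrow> avg N f \<le> avg N g"
  unfolding avg_def by (intro divide_right_mono sum_mono) auto

lemma avg_nonneg: "(\<And>x. 0 \<le> f x) \<Longrightarrow> 0 \<le> avg N f"
  unfolding avg_def by (intro divide_nonneg_nonneg sum_nonneg) auto

lemma avg_sum: "avg N (\<lambda>x. \<Sum>i\<in>I. f i x) = (\<Sum>i\<in>I. avg N (f i))"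
  unfolding avg_def by (subst sum.swap) (simp add: sum_divide_distrib)

lemma avg_add: "avg N (\<lambda>x. f x + g x) = avg N f + avg N g"
  unfolding avg_def by (simp add: sum.distrib add_divide_distrib)

lemma avg_cmult: "avg N (\<lambda>x. c * f x) = c * avg N f"
  unfolding avg_def by (simp add: sum_distrib_left)

lemma avg_const: "N > 0 \<Longrightarrow> avg N (\<lambda>x. c) = c"
  unfolding avg_def by simp

lemma sum_shift_periodic:
  fixes f :: "int \<Rightarrow> real"
  assumes "periodic N f" "N > 0"
  shows "(\<Sum>x\<in>{0..<int N}. f (x + t)) = (\<Sum>x\<in>{0..<int N}. f x)"
proof -
  let ?g = "\<lambda>x. (x + t) mod int N"
  have inj: "inj_on ?g {0..<int N}"
  proof (rule inj_onI)
    fix x y assume xy: "x \<in> {0..<int N}" "y \<in> {0..<int N}" "?g x = ?g y"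
    then have "[x + t = y + t] (mod int N)" by (simp add: int_cong_def)
    then have "[x = y] (mod int N)" by (simp add: cong_add_rcancel)
    with xy show "x = y" by (simp add: int_cong_def)
  qed
  have sub: "?g ` {0..<int N} \<subseteq> {0..<int N}" using assms(2) by auto
  have im: "?g ` {0..<int N} = {0..<int N}"
    by (rule endo_inj_surj[OF _ sub inj]) simp
  have "(\<Sum>x\<in>{0..<int N}. f x) = (\<Sum>x\<in>?g ` {0..<int N}. f x)" using im by simp
  also have "\<dots> = (\<Sum>x\<in>{0..<int N}. f (?g x))" using sum.reindex[OF inj, of f] by simp
  also have "\<dots> = (\<Sum>x\<in>{0..<int N}. f (x + t))"
    by (intro sum.cong refl periodicD[OF assms(1)]) (simp add: int_cong_def)
  finally show ?thesis by simp
qed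

lemma avg_shift: "periodic N f \<Longrightarrow> N > 0 \<Longrightarrow> avg N (\<lambda>x. f (x + t)) = avg N f"
  unfolding avg_def using sum_shift_periodic by simp

text \<open>The points \<open>x + D j\<close>, \<open>j < q\<close>, run through the residues modulo \<open>D q\<close> above the residue
  of \<open>x\<close> modulo \<open>D\<close>; this replaces the Chinese remainder theorem throughout.\<close>

lemma avg_fibre:
  assumes "periodic D \<phi>" "periodic N \<phi>" "periodic N g" "N > 0" "q > 0"
  shows "avg N (\<lambda>x. \<phi> x * g x) = avg N (\<lambda>x. \<phi> x * ((\<Sum>j\<in>{0..<int q}. g (x + int D * j)) / real q))"
proof -
  have 1: "avg N (\<lambda>x. \<phi> x * g (x + int D * j)) = avg N (\<lambda>x. \<phi> x * g x)" for j
  proof -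
    have "\<phi> (x + int D * j) = \<phi> x" for x
      by (rule periodicD[OF assms(1)]) (simp add: int_cong_def)
    then have "avg N (\<lambda>x. \<phi> x * g (x + int D * j)) = avg N (\<lambda>x. (\<lambda>x. \<phi> x * g x) (x + int D * j))"
      by simp
    also have "\<dots> = avg N (\<lambda>x. \<phi> x * g x)"
      by (rule avg_shift[OF periodic_mult[OF assms(2,3)] assms(4)])
    finally show ?thesis .
  qed
  have "avg N (\<lambda>x. \<phi> x * ((\<Sum>j\<in>{0..<int q}. g (x + int D * j)) / real q))
     = avg N (\<lambda>x. (1 / real q) * (\<Sum>j\<in>{0..<int q}. \<phi> x * g (x + int D * j)))"
    by (simp add: sum_distrib_left sum_divide_distrib)
  also have "\<dots> = (1 / real q) * (\<Sum>j\<in>{0..<int q}. avg N (\<lambda>x. \<phi> x * g (x + int D * j)))"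
    by (simp only: avg_cmult avg_sum)
  also have "\<dots> = avg N (\<lambda>x. \<phi> x * g x)"
    using assms(5) by (simp only: 1) simp
  finally show ?thesis by simp
qed

lemma card_residue_class:
  assumes "d > 0"
  shows "card {x\<in>{0..<int (d * n)}. [x = c] (mod int d)} = n"
proof -
  have "{x\<in>{0..<int (d * n)}. [x = c] (mod int d)} = (\<lambda>i. c mod int d + int d * int i) ` {..<n}"
  proof (intro equalityI subsetI)
    fix x assume x: "x \<in> {x\<in>{0..<int (d * n)}. [x = c] (mod int d)}"
    then have e: "x mod int d = c mod int d" by (simp add: int_cong_def)
    have "x = c mod int d + int d * int (nat (x div int d))"
      using x e[symmetric] assms by (simp add: pos_imp_zdiv_nonneg_iff)
    moreover have "nat (x div int d) < n"
    proof (rule ccontr)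
      assume "\<not> ?thesis"
      moreover have "x div int d \<ge> 0" using x assms by (simp add: pos_imp_zdiv_nonneg_iff)
      ultimately have "int n \<le> x div int d" by (simp add: nat_less_iff)
      then have "int d * int n \<le> int d * (x div int d)" by (intro mult_left_mono) auto
      also have "\<dots> \<le> x" using assms
        by (metis mult.commute pos_mod_sign of_nat_0_less_iff div_mult_mod_eq le_add_same_cancel1)
      finally show False using x by simp
    qed
    ultimately show "x \<in> (\<lambda>i. c mod int d + int d * int i) ` {..<n}" by blast
  next
    fix x assume "x \<in> (\<lambda>i. c mod int d + int d * int i) ` {..<n}"
    then obtain i where i: "i < n" "x = c mod int d + int d * int i" by auto
    have m: "0 \<le> c mod int d" "c mod int d < int d" using assms by auto
    have "x < int d + int d * int i" using m i by simp
    also have "\<dots> = int d * int (Suc i)" by (simp add: algebra_simps)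
    also have "\<dots> \<le> int d * int n" using i(1) by (intro mult_left_mono) auto
    finally show "x \<in> {x\<in>{0..<int (d * n)}. [x = c] (mod int d)}"
      using m i by (auto simp: int_cong_def)
  qed
  moreover have "inj_on (\<lambda>i. c mod int d + int d * int i) {..<n}"
    using assms by (auto intro!: inj_onI)
  ultimately show ?thesis by (simp add: card_image)
qed

lemma sum_of_bool_card: "finite A \<Longrightarrow> (\<Sum>x\<in>A. of_bool (P x) :: real) = real (card {x\<in>A. P x})"
  by (simp add: of_bool_def sum.If_cases Int_def)

lemma avg_class:
  assumes "d dvd N" "N > 0"
  shows "avg N (\<lambda>x. of_bool ([x = c] (mod int d))) = 1 / real d"
proof -
  obtain n where n: "N = d * n" using assms(1) by auto
  then have "d > 0" "n > 0" using assms(2) by auto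
  then show ?thesis
    unfolding avg_def n sum_of_bool_card[OF finite_atLeastLessThan_int]
    by (subst card_residue_class) auto
qed

text \<open>\<open>D\<close> is invertible modulo \<open>q ^ v\<close>, so the congruence for
  \<open>x + D j\<close> confines \<open>j\<close> to a single class modulo
  \<open>q ^ v\<close>.\<close>

lemma card_fibre_class:
  assumes "coprime D q" "q > 0" "v \<le> e"
  shows "card {j\<in>{0..<int (q ^ e)}. [x + int D * j = c] (mod int (q ^ v))} = q ^ (e - v)"
proof -
  have cop: "coprime (int D) (int (q ^ v))" using assms(1) by simp
  then obtain j0 where j0: "[int D * j0 = c - x] (mod int (q ^ v))"
    by (metis cong_solve_coprime_int cong_scalar_right mult.assoc mult.commute mult_1)
  have "[x + int D * j = c] (mod int (q ^ v)) \<longleftrightarrow> [j = j0] (mod int (q ^ v))" for j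
  proof -
    have "[x + int D * j = c] (mod int (q ^ v)) \<longleftrightarrow> [int D * j = c - x] (mod int (q ^ v))"
      by (metis add_diff_cancel_left' cong_add_lcancel diff_add_cancel add.commute)
    also have "\<dots> \<longleftrightarrow> [int D * j = int D * j0] (mod int (q ^ v))"
      using j0 cong_trans cong_sym by metis
    also have "\<dots> \<longleftrightarrow> [j = j0] (mod int (q ^ v))" using cop by (simp add: cong_mult_lcancel)
    finally show ?thesis .
  qed
  then have "{j\<in>{0..<int (q ^ e)}. [x + int D * j = c] (mod int (q ^ v))}
     = {j\<in>{0..<int (q ^ v * q ^ (e - v))}. [j = j0] (mod int (q ^ v))}"
    using assms(3) by (simp flip: power_add)
  then show ?thesis using card_residue_class[of "q ^ v" "q ^ (e - v)" j0] assms(2) by simp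
qed

subsection \<open>Disjoint smooth moduli and the sets containing their classes\<close>

text \<open>For a finite set of primes this is the sum of 1/n over all n composed of primes in
  \<open>S\<close>; it is the Mertens product when \<open>S\<close> is an initial segment of the
  primes.\<close>

definition euler_prod :: "nat set \<Rightarrow> real" where
  "euler_prod S = (\<Prod>p\<in>S. real p / (real p - 1))"

lemma geometric_le:
  fixes q :: real
  assumes "q > 1" "finite V" "\<And>v. v \<in> V \<Longrightarrow> v0 \<le> v"
  shows "(\<Sum>v\<in>V. 1 / q ^ v) \<le> 1 / q ^ v0 * (q / (q - 1))"
proof -
  have q: "norm (1 / q) < 1" using assms(1) by simp
  have s: "(\<lambda>n. 1 / q ^ v0 * (1 / q) ^ n) sums (1 / q ^ v0 * (1 / (1 - 1 / q)))"
    by (rule sums_mult[OF geometric_sums[OF q]])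
  have e: "1 / (1 - 1 / q) = q / (q - 1)" using assms(1) by (simp add: field_simps)
  have "(\<Sum>v\<in>V. 1 / q ^ v) = (\<Sum>n\<in>(\<lambda>v. v - v0) ` V. 1 / q ^ v0 * (1 / q) ^ n)"
  proof (subst sum.reindex)
    show "inj_on (\<lambda>v. v - v0) V"
      using assms(3) by (intro inj_onI) (metis le_add_diff_inverse2)
    show "(\<Sum>v\<in>V. 1 / q ^ v) = sum ((\<lambda>n. 1 / q ^ v0 * (1 / q) ^ n) \<circ> (\<lambda>v. v - v0)) V"
    proof (rule sum.cong[OF refl])
      fix v assume "v \<in> V"
      then have "v = v0 + (v - v0)" using assms(3) by simp
      then have "q ^ v = q ^ v0 * q ^ (v - v0)" by (metis power_add)
      then show "1 / q ^ v = ((\<lambda>n. 1 / q ^ v0 * (1 / q) ^ n) \<circ> (\<lambda>v. v - v0)) v"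
        by (simp add: power_one_over)
    qed
  qed
  also have "\<dots> \<le> (\<Sum>n. 1 / q ^ v0 * (1 / q) ^ n)"
    using assms(1,2) by (intro sum_le_suminf sums_summable[OF s]) auto
  also have "\<dots> = 1 / q ^ v0 * (q / (q - 1))" using s e by (simp add: sums_iff)
  finally show ?thesis .
qed

lemma prime_factors_div_power:
  fixes k q :: nat
  assumes "prime q" "k > 0" "prime_factors k \<subseteq> insert q S" "q \<notin> S"
  defines "k' \<equiv> k div q ^ multiplicity q k"
  shows "k = q ^ multiplicity q k * k'" "k' > 0" "prime_factors k' \<subseteq> S" "coprime q k'"
proof -
  have d: "q ^ multiplicity q k dvd k" by (rule multiplicity_dvd)
  then show k: "k = q ^ multiplicity q k * k'" unfolding k'_def by simp
  then show k': "k' > 0" using assms(2) by (metis gr0I mult_is_0)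
  have "\<not> q dvd k'"
    unfolding k'_def using assms(1,2) by (intro multiplicity_decompose) auto
  then show c: "coprime q k'" using assms(1) by (simp add: prime_imp_coprime)
  have "prime_factors k' \<subseteq> prime_factors k"
  proof (intro dvd_prime_factors)
    show "k' dvd k" using k by (metis dvd_triv_right)
  qed (use assms(2) in auto)
  moreover have "q \<notin> prime_factors k'" using \<open>\<not> q dvd k'\<close> by auto
  ultimately show "prime_factors k' \<subseteq> S" using assms(3) by blast
qed

text \<open>The \<open>n\<close> classes of \<open>y + Q z\<close> modulo \<open>Q n\<close>
  partition the class of \<open>y\<close> modulo \<open>Q\<close>, so the averages over the slices
  add up to the average over that class.\<close>

lemma cong_class_split:
  assumes "Q > 0" "n > 0"
  shows "(\<Sum>z\<in>{0..<int n}. of_bool ([x = y + int Q * z] (mod int (Q * n))) :: real)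
         = of_bool ([x = y] (mod int Q))"
proof (cases "[x = y] (mod int Q)")
  case False
  have "\<not> [x = y + int Q * z] (mod int (Q * n))" for z
  proof
    assume "[x = y + int Q * z] (mod int (Q * n))"
    then have "[x = y + int Q * z] (mod int Q)"
      by (rule cong_dvd_modulus) simp
    also have "[y + int Q * z = y] (mod int Q)" by (simp add: int_cong_def)
    finally show False using False by simp
  qed
  with False show ?thesis by simp
next
  case True
  then obtain t where t: "x = y + int Q * t" by (metis cong_iff_lin cong_sym)
  have "[x = y + int Q * z] (mod int (Q * n)) \<longleftrightarrow> [z = t] (mod int n)" for z
  proof -
    have "[x = y + int Q * z] (mod int (Q * n)) \<longleftrightarrow> [int Q * t = int Q * z] (mod int (Q * n))"
      unfolding t by (rule cong_add_lcancel)
    also have "\<dots> \<longleftrightarrow> int Q * int n dvd int Q * (t - z)"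
      by (simp add: cong_iff_dvd_diff algebra_simps)
    also have "\<dots> \<longleftrightarrow> [t = z] (mod int n)" using assms(1) by (simp add: cong_iff_dvd_diff)
    finally show ?thesis by (simp add: cong_sym_eq)
  qed
  then have "(\<Sum>z\<in>{0..<int n}. of_bool ([x = y + int Q * z] (mod int (Q * n))) :: real)
     = real (card {z\<in>{0..<int (n * 1)}. [z = t] (mod int n)})"
    by (simp only: sum_of_bool_card[OF finite_atLeastLessThan_int] mult_1_right)
  then show ?thesis using card_residue_class[of n 1 t] assms(2) True by simp
qed

text \<open>Slicing along one prime \<open>q\<close>: the slices above \<open>y + Q z\<close> contain a class modulo the
  \<open>q\<close>-free part \<open>k'\<close> of \<open>k\<close> for at least the proportion \<open>q\<^sup>-\<^sup>v\<close> of the \<open>z\<close>, where \<open>v\<close> is the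
  smallest exponent with \<open>q\<^sup>v k' \<in> K\<close>, whereas \<open>k'\<close> accounts for at most
  \<open>q\<^sup>-\<^sup>v q/(q-1)\<close> of the sum.\<close>

lemma class_sum_le_rel:
  assumes "finite S" "\<forall>p\<in>S. prime p" "N > 0"
  shows "\<lbrakk>finite K; \<forall>k\<in>K. k dvd N \<and> prime_factors k \<subseteq> S; Q dvd N; \<forall>p\<in>S. coprime p Q;
          \<forall>k\<in>K. \<exists>b. \<forall>x. [x = b] (mod int k) \<longrightarrow> [x = y] (mod int Q) \<longrightarrow> x \<in> U\<rbrakk>
    \<Longrightarrow> (\<Sum>k\<in>K. 1 / real k)
        \<le> euler_prod S * real Q * avg N (\<lambda>x. of_bool (x \<in> U) * of_bool ([x = y] (mod int Q)))"
  using assms(1,2)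
proof (induction S arbitrary: K Q y rule: finite_induct)
  case empty
  have Q: "Q > 0" using empty.prems(3) assms(3) by (metis dvd_0_left_iff gr0I)
  have K: "K \<subseteq> {1}"
  proof
    fix k assume "k \<in> K"
    then have "k > 0" "prime_factors k = {}" using empty.prems(2) assms(3) by (auto intro: dvd_pos_nat)
    then show "k \<in> {1}" by (simp add: prime_factorization_empty_iff)
  qed
  show ?case
  proof (cases "K = {}")
    case True
    then show ?thesis by (auto simp: euler_prod_def intro!: mult_nonneg_nonneg avg_nonneg)
  next
    case False
    with K have K1: "K = {1}" by auto
    then have "\<forall>x. [x = y] (mod int Q) \<longrightarrow> x \<in> U" using empty.prems(5) by simp
    then have "avg N (\<lambda>x. of_bool (x \<in> U) * of_bool ([x = y] (mod int Q)))
       = avg N (\<lambda>x. of_bool ([x = y] (mod int Q)))"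
      by (intro arg_cong[where f = "avg N"] ext) (auto simp: of_bool_def)
    also have "\<dots> = 1 / real Q" by (rule avg_class[OF empty.prems(3) assms(3)])
    finally show ?thesis using K1 Q by (simp add: euler_prod_def)
  qed
next
  case (insert q S)
  note IH = insert.IH
  have q: "prime q" and S: "\<forall>p\<in>S. prime p" using insert.prems by auto
  have q1: "q > 1" using q by (rule prime_gt_1_nat)
  have Q: "Q > 0" using insert.prems(3) assms(3) by (metis dvd_0_left_iff gr0I)
  \<comment> \<open>The full power of \<open>q\<close> in \<open>N\<close>, so that slicing modulo
    \<open>q ^ e\<close> resolves the \<open>q\<close>-part of every \<open>k\<close> in
    \<open>K\<close> at once.\<close>
  define e where "e = multiplicity q N"
  define v where "v k = multiplicity q k" for k
  define c where "c k = k div q ^ v k" for k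
  have kpos: "k > 0" if "k \<in> K" for k using insert.prems(2) assms(3) that by (auto intro: dvd_pos_nat)
  have kfac: "k = q ^ v k * c k" "c k > 0" "prime_factors (c k) \<subseteq> S" "coprime q (c k)" if "k \<in> K" for k
    using prime_factors_div_power[OF q kpos[OF that], of S] insert.prems(2) insert.hyps(2) that
    unfolding v_def c_def by auto
  have ve: "v k \<le> e" if "k \<in> K" for k
    unfolding v_def e_def using insert.prems(2) that assms(3) by (intro dvd_imp_multiplicity_le) auto
  have cdvd: "c k dvd N" if "k \<in> K" for k
    using kfac(1)[OF that] insert.prems(2) that by (metis dvd_mult_right)
  from insert.prems(5) obtain b where
    b: "\<And>k x. k \<in> K \<Longrightarrow> [x = b k] (mod int k) \<Longrightarrow> [x = y] (mod int Q) \<Longrightarrow> x \<in> U"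
    by metis
  have copqQ: "coprime q Q" using insert.prems(4) by simp
  have Qe: "Q * q ^ e dvd N"
  proof (rule divides_mult)
    show "Q dvd N" by fact
    show "q ^ e dvd N" unfolding e_def by (rule multiplicity_dvd)
    show "coprime Q (q ^ e)" using copqQ by (simp add: coprime_commute)
  qed
  \<comment> \<open>\<open>J z\<close> holds the \<open>q\<close>-free parts whose class is seen on
    the slice above \<open>y + Q z\<close>; the induction hypothesis applies to that slice, with
    \<open>Q * q ^ e\<close> in place of \<open>Q\<close>.\<close>
  define J where "J z = c ` {k\<in>K. [y + int Q * z = b k] (mod int (q ^ v k))}" for z
  define F where "F x = (of_bool (x \<in> U) :: real)" for x
  have step: "(\<Sum>k\<in>J z. 1 / real k) \<le> euler_prod S * real (Q * q ^ e)
      * avg N (\<lambda>x. F x * of_bool ([x = y + int Q * z] (mod int (Q * q ^ e))))" for z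
    unfolding F_def
  proof (rule IH)
    show "finite (J z)" unfolding J_def using insert.prems(1) by auto
    show "\<forall>k\<in>J z. k dvd N \<and> prime_factors k \<subseteq> S" unfolding J_def using cdvd kfac(3) by auto
    show "Q * q ^ e dvd N" by fact
    show "\<forall>p\<in>S. coprime p (Q * q ^ e)"
    proof
      fix p assume p: "p \<in> S"
      then have "p \<noteq> q" using insert.hyps(2) by auto
      then have "coprime p q" using p S q by (simp add: primes_coprime)
      then show "coprime p (Q * q ^ e)" using insert.prems(4) p by simp
    qed
    show "\<forall>k\<in>J z. \<exists>b. \<forall>x. [x = b] (mod int k) \<longrightarrow>
        [x = y + int Q * z] (mod int (Q * q ^ e)) \<longrightarrow> x \<in> U"
    proof
      fix k' assume "k' \<in> J z"
      then obtain k where k: "k \<in> K" "[y + int Q * z = b k] (mod int (q ^ v k))" "k' = c k"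
        unfolding J_def by auto
      have "x \<in> U" if x: "[x = b k] (mod int k')" "[x = y + int Q * z] (mod int (Q * q ^ e))" for x
      proof (rule b[OF k(1)])
        have "q ^ v k dvd Q * q ^ e" using ve[OF k(1)] by (simp add: le_imp_power_dvd)
        then have "[x = y + int Q * z] (mod int (q ^ v k))"
          using x(2) cong_dvd_modulus by (metis of_nat_dvd_iff)
        then have 1: "[x = b k] (mod int (q ^ v k))" using k(2) cong_trans by blast
        have cop: "coprime (int (q ^ v k)) (int k')" using kfac(4)[OF k(1)] k(3) by simp
        have "int (q ^ v k) * int k' dvd x - b k"
          using 1 x(1) cop by (intro divides_mult) (auto simp: cong_iff_dvd_diff)
        also have "int (q ^ v k) * int k' = int k" using kfac(1)[OF k(1)] k(3) by (metis of_nat_mult)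
        finally show "[x = b k] (mod int k)" by (simp add: cong_iff_dvd_diff)
        have "[x = y + int Q * z] (mod int Q)"
          using x(2) by (rule cong_dvd_modulus) simp
        also have "[y + int Q * z = y] (mod int Q)" by (simp add: int_cong_def)
        finally show "[x = y] (mod int Q)" .
      qed
      then show "\<exists>b. \<forall>x. [x = b] (mod int k') \<longrightarrow>
        [x = y + int Q * z] (mod int (Q * q ^ e)) \<longrightarrow> x \<in> U" by blast
    qed
  qed (use S in auto)
  let ?Z = "{0..<int (q ^ e)}"
  have upper: "(\<Sum>z\<in>?Z. \<Sum>k\<in>J z. 1 / real k)
      \<le> euler_prod S * real (Q * q ^ e) * avg N (\<lambda>x. F x * of_bool ([x = y] (mod int Q)))"
  proof -
    have "(\<Sum>z\<in>?Z. \<Sum>k\<in>J z. 1 / real k) \<le> (\<Sum>z\<in>?Z. euler_prod S * real (Q * q ^ e)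
      * avg N (\<lambda>x. F x * of_bool ([x = y + int Q * z] (mod int (Q * q ^ e)))))"
      by (intro sum_mono step)
    also have "\<dots> = euler_prod S * real (Q * q ^ e)
      * avg N (\<lambda>x. \<Sum>z\<in>?Z. F x * of_bool ([x = y + int Q * z] (mod int (Q * q ^ e))))"
      by (simp only: avg_sum sum_distrib_left)
    also have "(\<lambda>x. \<Sum>z\<in>?Z. F x * of_bool ([x = y + int Q * z] (mod int (Q * q ^ e))))
       = (\<lambda>x. F x * of_bool ([x = y] (mod int Q)))"
      using cong_class_split[of Q "q ^ e"] Q q1 by (simp flip: sum_distrib_left)
    finally show ?thesis .
  qed
  define vm where "vm k' = Min (v ` {k\<in>K. c k = k'})" for k'
  have vm: "\<exists>k\<in>K. c k = k' \<and> v k = vm k'" if "k' \<in> c ` K" for k'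
  proof -
    have "vm k' \<in> v ` {k\<in>K. c k = k'}" unfolding vm_def
      using that insert.prems(1) by (intro Min_in) auto
    then show ?thesis by auto
  qed
  have vm_le: "vm k' \<le> v k" if "k \<in> K" "c k = k'" for k k'
    unfolding vm_def using that insert.prems(1) by (intro Min_le) auto
  have lower: "(\<Sum>k'\<in>c ` K. 1 / real k' * real (q ^ (e - vm k'))) \<le> (\<Sum>z\<in>?Z. \<Sum>k\<in>J z. 1 / real k)"
  proof -
    have JK: "J z \<subseteq> c ` K" for z unfolding J_def by auto
    have fcK: "finite (c ` K)" using insert.prems(1) by simp
    have "(\<Sum>z\<in>?Z. \<Sum>k\<in>J z. 1 / real k) = (\<Sum>z\<in>?Z. \<Sum>k\<in>c ` K. 1 / real k * of_bool (k \<in> J z))"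
    proof (rule sum.cong[OF refl])
      fix z
      have "(\<Sum>k\<in>J z. 1 / real k) = (\<Sum>k\<in>c ` K \<inter> J z. 1 / real k)"
        using JK by (simp add: Int_absorb1)
      then show "(\<Sum>k\<in>J z. 1 / real k) = (\<Sum>k\<in>c ` K. 1 / real k * of_bool (k \<in> J z))"
        using fcK by (simp add: sum.inter_restrict of_bool_def if_distrib cong: if_cong)
    qed
    also have "\<dots> = (\<Sum>k\<in>c ` K. 1 / real k * (\<Sum>z\<in>?Z. of_bool (k \<in> J z)))"
      unfolding sum_distrib_left by (rule sum.swap)
    also have "\<dots> \<ge> (\<Sum>k'\<in>c ` K. 1 / real k' * real (q ^ (e - vm k')))"
    proof (intro sum_mono mult_left_mono)
      fix k' assume "k' \<in> c ` K"
      then obtain k where k: "k \<in> K" "c k = k'" "v k = vm k'" using vm by blast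
      have "q ^ (e - vm k') = card {z\<in>?Z. [y + int Q * z = b k] (mod int (q ^ v k))}"
        using card_fibre_class[of Q q "v k" e y "b k"] copqQ ve[OF k(1)] q1 k(3)
        by (simp add: coprime_commute)
      also have "\<dots> \<le> card {z\<in>?Z. k' \<in> J z}"
        unfolding J_def using k by (intro card_mono finite_Collect_conjI disjI1) auto
      finally show "real (q ^ (e - vm k')) \<le> (\<Sum>z\<in>?Z. of_bool (k' \<in> J z))"
        by (subst sum_of_bool_card) auto
    qed auto
    finally show ?thesis .
  qed
  have "(\<Sum>k\<in>K. 1 / real k) = (\<Sum>k'\<in>c ` K. \<Sum>k\<in>{k\<in>K. c k = k'}. 1 / real k)"
    using insert.prems(1) by (rule sum.image_gen)
  also have "\<dots> \<le> (\<Sum>k'\<in>c ` K. 1 / real k' * (1 / real q ^ vm k' * (real q / (real q - 1))))"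
  proof (rule sum_mono)
    fix k' assume k': "k' \<in> c ` K"
    have inj: "inj_on v {k\<in>K. c k = k'}"
      by (rule inj_onI) (metis (mono_tags, lifting) kfac(1) mem_Collect_eq)
    have "(\<Sum>k\<in>{k\<in>K. c k = k'}. 1 / real k) = (\<Sum>k\<in>{k\<in>K. c k = k'}. 1 / real k' * (1 / real q ^ v k))"
    proof (rule sum.cong[OF refl])
      fix k assume "k \<in> {k\<in>K. c k = k'}"
      then have "real k = real q ^ v k * real k'"
        using kfac(1)[of k] by (metis (mono_tags, lifting) mem_Collect_eq of_nat_mult of_nat_power)
      then show "1 / real k = 1 / real k' * (1 / real q ^ v k)" by simp
    qed
    also have "\<dots> = 1 / real k' * (\<Sum>u\<in>v ` {k\<in>K. c k = k'}. 1 / real q ^ u)"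
      by (simp add: sum.reindex[OF inj] sum_distrib_left)
    also have "\<dots> \<le> 1 / real k' * (1 / real q ^ vm k' * (real q / (real q - 1)))"
      using q1 insert.prems(1) vm_le by (intro mult_left_mono geometric_le) auto
    finally show "(\<Sum>k\<in>{k\<in>K. c k = k'}. 1 / real k) \<le> \<dots>" .
  qed
  also have "\<dots> = (real q / (real q - 1)) / real (q ^ e)
      * (\<Sum>k'\<in>c ` K. 1 / real k' * real (q ^ (e - vm k')))"
    unfolding sum_distrib_left
  proof (rule sum.cong[OF refl])
    fix k' assume "k' \<in> c ` K"
    then have "vm k' \<le> e" using vm ve by metis
    then have "real (q ^ (e - vm k')) = real q ^ e / real q ^ vm k'"
      unfolding of_nat_power using q1 by (subst power_diff) auto
    then show "1 / real k' * (1 / real q ^ vm k' * (real q / (real q - 1)))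
      = (real q / (real q - 1)) / real (q ^ e) * (1 / real k' * real (q ^ (e - vm k')))"
      using q1 by simp
  qed
  also have "\<dots> \<le> (real q / (real q - 1)) / real (q ^ e) *
      (euler_prod S * real (Q * q ^ e) * avg N (\<lambda>x. F x * of_bool ([x = y] (mod int Q))))"
    using q1 by (intro mult_left_mono order.trans[OF lower upper]) auto
  also have "\<dots> = euler_prod (insert q S) * real Q * avg N (\<lambda>x. F x * of_bool ([x = y] (mod int Q)))"
    using insert.hyps q1 by (simp add: euler_prod_def)
  finally show ?case unfolding F_def .
qed

lemma class_sum_le:
  assumes "finite S" "\<forall>p\<in>S. prime p" "N > 0" "finite K"
    and "\<And>k. k \<in> K \<Longrightarrow> k dvd N" "\<And>k. k \<in> K \<Longrightarrow> prime_factors k \<subseteq> S"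
    and "\<And>k. k \<in> K \<Longrightarrow> \<exists>b. \<forall>x. [x = b] (mod int k) \<longrightarrow> x \<in> U"
  shows "(\<Sum>k\<in>K. 1 / real k) \<le> euler_prod S * avg N (\<lambda>x. of_bool (x \<in> U))"
  using class_sum_le_rel[OF assms(1-4), of 1 0 U] assms(5-7) by simp

text \<open>Unique factorization embeds \<open>K\<close> in a finite box of exponent vectors; the
  terms being nonnegative, the sum over the whole box is an upper bound, and it factors as a product
  over the primes.\<close>

lemma smooth_sum_le:
  fixes h :: "nat \<Rightarrow> nat \<Rightarrow> real"
  assumes "finite S" "finite K"
    and K: "\<And>n. n \<in> K \<Longrightarrow> n > 0" "\<And>n. n \<in> K \<Longrightarrow> prime_factors n \<subseteq> S"
    and h: "\<And>p v. p \<in> S \<Longrightarrow> h p v \<ge> 0" "\<And>p V. p \<in> S \<Longrightarrow> (\<Sum>v\<le>V. h p v) \<le> H p"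
  shows "(\<Sum>n\<in>K. \<Prod>p\<in>S. h p (multiplicity p n)) \<le> (\<Prod>p\<in>S. H p)"
proof -
  define V where "V = Max (insert 0 ((\<lambda>(p, n). multiplicity p n) ` (S \<times> K)))"
  define \<phi> where "\<phi> n = (\<lambda>p\<in>S. multiplicity p n)" for n :: nat
  have le: "multiplicity p n \<le> V" if "p \<in> S" "n \<in> K" for p n
    unfolding V_def using that assms(1,2) by (intro Max_ge) force+
  have inj: "inj_on \<phi> K"
  proof (rule inj_onI)
    fix m n assume mn: "m \<in> K" "n \<in> K" "\<phi> m = \<phi> n"
    show "m = n"
    proof (rule multiplicity_eq_nat)
      fix p :: nat assume p: "prime p"
      show "multiplicity p m = multiplicity p n"
      proof (cases "p \<in> S")
        case True
        then show ?thesis using mn(3) unfolding \<phi>_def by (metis restrict_apply')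
      next
        case False
        then have "p \<notin> prime_factors m" "p \<notin> prime_factors n" using K(2) mn by auto
        then have "\<not> p dvd m" "\<not> p dvd n" using K(1) mn p by (auto simp: prime_factors_dvd)
        then show ?thesis by (simp add: not_dvd_imp_multiplicity_0)
      qed
    qed (use K(1) mn in auto)
  qed
  have sub: "\<phi> ` K \<subseteq> PiE S (\<lambda>_. {..V})" unfolding \<phi>_def using le by auto
  have "(\<Sum>n\<in>K. \<Prod>p\<in>S. h p (multiplicity p n)) = (\<Sum>f\<in>\<phi> ` K. \<Prod>p\<in>S. h p (f p))"
    by (subst sum.reindex[OF inj]) (simp add: \<phi>_def)
  also have "\<dots> \<le> (\<Sum>f\<in>PiE S (\<lambda>_. {..V}). \<Prod>p\<in>S. h p (f p))"
    using sub assms(1) h(1) by (intro sum_mono2 finite_PiE prod_nonneg) auto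
  also have "\<dots> = (\<Prod>p\<in>S. \<Sum>v\<le>V. h p v)"
    using assms(1) by (subst prod_sum_PiE) auto
  also have "\<dots> \<le> (\<Prod>p\<in>S. H p)"
    using h by (intro prod_mono conjI sum_nonneg) auto
  finally show ?thesis .
qed

subsection \<open>The distortion method\<close>

definition fibre_density :: "nat \<Rightarrow> nat \<Rightarrow> (int \<Rightarrow> bool) \<Rightarrow> int \<Rightarrow> real" where
  "fibre_density D q B x = (\<Sum>j\<in>{0..<int q}. of_bool (B (x + int D * j))) / real q"

lemma fibre_density_bounds: "q > 0 \<Longrightarrow> 0 \<le> fibre_density D q B x" "q > 0 \<Longrightarrow> fibre_density D q B x \<le> 1"
proof -
  have "(\<Sum>j\<in>{0..<int q}. of_bool (B (x + int D * j)) :: real) \<le> (\<Sum>j\<in>{0..<int q}. 1)"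
    by (intro sum_mono) auto
  then show "q > 0 \<Longrightarrow> fibre_density D q B x \<le> 1" by (simp add: fibre_density_def divide_le_eq_1)
  show "q > 0 \<Longrightarrow> 0 \<le> fibre_density D q B x"
    unfolding fibre_density_def by (intro divide_nonneg_nonneg sum_nonneg) auto
qed

text \<open>Replacing \<open>x\<close> by \<open>x + D t\<close> only shifts the index
  \<open>j\<close> by \<open>t\<close>, and \<open>j\<close> matters only modulo
  \<open>q\<close>.\<close>

lemma periodic_fibre_density:
  assumes "periodic (D * q) B" "q > 0"
  shows "periodic D (fibre_density D q B)"
  unfolding periodic_def
proof (intro allI impI)
  fix x y assume "[x = y] (mod int D)"
  then obtain t where t: "y = x + int D * t" by (metis cong_iff_lin)
  let ?F = "\<lambda>j. of_bool (B (x + int D * j)) :: real"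
  have "periodic q ?F"
    unfolding periodic_def
  proof (intro allI impI)
    fix j k assume "[j = k] (mod int q)"
    then have "int D * int q dvd int D * (j - k)" by (simp add: cong_iff_dvd_diff mult_dvd_mono)
    also have "int D * (j - k) = (x + int D * j) - (x + int D * k)" by (simp add: algebra_simps)
    finally have "[x + int D * j = x + int D * k] (mod int (D * q))" by (simp add: cong_iff_dvd_diff)
    then show "?F j = ?F k" using periodicD[OF assms(1)] by simp
  qed
  then have "(\<Sum>j\<in>{0..<int q}. ?F (j + t)) = (\<Sum>j\<in>{0..<int q}. ?F j)"
    using assms(2) by (rule sum_shift_periodic)
  moreover have "?F (j + t) = of_bool (B (y + int D * j))" for j
    unfolding t by (simp add: algebra_simps)
  ultimately show "fibre_density D q B x = fibre_density D q B y"
    unfolding fibre_density_def by simp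
qed

text \<open>\<open>wt_in\<close> and \<open>wt_out\<close> are the factors on and off
  \<open>B\<close> in a fibre of which \<open>B\<close> has the proportion \<open>t\<close>. Below
  1/2 all weight leaves \<open>B\<close>; from 1/2 on, the factor off \<open>B\<close> is capped at
  2 and the remaining mass 2 t - 1 stays on \<open>B\<close>.\<close>

definition wt_in :: "real \<Rightarrow> real" where "wt_in t = (if t < 1/2 then 0 else (2 * t - 1) / t)"
definition wt_out :: "real \<Rightarrow> real" where "wt_out t = (if t < 1/2 then 1 / (1 - t) else 2)"

lemma wt_balance: "t * wt_in t + (1 - t) * wt_out t = 1"
  by (auto simp: wt_in_def wt_out_def field_simps)

text \<open>The mass left on \<open>B\<close> is 0 or 2 t - 1, and 2 t - 1 \<le> t^2 because (t -
  1)^2 \<ge> 0. This is why second moments control the loss.\<close>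

lemma wt_in_le: "t \<ge> 0 \<Longrightarrow> wt_in t * t \<le> t\<^sup>2"
proof -
  assume t: "t \<ge> 0"
  have "(t - 1)\<^sup>2 \<ge> 0" by simp
  then have "2 * t - 1 \<le> t\<^sup>2" by (simp add: power2_eq_square algebra_simps)
  then show ?thesis using t by (auto simp: wt_in_def)
qed

lemma wt_bounds:
  assumes "0 \<le> t" "t \<le> 1"
  shows "0 \<le> wt_in t" "wt_in t \<le> 2" "0 \<le> wt_out t" "wt_out t \<le> 2"
  using assms by (auto simp: wt_in_def wt_out_def field_simps)

text \<open>One step of the distortion method: the weight is moved, within each fibre, away from \<open>B\<close> as
  far as possible without increasing it by more than the factor 2.\<close>

lemma distortion_step:
  assumes w: "\<And>x. w x \<ge> 0" "periodic D w"
    and N: "D * q dvd N" "N > 0" "q > 0"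
    and B: "periodic (D * q) B"
  obtains w' :: "int \<Rightarrow> real" where
    "\<And>x. w' x \<ge> 0" "periodic (D * q) w'" "\<And>x. w' x \<le> 2 * w x"
    "\<And>\<phi>. periodic D \<phi> \<Longrightarrow> avg N (\<lambda>x. w' x * \<phi> x) = avg N (\<lambda>x. w x * \<phi> x)"
    "avg N (\<lambda>x. w' x * of_bool (B x)) \<le> avg N (\<lambda>x. w x * (fibre_density D q B x)\<^sup>2)"
proof -
  define \<alpha> where "\<alpha> = fibre_density D q B"
  define g where "g x = of_bool (B x) * wt_in (\<alpha> x) + (1 - of_bool (B x)) * wt_out (\<alpha> x)" for x
  have D: "D dvd N" using N(1) by (metis dvd_mult_left)
  have \<alpha>p: "periodic D \<alpha>" unfolding \<alpha>_def by (rule periodic_fibre_density[OF B N(3)])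
  have \<alpha>01: "0 \<le> \<alpha> x" "\<alpha> x \<le> 1" for x unfolding \<alpha>_def using fibre_density_bounds N(3) by auto
  have \<alpha>shift: "\<alpha> (x + int D * j) = \<alpha> x" for x j
    by (rule periodicD[OF \<alpha>p]) (simp add: int_cong_def)
  have g02: "0 \<le> g x" "g x \<le> 2" for x
    unfolding g_def using wt_bounds[OF \<alpha>01] by (auto simp: of_bool_def)
  have gp: "periodic (D * q) g"
    unfolding periodic_def g_def
  proof (intro allI impI)
    fix x y assume xy: "[x = y] (mod int (D * q))"
    then have "B x = B y" "\<alpha> x = \<alpha> y"
      using periodicD[OF B] periodicD[OF periodic_dvd[OF \<alpha>p, of "D * q"]] by auto
    then show "of_bool (B x) * wt_in (\<alpha> x) + (1 - of_bool (B x)) * wt_out (\<alpha> x)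
      = of_bool (B y) * wt_in (\<alpha> y) + (1 - of_bool (B y)) * wt_out (\<alpha> y)" by simp
  qed
  have gN: "periodic N g" using gp N(1) by (rule periodic_dvd)
  have BN: "periodic N (\<lambda>x. of_bool (B x) :: real)"
    using periodic_comp[OF periodic_dvd[OF B N(1)], of of_bool] .
  \<comment> \<open>Mean 1 on every fibre: averages against functions of period \<open>D\<close> are
    unchanged.\<close>
  have mean: "(\<Sum>j\<in>{0..<int q}. g (x + int D * j)) / real q = 1" for x
  proof -
    have "(\<Sum>j\<in>{0..<int q}. g (x + int D * j))
       = (\<Sum>j\<in>{0..<int q}. of_bool (B (x + int D * j)) * (wt_in (\<alpha> x) - wt_out (\<alpha> x)) + wt_out (\<alpha> x))"
      unfolding g_def \<alpha>shift by (intro sum.cong refl) (simp add: algebra_simps)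
    also have "\<dots> = (\<Sum>j\<in>{0..<int q}. of_bool (B (x + int D * j))) * (wt_in (\<alpha> x) - wt_out (\<alpha> x)) + real q
        * wt_out (\<alpha> x)"
      by (simp add: sum.distrib flip: sum_distrib_right)
    also have "\<dots> / real q = \<alpha> x * (wt_in (\<alpha> x) - wt_out (\<alpha> x)) + wt_out (\<alpha> x)"
      using N(3) unfolding \<alpha>_def fibre_density_def by (simp add: add_divide_distrib)
    also have "\<dots> = 1" using wt_balance[of "\<alpha> x"] by (simp add: algebra_simps)
    finally show ?thesis .
  qed
  show ?thesis
  proof (rule that[of "\<lambda>x. w x * g x"])
    show "0 \<le> w x * g x" for x using w g02 by simp
    show "periodic (D * q) (\<lambda>x. w x * g x)"
      by (rule periodic_mult[OF periodic_dvd[OF w(2)] gp]) simp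
    show "w x * g x \<le> 2 * w x" for x
      using mult_left_mono[OF g02(2), of "w x" x] w(1)[of x] by simp
  next
    fix \<phi> :: "int \<Rightarrow> real" assume \<phi>: "periodic D \<phi>"
    have p: "periodic D (\<lambda>x. w x * \<phi> x)" using w(2) \<phi> by (rule periodic_mult)
    have "avg N (\<lambda>x. w x * g x * \<phi> x) = avg N (\<lambda>x. (w x * \<phi> x) * g x)"
      by (simp add: mult_ac)
    also have "\<dots> = avg N (\<lambda>x. (w x * \<phi> x) * ((\<Sum>j\<in>{0..<int q}. g (x + int D * j)) / real q))"
      by (rule avg_fibre[OF p periodic_dvd[OF p D] gN N(2,3)])
    finally show "avg N (\<lambda>x. w x * g x * \<phi> x) = avg N (\<lambda>x. w x * \<phi> x)" by (simp only: mean mult_1_right)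
  next
    have p: "periodic D (\<lambda>x. w x * wt_in (\<alpha> x))" using w(2) periodic_comp[OF \<alpha>p] by (rule periodic_mult)
    have "avg N (\<lambda>x. w x * g x * of_bool (B x)) = avg N (\<lambda>x. (w x * wt_in (\<alpha> x)) * of_bool (B x))"
      unfolding g_def by (intro arg_cong[where f = "avg N"] ext) (simp add: of_bool_def)
    also have "\<dots> = avg N (\<lambda>x. (w x * wt_in (\<alpha> x)) * \<alpha> x)"
      unfolding \<alpha>_def fibre_density_def
      by (rule avg_fibre[OF p[unfolded \<alpha>_def fibre_density_def] periodic_dvd[OF p[unfolded \<alpha>_def fibre_density_def] D] BN N(2,3)])
    also have "\<dots> \<le> avg N (\<lambda>x. w x * (\<alpha> x)\<^sup>2)"
      using w(1) wt_in_le[OF \<alpha>01(1)] by (intro avg_mono) (simp add: mult_left_mono mult.assoc)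
    finally show "avg N (\<lambda>x. w x * g x * of_bool (B x)) \<le> avg N (\<lambda>x. w x * (fibre_density D q B x)\<^sup>2)"
      unfolding \<alpha>_def .
  qed
qed

section \<open>Smooth parts of an integer\<close>

text \<open>The product runs over all primes up to \<open>z\<close>, not over the prime factors of
  \<open>n\<close>, so passing from \<open>z\<close> to \<open>Suc z\<close> either changes nothing
  or multiplies by one full prime power. The induction of the distortion method follows
  this.\<close>

definition smooth_part :: "nat \<Rightarrow> nat \<Rightarrow> nat" where
  "smooth_part z n = (\<Prod>p\<in>{p. prime p \<and> p \<le> z}. p ^ multiplicity p n)"

lemma finite_primes_le [simp, intro]: "finite {p::nat. prime p \<and> p \<le> z}"
  by (rule finite_subset[of _ "{..z}"]) auto

lemma multiplicity_smooth_part: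
  assumes "prime p"
  shows "multiplicity p (smooth_part z n) = (if p \<le> z then multiplicity p n else 0)"
  unfolding smooth_part_def using assms
  by (subst multiplicity_prod_prime_powers) auto

lemma smooth_part_pos [simp]: "smooth_part z n > 0"
  unfolding smooth_part_def by (intro prod_pos) (auto simp: prime_gt_0_nat)

lemma dvd_smooth_part:
  assumes "m dvd n" "n > 0" "prime_factors m \<subseteq> {..z}"
  shows "m dvd smooth_part z n"
proof (rule multiplicity_le_imp_dvd)
  show "m \<noteq> 0" using assms by auto
  fix p :: nat assume p: "prime p"
  show "multiplicity p m \<le> multiplicity p (smooth_part z n)"
  proof (cases "p \<le> z")
    case True
    then show ?thesis using assms p by (simp add: multiplicity_smooth_part dvd_imp_multiplicity_le)
  next
    case False
    then have "\<not> p dvd m" using assms p \<open>m \<noteq> 0\<close> by (auto simp: prime_factors_dvd)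
    then show ?thesis by (simp add: not_dvd_imp_multiplicity_0)
  qed
qed

lemma smooth_part_dvd: "n > 0 \<Longrightarrow> smooth_part z n dvd n"
  by (rule multiplicity_le_imp_dvd) (auto simp: multiplicity_smooth_part less_imp_neq[OF smooth_part_pos, symmetric])

lemma prime_factors_smooth_part: "prime_factors (smooth_part z n) \<subseteq> {p. prime p \<and> p \<le> z}"
proof
  fix p assume p: "p \<in> prime_factors (smooth_part z n)"
  then have "prime p" "multiplicity p (smooth_part z n) > 0" by (auto simp: prime_factors_multiplicity)
  then show "p \<in> {p. prime p \<and> p \<le> z}" by (auto simp: multiplicity_smooth_part split: if_splits)
qed

lemma primes_le_Suc: "{p. prime p \<and> p \<le> Suc z}
    = (if prime (Suc z) then insert (Suc z) {p. prime p \<and> p \<le> z} else {p. prime p \<and> p \<le> z})"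
  using le_Suc_eq by auto

lemma smooth_part_Suc:
  "smooth_part (Suc z) n
      = (if prime (Suc z) then smooth_part z n * Suc z ^ multiplicity (Suc z) n else smooth_part z n)"
  unfolding smooth_part_def by (simp add: primes_le_Suc mult.commute)

lemma coprime_smooth_part: "prime (Suc z) \<Longrightarrow> coprime (smooth_part z n) (Suc z)"
  unfolding smooth_part_def
  by (intro prod_coprime_left) (auto simp: primes_coprime)

text \<open>Each distortion step, one for every prime above \<open>P\<close>, costs a factor 2 in the weight of a class
  modulo \<open>n\<close>.\<close>

definition cell_weight :: "nat \<Rightarrow> nat \<Rightarrow> real" where
  "cell_weight P n = 2 ^ card {p\<in>prime_factors n. p > P} / real n"

definition top_moduli :: "nat set \<Rightarrow> nat \<Rightarrow> nat set" where
  "top_moduli M r = {m\<in>M. r \<in> prime_factors m \<and> prime_factors m \<subseteq> {..r}}"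

definition prime_free :: "nat \<Rightarrow> nat \<Rightarrow> nat" where
  "prime_free r m = m div r ^ multiplicity r m"

text \<open>Bounds the weighted average of the squared density of the classes removed at
  \<open>r\<close>. Expanding the square gives pairs of moduli: their \<open>r\<close>-free parts
  select a cell modulo the lcm, and the powers of \<open>r\<close> are proportions within a
  fibre.\<close>

definition second_moment :: "nat \<Rightarrow> nat set \<Rightarrow> nat \<Rightarrow> real" where
  "second_moment P M r = (\<Sum>m\<in>top_moduli M r. \<Sum>m'\<in>top_moduli M r.
     cell_weight P (lcm (prime_free r m) (prime_free r m')) / real r ^ (multiplicity r m + multiplicity r m'))"

lemma cell_weight_nonneg [simp]: "cell_weight P n \<ge> 0"
  by (simp add: cell_weight_def)

lemma second_moment_nonneg [simp]: "second_moment P M r \<ge> 0"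
  unfolding second_moment_def by (intro sum_nonneg divide_nonneg_nonneg) auto

lemma prime_free_facts:
  assumes "prime r" "m > 0" "prime_factors m \<subseteq> {..r}"
  shows "m = r ^ multiplicity r m * prime_free r m" "prime_free r m > 0"
    "prime_factors (prime_free r m) \<subseteq> {..r - 1}" "coprime r (prime_free r m)"
proof -
  have "prime_factors m \<subseteq> insert r {..r - 1}" using assms(3) by auto
  moreover have "r \<notin> {..r - 1}" using prime_gt_0_nat[OF assms(1)] by auto
  ultimately show "m = r ^ multiplicity r m * prime_free r m" "prime_free r m > 0"
    "prime_factors (prime_free r m) \<subseteq> {..r - 1}" "coprime r (prime_free r m)"
    using prime_factors_div_power[OF assms(1,2), of "{..r - 1}"] unfolding prime_free_def by auto
qed

lemma cong_prime_power_split: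
  fixes c :: nat
  assumes "coprime q c"
  shows "[x = b] (mod int (q * c)) \<longleftrightarrow> [x = b] (mod int q) \<and> [x = b] (mod int c)"
proof
  assume "[x = b] (mod int (q * c))"
  then show "[x = b] (mod int q) \<and> [x = b] (mod int c)"
    by (metis cong_dvd_modulus dvd_triv_left dvd_triv_right of_nat_mult)
next
  assume "[x = b] (mod int q) \<and> [x = b] (mod int c)"
  then show "[x = b] (mod int (q * c))"
    using assms by (simp add: cong_iff_dvd_diff divides_mult)
qed

lemma of_bool_le_sum:
  assumes "finite T" "m \<in> T" "P m"
  shows "(1 :: real) \<le> (\<Sum>m\<in>T. of_bool (P m))"
  using member_le_sum[of m T "\<lambda>m. of_bool (P m) :: real"] assms by auto

text \<open>Union bound. The class of \<open>m\<close> meets the fibre of \<open>x\<close> only if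
  \<open>x\<close> lies in it modulo the \<open>r\<close>-free part of \<open>m\<close>, and then in
  the proportion r^(-v), where v is the exponent of \<open>r\<close> in \<open>m\<close>.\<close>

lemma fibre_density_classes_le:
  assumes T: "finite T" "\<And>m. m \<in> T \<Longrightarrow> m dvd N \<and> prime_factors m \<subseteq> {..Suc z}"
    and z: "prime (Suc z)" "N > 0"
  defines "r \<equiv> Suc z"
  shows "fibre_density (smooth_part z N) (r ^ multiplicity r N) (\<lambda>x. \<exists>m\<in>T. [x = a m] (mod int m)) x
     \<le> (\<Sum>m\<in>T. of_bool ([x = a m] (mod int (prime_free r m))) / real r ^ multiplicity r m)"
proof -
  define D where "D = smooth_part z N"
  define e where "e = multiplicity r N"
  have r: "prime r" using z r_def by simp
  have r0: "r > 0" using prime_gt_0_nat[OF r] .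
  have each: "(\<Sum>j\<in>{0..<int (r ^ e)}. of_bool ([x + int D * j = a m] (mod int m)))
      = of_bool ([x = a m] (mod int (prime_free r m))) * real r ^ (e - multiplicity r m)" if "m \<in> T" for m
  proof -
    have m: "m > 0" "m dvd N" "prime_factors m \<subseteq> {..r}"
      using T(2)[OF that] z(2) r_def by (auto intro: dvd_pos_nat)
    note pf = prime_free_facts[OF r m(1,3)]
    let ?c = "prime_free r m" and ?v = "multiplicity r m"
    have ve: "?v \<le> e" unfolding e_def using m z(2) by (intro dvd_imp_multiplicity_le) auto
    have "?c dvd D" unfolding D_def
      using pf m z(2) r_def by (intro dvd_smooth_part) (auto, metis dvd_mult_right)
    then have "[x + int D * j = x] (mod int ?c)" for j by (simp add: cong_iff_dvd_diff)
    then have c: "[x + int D * j = a m] (mod int ?c) \<longleftrightarrow> [x = a m] (mod int ?c)" for j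
      using cong_trans cong_sym by blast
    have "[x + int D * j = a m] (mod int m) \<longleftrightarrow>
       [x = a m] (mod int ?c) \<and> [x + int D * j = a m] (mod int (r ^ ?v))" for j
      using cong_prime_power_split[of "r ^ ?v" ?c "x + int D * j" "a m"] pf(1,4) c[of j] by auto
    then have "(\<Sum>j\<in>{0..<int (r ^ e)}. of_bool ([x + int D * j = a m] (mod int m)) :: real)
      = of_bool ([x = a m] (mod int ?c)) * (\<Sum>j\<in>{0..<int (r ^ e)}. of_bool ([x + int D * j = a m] (mod int (r ^ ?v))))"
      by (simp only: of_bool_conj sum_distrib_left)
    also have "(\<Sum>j\<in>{0..<int (r ^ e)}. of_bool ([x + int D * j = a m] (mod int (r ^ ?v))) :: real)
        = real (r ^ (e - ?v))"
      using card_fibre_class[of D r ?v e x "a m"] coprime_smooth_part[OF z(1), of N] ve r0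
      by (subst sum_of_bool_card) (auto simp: D_def r_def)
    finally show ?thesis by simp
  qed
  have "(\<Sum>j\<in>{0..<int (r ^ e)}. of_bool (\<exists>m\<in>T. [x + int D * j = a m] (mod int m)) :: real)
     \<le> (\<Sum>j\<in>{0..<int (r ^ e)}. \<Sum>m\<in>T. of_bool ([x + int D * j = a m] (mod int m)))"
  proof (rule sum_mono)
    fix j
    have "of_bool (\<exists>m\<in>T. P m) \<le> (\<Sum>m\<in>T. of_bool (P m) :: real)" for P
      using of_bool_le_sum[OF T(1)] by (cases "\<exists>m\<in>T. P m") (auto intro: sum_nonneg)
    then show "(of_bool (\<exists>m\<in>T. [x + int D * j = a m] (mod int m)) :: real)
        \<le> (\<Sum>m\<in>T. of_bool ([x + int D * j = a m] (mod int m)))" .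
  qed
  also have "\<dots> = (\<Sum>m\<in>T. of_bool ([x = a m] (mod int (prime_free r m)))
      * real r ^ (e - multiplicity r m))"
    by (subst sum.swap) (intro sum.cong refl each)
  finally have "fibre_density D (r ^ e) (\<lambda>x. \<exists>m\<in>T. [x = a m] (mod int m)) x
     \<le> (\<Sum>m\<in>T. of_bool ([x = a m] (mod int (prime_free r m))) * real r ^ (e - multiplicity r m)) / real (r ^ e)"
    unfolding fibre_density_def using r0 by (intro divide_right_mono) auto
  also have "\<dots> = (\<Sum>m\<in>T. of_bool ([x = a m] (mod int (prime_free r m))) / real r ^ multiplicity r m)"
    unfolding sum_divide_distrib
  proof (rule sum.cong[OF refl])
    fix m assume "m \<in> T"
    then have "multiplicity r m \<le> e"
      unfolding e_def using T(2) z(2) by (intro dvd_imp_multiplicity_le) auto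
    then show "of_bool ([x = a m] (mod int (prime_free r m)))
        * real r ^ (e - multiplicity r m) / real (r ^ e)
      = of_bool ([x = a m] (mod int (prime_free r m))) / real r ^ multiplicity r m"
      using r0 by (simp add: power_diff)
  qed
  finally show ?thesis unfolding D_def e_def .
qed

lemma cell_weight_prime_power:
  assumes "prime r" "r > P" "v > 0" "coprime r n" "n > 0"
  shows "cell_weight P (r ^ v * n) = 2 / real r ^ v * cell_weight P n"
proof -
  have "prime_factors (r ^ v) = {r}"
    using assms(1,3) by (simp add: prime_factorization_prime_power)
  then have "prime_factors (r ^ v * n) = insert r (prime_factors n)"
    using assms(1,5) prime_factors_product[of "r ^ v" n] prime_gt_0_nat[OF assms(1)] by simp
  then have "{p \<in> prime_factors (r ^ v * n). p > P} = insert r {p \<in> prime_factors n. p > P}"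
    using assms(2) by auto
  moreover have "r \<notin> prime_factors n"
    using assms(1,4) by (metis coprime_absorb_left in_prime_factors_iff not_prime_unit)
  ultimately have "card {p \<in> prime_factors (r ^ v * n). p > P}
      = Suc (card {p \<in> prime_factors n. p > P})"
    by simp
  then show ?thesis by (simp add: cell_weight_def)
qed

text \<open>Expanding the square gives pairs of classes; two classes are disjoint or meet in one
  class modulo the lcm, whose weight \<open>cell\<close> bounds.\<close>

lemma weighted_second_moment_le:
  fixes w :: "int \<Rightarrow> real"
  assumes w: "\<And>x. w x \<ge> 0"
    and cell: "\<And>L c. L dvd D \<Longrightarrow> avg N (\<lambda>x. w x * of_bool ([x = c] (mod int L))) \<le> cell_weight P L"
    and T: "\<And>m. m \<in> T \<Longrightarrow> c m dvd D" "\<And>m. m \<in> T \<Longrightarrow> u m \<ge> 0"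
    and f: "\<And>x. 0 \<le> f x" "\<And>x. f x \<le> (\<Sum>m\<in>T. of_bool ([x = a m] (mod int (c m))) * u m)"
  shows "avg N (\<lambda>x. w x * (f x)\<^sup>2) \<le> (\<Sum>m\<in>T. \<Sum>m'\<in>T. cell_weight P (lcm (c m) (c m')) * (u m * u m'))"
proof -
  let ?I = "\<lambda>m x. of_bool ([x = a m] (mod int (c m))) :: real"
  have "avg N (\<lambda>x. w x * (f x)\<^sup>2) \<le> avg N (\<lambda>x. \<Sum>m\<in>T. \<Sum>m'\<in>T. (u m * u m') * (w x * (?I m x * ?I m' x)))"
  proof (rule avg_mono)
    fix x
    have "(f x)\<^sup>2 \<le> (\<Sum>m\<in>T. ?I m x * u m)\<^sup>2" using f by (intro power_mono) auto
    then have "w x * (f x)\<^sup>2 \<le> w x * (\<Sum>m\<in>T. ?I m x * u m)\<^sup>2" by (intro mult_left_mono w)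
    also have "\<dots> = (\<Sum>m\<in>T. \<Sum>m'\<in>T. (u m * u m') * (w x * (?I m x * ?I m' x)))"
      by (simp add: power2_eq_square sum_product sum_distrib_left mult_ac)
    finally show "w x * (f x)\<^sup>2 \<le> \<dots>" .
  qed
  also have "\<dots> = (\<Sum>m\<in>T. \<Sum>m'\<in>T. (u m * u m') * avg N (\<lambda>x. w x * (?I m x * ?I m' x)))"
    by (simp only: avg_sum avg_cmult)
  also have "\<dots> \<le> (\<Sum>m\<in>T. \<Sum>m'\<in>T. (u m * u m') * cell_weight P (lcm (c m) (c m')))"
  proof (intro sum_mono mult_left_mono)
    fix m m' assume m: "m \<in> T" "m' \<in> T"
    show "avg N (\<lambda>x. w x * (?I m x * ?I m' x)) \<le> cell_weight P (lcm (c m) (c m'))"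
    proof (cases "\<exists>x0. [x0 = a m] (mod int (c m)) \<and> [x0 = a m'] (mod int (c m'))")
      case True
      then obtain x0 where x0: "[x0 = a m] (mod int (c m))" "[x0 = a m'] (mod int (c m'))" by blast
      have "avg N (\<lambda>x. w x * (?I m x * ?I m' x))
          \<le> avg N (\<lambda>x. w x * of_bool ([x = x0] (mod int (lcm (c m) (c m')))))"
      proof (intro avg_mono mult_left_mono w)
        fix x
        show "?I m x * ?I m' x \<le> of_bool ([x = x0] (mod int (lcm (c m) (c m'))))"
        proof (cases "[x = a m] (mod int (c m)) \<and> [x = a m'] (mod int (c m'))")
          case True
          then have "[x = x0] (mod int (c m))" "[x = x0] (mod int (c m'))"
            using x0 cong_sym cong_trans by blast+
          then have "[x = x0] (mod int (lcm (c m) (c m')))"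
            by (simp add: cong_iff_dvd_diff flip: lcm_int_int_eq)
          then show ?thesis by simp
        qed auto
      qed
      also have "\<dots> \<le> cell_weight P (lcm (c m) (c m'))"
        by (rule cell) (use T m in \<open>auto intro: lcm_least\<close>)
      finally show ?thesis .
    next
      case False
      have "?I m x * ?I m' x = 0" for x
      proof -
        from False have "\<not> [x = a m] (mod int (c m)) \<or> \<not> [x = a m'] (mod int (c m'))" by blast
        then show ?thesis by (elim disjE) simp_all
      qed
      then have "(\<lambda>x. w x * (?I m x * ?I m' x)) = (\<lambda>x. 0)" by (simp only: mult_zero_right)
      then have "avg N (\<lambda>x. w x * (?I m x * ?I m' x)) = 0" by (simp only: avg_def) simp
      then show ?thesis by simp
    qed
    show "0 \<le> u m * u m'" using T m by simp
  qed
  finally show ?thesis by (simp add: mult_ac)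
qed

lemma periodic_class_union:
  "(\<And>m. m \<in> T \<Longrightarrow> m dvd D) \<Longrightarrow> periodic D (\<lambda>x. \<exists>m\<in>T. [x = a m] (mod int m))"
  unfolding periodic_def
proof (intro allI impI bex_cong refl)
  fix x y m assume *: "\<And>m. m \<in> T \<Longrightarrow> m dvd D" "[x = y] (mod int D)" "m \<in> T"
  show "[x = a m] (mod int m) \<longleftrightarrow> [y = a m] (mod int m)"
    by (rule periodicD[OF periodic_cong_class[OF *(1)[OF *(3)]] *(2)])
qed

abbreviation primes_between :: "nat \<Rightarrow> nat \<Rightarrow> nat set" where
  "primes_between P z \<equiv> {r. prime r \<and> P < r \<and> r \<le> z}"

abbreviation covered :: "nat set \<Rightarrow> (nat \<Rightarrow> int) \<Rightarrow> nat \<Rightarrow> int \<Rightarrow> bool" where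
  "covered M a z x \<equiv> \<exists>m\<in>{m\<in>M. prime_factors m \<subseteq> {..z}}. [x = a m] (mod int m)"

text \<open>Induction on \<open>z\<close>, with one distortion step at each prime. Besides the
  covered weight, the invariant carries what the next step consumes: the period, and the bound on
  cells, from which the next second moment is estimated. Keeping the zeros of \<open>w0\<close>
  confines the weight to the set it starts from, and keeping the total preserves its
  density.\<close>

lemma distortion:
  fixes w0 :: "int \<Rightarrow> real"
  assumes M: "finite M" "\<And>m. m \<in> M \<Longrightarrow> m dvd N" "N > 0" "\<And>m. m \<in> M \<Longrightarrow> \<not> prime_factors m \<subseteq> {..P}"
    and w0: "\<And>x. 0 \<le> w0 x" "\<And>x. w0 x \<le> 1" "periodic (smooth_part P N) w0"
    and z: "P \<le> z"
  shows "\<exists>w :: int \<Rightarrow> real. (\<forall>x. 0 \<le> w x) \<and> periodic (smooth_part z N) w \<and> (\<forall>x. w0 x = 0 \<longrightarrow> w x = 0)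
     \<and> avg N w = avg N w0
     \<and> (\<forall>L c. L dvd smooth_part z N \<longrightarrow> avg N (\<lambda>x. w x * of_bool ([x = c] (mod int L))) \<le> cell_weight P L)
     \<and> avg N (\<lambda>x. w x * of_bool (covered M a z x))
        \<le> (\<Sum>r\<in>primes_between P z. second_moment P M r)"
  using z
proof (induction z rule: dec_induct)
  case base
  have e: "{m\<in>M. prime_factors m \<subseteq> {..P}} = {}" using M(4) by auto
  have "0 \<le> (\<Sum>r\<in>primes_between P P. second_moment P M r)"
    by (intro sum_nonneg) simp
  moreover have "avg N (\<lambda>x. w0 x * of_bool ([x = c] (mod int L))) \<le> cell_weight P L"
    if "L dvd smooth_part P N" for L c
  proof -
    have "L dvd N" using that smooth_part_dvd[OF M(3)] dvd_trans by blast
    have "{p\<in>prime_factors L. p > P} = {}"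
      using prime_factors_smooth_part[of P N] dvd_prime_factors[OF _ that] smooth_part_pos[of P N]
        by force
    then have "cell_weight P L = 1 / real L" by (simp only: cell_weight_def) simp
    also have "1 / real L = avg N (\<lambda>x. of_bool ([x = c] (mod int L)))"
      using avg_class[OF \<open>L dvd N\<close> M(3)] by simp
    finally show ?thesis using w0(1,2) by (auto intro!: avg_mono simp: of_bool_def)
  qed
  moreover have "avg N (\<lambda>x. w0 x * of_bool (covered M a P x)) = 0"
    unfolding e by (simp add: avg_def)
  ultimately show ?case
    using w0(1,3) by (intro exI[of _ w0] conjI allI impI) (assumption | rule refl | blast | linarith)+
next
  case (step z)
  from step.IH obtain w :: "int \<Rightarrow> real" where
    w: "\<And>x. 0 \<le> w x" "periodic (smooth_part z N) w" "\<And>x. w0 x = 0 \<Longrightarrow> w x = 0" "avg N w = avg N w0"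
    and cell: "\<And>L c. L dvd smooth_part z N
        \<Longrightarrow> avg N (\<lambda>x. w x * of_bool ([x = c] (mod int L))) \<le> cell_weight P L"
    and loss: "avg N (\<lambda>x. w x * of_bool (covered M a z x))
        \<le> (\<Sum>r\<in>primes_between P z. second_moment P M r)"
    by blast
  show ?case
  proof (cases "prime (Suc z)")
    case False
    have sub: "prime_factors m \<subseteq> {..Suc z} \<longleftrightarrow> prime_factors m \<subseteq> {..z}" for m :: nat
      using False le_Suc_eq by (auto simp: subset_iff in_prime_factors_iff)
    have "primes_between P (Suc z) = primes_between P z"
      using False le_Suc_eq by auto
    note rs = this
    have sp: "smooth_part (Suc z) N = smooth_part z N" using False by (simp add: smooth_part_Suc)
    show ?thesis unfolding rs sp sub by (rule step.IH)
  next
    case True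
    define r where "r = Suc z"
    define D where "D = smooth_part z N"
    define e where "e = multiplicity r N"
    define T where "T = top_moduli M r"
    define B where "B x \<longleftrightarrow> (\<exists>m\<in>T. [x = a m] (mod int m))" for x
    have r: "prime r" "r > 0" "r > P" using True step.hyps by (auto simp: r_def)
    have Dr: "smooth_part (Suc z) N = D * r ^ e"
      using True by (simp add: smooth_part_Suc D_def r_def e_def)
    have copDr: "coprime D r" using coprime_smooth_part[OF True] by (simp add: D_def r_def)
    have dN: "D * r ^ e dvd N" using smooth_part_dvd[OF M(3), of "Suc z"] Dr by simp
    have re: "r ^ e > 0" using r(2) by simp
    have DN: "D dvd N" using dN by (metis dvd_mult_left)
    have T: "m dvd N" "m > 0" "prime_factors m \<subseteq> {..Suc z}" "r \<in> prime_factors m" if "m \<in> T" for m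
      using that M(2,3) unfolding T_def top_moduli_def r_def by (auto intro: dvd_pos_nat)
    have fT: "finite T" unfolding T_def top_moduli_def using M(1) by auto
    have Bper: "periodic (D * r ^ e) B"
      unfolding B_def using T dvd_smooth_part M(3) Dr by (intro periodic_class_union) metis
    obtain w' :: "int \<Rightarrow> real" where w': "\<And>x. w' x \<ge> 0" "periodic (D * r ^ e) w'" "\<And>x. w' x \<le> 2 * w x"
      and keep: "\<And>\<phi>. periodic D \<phi> \<Longrightarrow> avg N (\<lambda>x. w' x * \<phi> x) = avg N (\<lambda>x. w x * \<phi> x)"
      and lossB: "avg N (\<lambda>x. w' x * of_bool (B x)) \<le> avg N (\<lambda>x. w x * (fibre_density D (r ^ e) B x)\<^sup>2)"
    proof (rule distortion_step[OF w(1) w(2)[folded D_def] dN M(3) re Bper], goal_cases)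
      case (1 w')
      show ?case by (rule 1(1)[OF 1(2) 1(3) 1(4) 1(5) 1(6)])
    qed
    \<comment> \<open>If \<open>r\<close> does not divide \<open>L\<close>, the cell has period
      \<open>D\<close> and its weight is unchanged. Otherwise \<open>w'\<close> is at most
      \<open>2 * w\<close>, and \<open>w\<close>, being constant on fibres, is equidistributed
      modulo the powers of \<open>r\<close>.\<close>
    have cell': "avg N (\<lambda>x. w' x * of_bool ([x = c] (mod int L))) \<le> cell_weight P L"
      if L: "L dvd D * r ^ e" for L c
    proof -
      define v where "v = multiplicity r L"
      define L' where "L' = prime_free r L"
      have "L dvd N" using L dN dvd_trans by blast
      then have L0: "L > 0" using M(3) by (auto intro: dvd_pos_nat)
      have Lr: "prime_factors L \<subseteq> {..r}"
      proof -
        have "prime_factors L \<subseteq> prime_factors (smooth_part (Suc z) N)"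
          using L Dr smooth_part_pos[of "Suc z" N] by (intro dvd_prime_factors) auto
        also have "\<dots> \<subseteq> {..r}" using prime_factors_smooth_part[of "Suc z" N] unfolding r_def by auto
        finally show ?thesis .
      qed
      note pf = prime_free_facts[OF r(1) L0 Lr, folded v_def L'_def]
      have L'D: "L' dvd D"
        unfolding D_def
      proof (rule dvd_smooth_part)
        show "L' dvd N" using pf(1) \<open>L dvd N\<close> by (metis dvd_mult_right)
        show "prime_factors L' \<subseteq> {..z}" using pf(3) by (simp add: r_def)
      qed (rule M(3))
      have pD: "periodic D (\<lambda>x. of_bool ([x = c] (mod int L')) :: real)"
        using periodic_comp[OF periodic_cong_class[OF L'D]] .
      show ?thesis
      proof (cases "v = 0")
        case True
        then have "L = L'" using pf(1) by simp
        then show ?thesis using keep[OF pD] cell[of L' c] L'D by (simp add: D_def)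
      next
        case False
        have ve: "v \<le> e" unfolding v_def e_def
          using \<open>L dvd N\<close> M(3) by (intro dvd_imp_multiplicity_le) auto
        let ?A = "\<lambda>x. of_bool ([x = c] (mod int L')) :: real"
        let ?R = "\<lambda>x. of_bool ([x = c] (mod int (r ^ v))) :: real"
        have pR: "periodic N ?R"
          by (rule periodic_comp[OF periodic_cong_class]) (metis pf(1) \<open>L dvd N\<close> dvd_mult_left)
        have pwA: "periodic D (\<lambda>x. w x * ?A x)" using w(2) pD unfolding D_def by (rule periodic_mult)
        have "avg N (\<lambda>x. w' x * of_bool ([x = c] (mod int L))) \<le> avg N (\<lambda>x. 2 * ((w x * ?A x) * ?R x))"
        proof (rule avg_mono)
          fix x
          have "[x = c] (mod int L) \<longleftrightarrow> [x = c] (mod int (r ^ v)) \<and> [x = c] (mod int L')"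
            using cong_prime_power_split[of "r ^ v" L' x c] pf(1,4) by auto
          then show "w' x * of_bool ([x = c] (mod int L)) \<le> 2 * ((w x * ?A x) * ?R x)"
            using w'(3)[of x] w(1)[of x] by (simp add: of_bool_def)
        qed
        also have "\<dots> = 2 * avg N (\<lambda>x. (w x * ?A x) * ?R x)" by (rule avg_cmult)
        also have "avg N (\<lambda>x. (w x * ?A x) * ?R x)
          = avg N (\<lambda>x. (w x * ?A x) * ((\<Sum>j\<in>{0..<int (r ^ e)}. ?R (x + int D * j)) / real (r ^ e)))"
          using r(2) by (intro avg_fibre[OF pwA periodic_dvd[OF pwA DN] pR M(3)]) simp
        also have "\<dots> = avg N (\<lambda>x. (1 / real r ^ v) * (w x * ?A x))"
        proof (intro arg_cong[where f = "avg N"] ext)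
          fix x
          have "(\<Sum>j\<in>{0..<int (r ^ e)}. ?R (x + int D * j)) = real r ^ (e - v)"
            using card_fibre_class[OF copDr r(2) ve, of x c] by (subst sum_of_bool_card) auto
          then have "(\<Sum>j\<in>{0..<int (r ^ e)}. ?R (x + int D * j)) / real (r ^ e) = 1 / real r ^ v"
            using ve r(2) by (simp add: power_diff)
          then show "(w x * ?A x) * ((\<Sum>j\<in>{0..<int (r ^ e)}. ?R (x + int D * j)) / real (r ^ e))
             = (1 / real r ^ v) * (w x * ?A x)" by simp
        qed
        also have "\<dots> = 1 / real r ^ v * avg N (\<lambda>x. w x * ?A x)" by (rule avg_cmult)
        also have "2 * \<dots> \<le> 2 * (1 / real r ^ v * cell_weight P L')"
          using cell[of L' c] L'D by (intro mult_left_mono) (auto simp: D_def)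
        also have "\<dots> = cell_weight P L"
          using cell_weight_prime_power[OF r(1,3), of v L'] False pf by simp
        finally show ?thesis .
      qed
    qed
    have sm: "avg N (\<lambda>x. w x * (fibre_density D (r ^ e) B x)\<^sup>2) \<le> second_moment P M r"
    proof -
      have "avg N (\<lambda>x. w x * (fibre_density D (r ^ e) B x)\<^sup>2) \<le>
        (\<Sum>m\<in>T. \<Sum>m'\<in>T. cell_weight P (lcm (prime_free r m) (prime_free r m'))
            * (1 / real r ^ multiplicity r m * (1 / real r ^ multiplicity r m')))"
      proof (rule weighted_second_moment_le[OF w(1), where D = D and a = a])
        show "avg N (\<lambda>x. w x * of_bool ([x = c] (mod int L))) \<le> cell_weight P L" if "L dvd D" for L c
          using cell that unfolding D_def .
        show "prime_free r m dvd D" if "m \<in> T" for m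
        proof -
          note pf = prime_free_facts[OF r(1) T(2,3)[OF that, folded r_def]]
          show ?thesis unfolding D_def
          proof (rule dvd_smooth_part)
            show "prime_free r m dvd N" using pf(1) T(1)[OF that] by (metis dvd_mult_right)
            show "prime_factors (prime_free r m) \<subseteq> {..z}" using pf(3) by (simp add: r_def)
          qed (rule M(3))
        qed
        show "fibre_density D (r ^ e) B x
            \<le> (\<Sum>m\<in>T. of_bool ([x = a m] (mod int (prime_free r m))) * (1 / real r ^ multiplicity r m))" for x
          using fibre_density_classes_le[OF fT _ True M(3), of a x] T(1,3)
          unfolding D_def e_def r_def B_def by simp
        show "0 \<le> fibre_density D (r ^ e) B x" for x using fibre_density_bounds(1) r(2) by simp
      qed auto
      then show ?thesis unfolding second_moment_def T_def by (simp add: power_add)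
    qed
    have rs: "primes_between P (Suc z) = insert r (primes_between P z)"
      using r True unfolding r_def using le_Suc_eq by auto
    have fin: "finite (primes_between P z)" by (rule finite_subset[of _ "{..z}"]) auto
    \<comment> \<open>What the smaller primes cover has period \<open>D\<close>, so its weight
      survives the step exactly; only the new classes \<open>B\<close> add to the loss.\<close>
    have pC: "periodic D (\<lambda>x. of_bool (covered M a z x) :: real)"
      unfolding D_def using M(2,3)
        by (intro periodic_comp[OF periodic_class_union] dvd_smooth_part) auto
    have "avg N (\<lambda>x. w' x * of_bool (covered M a (Suc z) x))
       \<le> avg N (\<lambda>x. w' x * of_bool (covered M a z x) + w' x * of_bool (B x))"
    proof (rule avg_mono)
      fix x
      have "covered M a (Suc z) x \<Longrightarrow> covered M a z x \<or> B x"
      proof -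
        assume "covered M a (Suc z) x"
        then obtain m where m: "m \<in> M" "prime_factors m \<subseteq> {..Suc z}" "[x = a m] (mod int m)" by blast
        show "covered M a z x \<or> B x"
        proof (cases "r \<in> prime_factors m")
          case True
          then have "m \<in> T" using m unfolding T_def top_moduli_def r_def by blast
          then show ?thesis using m(3) unfolding B_def by blast
        next
          case False
          have "prime_factors m \<subseteq> {..z}"
          proof
            fix p assume p: "p \<in> prime_factors m"
            then have "p \<le> Suc z" "p \<noteq> r" using m(2) False by auto
            then show "p \<in> {..z}" by (simp add: r_def)
          qed
          then show ?thesis using m by blast
        qed
      qed
      then show "w' x * of_bool (covered M a (Suc z) x)
         \<le> w' x * of_bool (covered M a z x) + w' x * of_bool (B x)"
        using w'(1)[of x] by (auto simp: of_bool_def)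
    qed
    also have "\<dots> = avg N (\<lambda>x. w x * of_bool (covered M a z x)) + avg N (\<lambda>x. w' x * of_bool (B x))"
      using keep[OF pC] by (simp only: avg_add)
    also have "\<dots> \<le> (\<Sum>r\<in>primes_between P z. second_moment P M r) + second_moment P M r"
      using loss lossB sm by linarith
    also have "\<dots> = (\<Sum>r\<in>primes_between P (Suc z). second_moment P M r)"
      unfolding rs using fin by (subst sum.insert) (auto simp: r_def)
    finally have loss': "avg N (\<lambda>x. w' x * of_bool (covered M a (Suc z) x))
      \<le> (\<Sum>r\<in>primes_between P (Suc z). second_moment P M r)" .
    have "avg N w' = avg N w" using keep[of "\<lambda>_. 1"] by (simp add: periodic_def)
    then have mean': "avg N w' = avg N w0" using w(4) by simp
    have zero': "w' x = 0" if "w0 x = 0" for x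
    proof -
      have "w' x \<le> 2 * 0" using w'(3)[of x] w(3)[OF that] by simp
      then show ?thesis using w'(1)[of x] by linarith
    qed
    show ?thesis
      unfolding Dr
    proof (intro exI[of _ w'] conjI allI impI)
      show "0 \<le> w' x" for x by (rule w'(1))
      show "periodic (D * r ^ e) w'" by (rule w'(2))
      show "w' x = 0" if "w0 x = 0" for x using that by (rule zero')
      show "avg N w' = avg N w0" by (rule mean')
      show "avg N (\<lambda>x. w' x * of_bool ([x = c] (mod int L))) \<le> cell_weight P L"
        if "L dvd D * r ^ e" for L c
        using that by (rule cell')
    qed (rule loss')
  qed
qed

subsection \<open>Euler products and sieving\<close>

abbreviation primes_upto :: "nat \<Rightarrow> nat set" where
  "primes_upto z \<equiv> {p. prime p \<and> p \<le> z}"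

lemma euler_prod_Suc:
  "euler_prod (primes_upto (Suc z))
      = (if prime (Suc z) then euler_prod (primes_upto z) * (real (Suc z) / real z) else euler_prod (primes_upto z))"
  unfolding euler_prod_def by (simp add: primes_le_Suc)

lemma euler_prod_ge_1:
  assumes "\<And>p. p \<in> S \<Longrightarrow> prime p"
  shows "euler_prod S \<ge> 1"
  unfolding euler_prod_def
proof (rule prod_ge_1)
  fix p assume "p \<in> S"
  then have "p > 1" using assms prime_gt_1_nat by blast
  then show "1 \<le> real p / (real p - 1)" by (simp add: field_simps)
qed

lemma euler_prod_mono: "y \<le> z \<Longrightarrow> euler_prod (primes_upto y) \<le> euler_prod (primes_upto z)"
proof (induction z rule: dec_induct)
  case (step z)
  have "euler_prod (primes_upto z) \<ge> 1" by (rule euler_prod_ge_1) auto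
  then have "euler_prod (primes_upto z) \<le> euler_prod (primes_upto (Suc z))"
    by (auto simp: euler_prod_Suc field_simps dest: prime_gt_1_nat)
  then show ?case using step.IH by simp
qed simp

text \<open>Only odd factors occur from 5 on, and \<open>(j / (j - 1))\<^sup>2 \<le> j / (j - 2)\<close> telescopes.\<close>

lemma euler_prod_sqrt_bound: "z \<ge> 3 \<Longrightarrow> euler_prod (primes_upto z) ^ 2 \<le> 3 * real z"
proof (induction z rule: less_induct)
  case (less z)
  consider "z = 3" | "z > 3" "\<not> prime z" | "z > 3" "prime z" using less.prems by linarith
  then show ?case
  proof cases
    case 1
    have "primes_upto 3 = {2, 3::nat}"
    proof -
      have "p = 2 \<or> p = 3" if "prime p" "p \<le> 3" for p :: nat
        using prime_ge_2_nat[OF that(1)] that(2) by linarith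
      then show ?thesis by auto
    qed
    then show ?thesis using 1 by (simp add: euler_prod_def)
  next
    case 2
    then have "Suc (z - 1) = z" by simp
    then have "euler_prod (primes_upto z) = euler_prod (primes_upto (z - 1))"
      using euler_prod_Suc[of "z - 1"] 2 by simp
    moreover have "euler_prod (primes_upto (z - 1)) ^ 2 \<le> 3 * real (z - 1)"
      using less.IH[of "z - 1"] 2 by simp
    ultimately show ?thesis using 2 by (simp add: of_nat_diff)
  next
    case 3
    have odd: "odd z" using 3 prime_odd_nat by auto
    then have z5: "z \<ge> 5" using 3 by (cases "z = 4") auto
    have np: "\<not> prime (z - 1)"
    proof
      assume "prime (z - 1)"
      then have "odd (z - 1)" using z5 by (intro prime_odd_nat) auto
      moreover have "even (z - 1)" using odd by simp
      ultimately show False by blast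
    qed
    have s: "Suc (z - 1) = z" "Suc (z - 2) = z - 1" using z5 by auto
    define t where "t = real z"
    have t5: "t \<ge> 5" using z5 by (simp add: t_def)
    have "euler_prod (primes_upto (z - 1)) = euler_prod (primes_upto (z - 2))"
      using euler_prod_Suc[of "z - 2"] np s by simp
    then have e: "euler_prod (primes_upto z) = euler_prod (primes_upto (z - 2)) * (t / (t - 1))"
      using euler_prod_Suc[of "z - 1"] 3 s z5 by (simp add: t_def of_nat_diff)
    have "euler_prod (primes_upto (z - 2)) ^ 2 \<le> 3 * real (z - 2)" using less.IH[of "z - 2"] z5 by simp
    then have "euler_prod (primes_upto (z - 2)) ^ 2 \<le> 3 * (t - 2)"
      using z5 by (simp add: t_def of_nat_diff)
    then have "euler_prod (primes_upto z) ^ 2 \<le> 3 * (t - 2) * (t / (t - 1)) ^ 2"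
      unfolding e power_mult_distrib by (intro mult_right_mono) auto
    also have "\<dots> \<le> 3 * t"
    proof -
      have "(t - 2) * t \<le> (t - 1) ^ 2" by (simp add: power2_eq_square algebra_simps)
      then have "((t - 2) * t) * (3 * t) \<le> (t - 1) ^ 2 * (3 * t)"
        using t5 by (intro mult_right_mono) auto
      then have "3 * (t - 2) * t ^ 2 \<le> 3 * t * (t - 1) ^ 2"
        by (simp add: power2_eq_square algebra_simps)
      moreover have "(t - 1) ^ 2 > 0" using t5 by simp
      ultimately show ?thesis by (simp add: power_divide divide_le_eq)
    qed
    finally show ?thesis by (simp add: t_def)
  qed
qed

text \<open>This is the proportion lost at \<open>p\<close>. As p - 1 is even and exceeds 2, the
  square root bound can be used at p - 2, giving x^2 \<le> 3 (p - 2) / (p - 1)^2. The right side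
  equals (3/4)^2 at p = 5, and from 363 = 3 * 11^2 on it is at most 1/11^2.\<close>

lemma cover_ratio_bounds:
  assumes "prime p" "p \<ge> 5"
  defines "x \<equiv> euler_prod (primes_upto (p - 1)) / (real p - 1)"
  shows "0 \<le> x" "x \<le> 3/4" "p \<ge> 363 \<Longrightarrow> x \<le> 1/11"
proof -
  define t where "t = real p"
  have t5: "t \<ge> 5" using assms by (simp add: t_def)
  show x0: "0 \<le> x" unfolding x_def
    using euler_prod_ge_1[of "primes_upto (p - 1)"] t5 by (auto simp: t_def)
  have np: "\<not> prime (p - 1)"
  proof
    assume a: "prime (p - 1)"
    have "odd p" using assms prime_odd_nat by auto
    then have "even (p - 1)" by simp
    moreover have "odd (p - 1)" using assms(2) by (intro prime_odd_nat[OF a]) simp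
    ultimately show False by blast
  qed
  have s: "Suc (p - 2) = p - 1" using assms by simp
  have "euler_prod (primes_upto (p - 1)) = euler_prod (primes_upto (p - 2))"
    using euler_prod_Suc[of "p - 2"] np s by simp
  then have "euler_prod (primes_upto (p - 1)) ^ 2 \<le> 3 * (t - 2)"
    using euler_prod_sqrt_bound[of "p - 2"] assms by (simp add: t_def of_nat_diff)
  then have sq: "x ^ 2 \<le> 3 * (t - 2) / (t - 1) ^ 2"
    unfolding x_def power_divide t_def by (intro divide_right_mono) auto
  have p1: "(t - 1) ^ 2 > 0" using t5 by simp
  have "3 * (t - 2) / (t - 1) ^ 2 \<le> (3/4) ^ 2"
  proof -
    have "0 \<le> (t - 5) * (9 * t - 21)" using t5 by (intro mult_nonneg_nonneg) auto
    then have "48 * (t - 2) \<le> 9 * (t - 1) ^ 2" by (simp add: power2_eq_square algebra_simps)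
    then show ?thesis using p1 by (simp add: divide_le_eq power2_eq_square)
  qed
  then have "x ^ 2 \<le> (3/4) ^ 2" using sq by linarith
  then show "x \<le> 3/4" by (rule power2_le_imp_le) simp
  assume "p \<ge> 363"
  then have t363: "t \<ge> 363" by (simp add: t_def)
  have "3 * (t - 2) / (t - 1) ^ 2 \<le> (1/11) ^ 2"
  proof -
    have "0 \<le> (t - 363) * (t - 2)" using t363 by (intro mult_nonneg_nonneg) auto
    then have "363 * (t - 2) \<le> (t - 1) ^ 2" by (simp add: power2_eq_square algebra_simps)
    then show ?thesis using p1 by (simp add: divide_le_eq power2_eq_square)
  qed
  then have "x ^ 2 \<le> (1/11) ^ 2" using sq by linarith
  then show "x \<le> 1/11" by (rule power2_le_imp_le) simp
qed

text \<open>For nonnegative \<open>x\<close>, (1 - x)(1 + 11/10 x) \<ge> 1 holds exactly up to 1/11.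
  The constant has to be close to 1 because it multiplies the exponent of the density bound.\<close>

lemma one_minus_ge_exp:
  fixes x :: real
  assumes "0 \<le> x" "x \<le> 1/11"
  shows "1 - x \<ge> exp (- (11/10 * x))"
proof -
  have "1 + 11/10 * x \<le> exp (11/10 * x)" by simp
  then have "exp (- (11/10 * x)) \<le> 1 / (1 + 11/10 * x)"
    using assms by (simp add: exp_minus field_simps)
  also have "\<dots> \<le> 1 - x"
  proof -
    have "1 \<le> (1 - x) * (1 + 11/10 * x)"
    proof -
      have "x * (11 * x) \<le> x * 1" using assms by (intro mult_left_mono) auto
      then show ?thesis by (simp add: algebra_simps)
    qed
    then show ?thesis using assms by (simp add: divide_le_eq)
  qed
  finally show ?thesis .
qed

text \<open>The factors telescope: \<open>euler_prod (primes_upto (p - 1)) / (p - 1)\<close> is the increment of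
  \<open>euler_prod\<close> at the prime \<open>p\<close>.\<close>

lemma sieve_lower_bound:
  fixes \<mu> :: "nat \<Rightarrow> real"
  assumes init: "\<mu> 4 \<ge> c" "c \<ge> 0"
    and comp: "\<And>z. z \<ge> 4 \<Longrightarrow> \<not> prime (Suc z) \<Longrightarrow> \<mu> (Suc z) \<ge> \<mu> z"
    and prm: "\<And>z. z \<ge> 4 \<Longrightarrow> prime (Suc z) \<Longrightarrow> \<mu> (Suc z) \<ge> \<mu> z * (1 - euler_prod (primes_upto z) / real z)"
    and z: "z \<ge> 362"
  shows "\<mu> z \<ge> c * (1/4) ^ 362 * exp (- (11/10 * euler_prod (primes_upto z)))"
proof -
  \<comment> \<open>The factor at each prime from 5 on is at least 1/4. Charging it at composite
    steps too only worsens the constant; the bound is used at 362.\<close>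
  have small: "\<mu> z \<ge> c * (1/4) ^ z" if "z \<ge> 4" for z
    using that
  proof (induction z rule: dec_induct)
    case base
    have "c * (1/4) ^ 4 \<le> c * 1" using init(2) by (intro mult_left_mono power_le_one) auto
    then show ?case using init(1) by simp
  next
    case (step z)
    have 0: "c * (1/4) ^ z \<ge> 0" using init(2) by simp
    show ?case
    proof (cases "prime (Suc z)")
      case False
      then show ?thesis using comp[of z] step 0 by simp
    next
      case True
      have "euler_prod (primes_upto z) / real z \<le> 3/4"
        using cover_ratio_bounds(2)[OF True] step.hyps by simp
      then have "c * (1/4) ^ z * (1/4) \<le> \<mu> z * (1 - euler_prod (primes_upto z) / real z)"
        using step.IH 0 by (intro mult_mono) auto
      moreover have "c * (1/4) ^ Suc z = c * (1/4) ^ z * (1/4)" by simp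
      ultimately show ?thesis using prm[of z] step.hyps True by linarith
    qed
  qed
  define b where "b = c * (1/4) ^ 362"
  have b0: "b \<ge> 0" unfolding b_def using init(2) by simp
  have "\<mu> z \<ge> b * exp (- (11/10 * euler_prod (primes_upto z)))"
    using z
  proof (induction z rule: dec_induct)
    case base
    have "euler_prod (primes_upto 362) \<ge> 1" by (rule euler_prod_ge_1) auto
    then have "b * exp (- (11/10 * euler_prod (primes_upto 362))) \<le> b * 1"
      using b0 by (intro mult_left_mono) auto
    then show ?case using small[of 362] unfolding b_def by linarith
  next
    case (step z)
    show ?case
    proof (cases "prime (Suc z)")
      case False
      then show ?thesis using comp[of z] step by (simp add: euler_prod_Suc)
    next
      case True
      define x where "x = euler_prod (primes_upto z) / real z"
      have x: "0 \<le> x" "x \<le> 1/11"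
        using cover_ratio_bounds(1,3)[OF True] step.hyps by (auto simp: x_def)
      have "euler_prod (primes_upto (Suc z)) = euler_prod (primes_upto z) + x"
        using True step.hyps by (simp add: euler_prod_Suc x_def field_simps)
      then have "b * exp (- (11/10 * euler_prod (primes_upto (Suc z))))
        = b * exp (- (11/10 * euler_prod (primes_upto z))) * exp (- (11/10 * x))"
        by (simp add: algebra_simps flip: exp_add)
      also have "\<dots> \<le> \<mu> z * (1 - x)"
      proof (rule mult_mono)
        have "0 \<le> b * exp (- (11/10 * euler_prod (primes_upto z)))" using b0 by simp
        then show "0 \<le> \<mu> z" using step.IH by linarith
      qed (use step.IH one_minus_ge_exp[OF x] in auto)
      also have "\<dots> \<le> \<mu> (Suc z)" using prm[of z] step.hyps True by (simp add: x_def)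
      finally show ?thesis .
    qed
  qed
  then show ?thesis unfolding b_def .
qed

section \<open>Geometric sums with polynomial weights\<close>

text \<open>Partial sums of the binomial series of (1 - x)^(-k-1). Multiplying by 1 - x lowers
  \<open>k\<close> by one, by Pascal's rule, up to a boundary term of favourable sign.\<close>

lemma sum_binomial_powers_le:
  fixes x :: real
  assumes "0 \<le> x" "x < 1"
  shows "(\<Sum>u\<le>V. real ((u + k) choose k) * x ^ u) \<le> (1 / (1 - x)) ^ Suc k"
proof (induction k)
  case 0
  have s: "summable (\<lambda>u. x ^ u)" using assms by (intro summable_geometric) auto
  have "(\<Sum>u\<le>V. x ^ u) \<le> (\<Sum>u. x ^ u)" using s assms by (intro sum_le_suminf) auto
  then show ?case using assms by (simp add: suminf_geometric)
next
  case (Suc k)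
  have "(1 - x) * (\<Sum>u\<le>V. real ((u + Suc k) choose Suc k) * x ^ u)
      \<le> (\<Sum>u\<le>V. real ((u + k) choose k) * x ^ u)"
  proof (induction V)
    case 0
    then show ?case using assms by simp
  next
    case (Suc V)
    have id: "(1 - x) * (\<Sum>u\<le>V. real ((u + Suc k) choose Suc k) * x ^ u)
       + real ((V + Suc k) choose Suc k) * x ^ Suc V = (\<Sum>u\<le>V. real ((u + k) choose k) * x ^ u)" for V
    proof (induction V)
      case 0
      then show ?case by (simp add: algebra_simps)
    next
      case (Suc V)
      have "real ((Suc V + Suc k) choose Suc k)
          = real ((V + Suc k) choose Suc k) + real ((Suc V + k) choose k)"
        using binomial_Suc_Suc[of "V + Suc k" k] by (simp add: add_ac)
      then show ?case using Suc by (simp add: algebra_simps)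
    qed
    have "0 \<le> real ((Suc V + Suc k) choose Suc k) * x ^ Suc (Suc V)" using assms by simp
    then show ?case using id[of "Suc V"] by linarith
  qed
  also have "\<dots> \<le> (1 / (1 - x)) ^ Suc k" by (rule Suc.IH)
  finally have "(\<Sum>u\<le>V. real ((u + Suc k) choose Suc k) * x ^ u) \<le> (1 / (1 - x)) ^ Suc k / (1 - x)"
    using assms by (simp add: pos_le_divide_eq mult.commute)
  also have "\<dots> = (1 / (1 - x)) ^ Suc (Suc k)" by simp
  finally show ?case .
qed

lemma binomial_ratio: "real ((Suc u + k) choose k) * real (Suc u)
    = real ((u + k) choose k) * real (Suc (u + k))"
proof -
  have "Suc u * (Suc (u + k) choose Suc u) = Suc (u + k) * ((u + k) choose u)"
    by (rule Suc_times_binomial)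
  moreover have "Suc (u + k) choose Suc u = (Suc u + k) choose k"
    by (metis add_Suc add_diff_cancel_left' binomial_symmetric le_add1)
  moreover have "(u + k) choose u = (u + k) choose k"
    by (metis add_diff_cancel_left' binomial_symmetric le_add1)
  ultimately show ?thesis by (metis mult.commute of_nat_mult)
qed

text \<open>At the u-th power of a prime this is d^2 \<le> d_4, where d_k counts ordered
  factorizations into k factors and d = d_2; the next bound is d^4 \<le> d_16. Binomial coefficients
  turn the sums over \<open>u\<close> into powers of 1 / (1 - x).\<close>

lemma power2_le_binomial: "real (Suc u) ^ 2 \<le> real ((u + 3) choose 3)"
proof (induction u)
  case (Suc u)
  define t where "t = real u"
  have t: "t \<ge> 0" by (simp add: t_def)
  have "(t + 2) ^ 2 * (t + 1) \<le> (t + 1) ^ 2 * (t + 4)"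
    using t by (simp add: power2_eq_square algebra_simps)
  also have "\<dots> \<le> real ((u + 3) choose 3) * (t + 4)"
    using Suc t by (intro mult_right_mono) (auto simp: t_def add_ac)
  also have "\<dots> = real ((Suc u + 3) choose 3) * (t + 1)"
    using binomial_ratio[of u 3] by (simp add: t_def add_ac)
  finally have "(t + 2) ^ 2 \<le> real ((Suc u + 3) choose 3)" using t by (simp add: mult_le_cancel_right)
  then show ?case by (simp add: t_def add_ac)
qed simp

lemma power4_le_binomial: "real (Suc u) ^ 4 \<le> real ((u + 15) choose 15)"
proof (induction u)
  case (Suc u)
  define t where "t = real u"
  have t: "t \<ge> 0" by (simp add: t_def)
  have "(t + 2) ^ 4 * (t + 1) \<le> (t + 1) ^ 4 * (t + 16)"
  proof -
    have "(t + 1) ^ 4 * (t + 16) - (t + 2) ^ 4 * (t + 1) = (t + 1) * (11 * t ^ 3 + 27 * t\<^sup>2 + 17 * t)"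
      by (simp add: power4_eq_xxxx power3_eq_cube power2_eq_square algebra_simps)
    also have "\<dots> \<ge> 0" using t by simp
    finally show ?thesis by simp
  qed
  also have "\<dots> \<le> real ((u + 15) choose 15) * (t + 16)"
    using Suc t by (intro mult_right_mono) (auto simp: t_def add_ac)
  also have "\<dots> = real ((Suc u + 15) choose 15) * (t + 1)"
    using binomial_ratio[of u 15] by (simp add: t_def add_ac)
  finally have "(t + 2) ^ 4 \<le> real ((Suc u + 15) choose 15)" using t by (simp add: mult_le_cancel_right)
  then show ?case by (simp add: t_def add_ac)
qed simp

lemma sum_weighted_geometric_le:
  assumes "prime q"
  shows "(\<Sum>u\<le>V. real (Suc u) / real q ^ u) \<le> (real q / (real q - 1)) ^ 2"
    and "(\<Sum>u\<le>V. real (Suc u) ^ 2 / real q ^ u) \<le> (real q / (real q - 1)) ^ 4"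
    and "(\<Sum>u\<le>V. real (Suc u) ^ 4 / real q ^ u) \<le> (real q / (real q - 1)) ^ 16"
proof -
  define x where "x = 1 / real q"
  have q: "real q > 1" using prime_gt_1_nat[OF assms] by simp
  have x: "0 \<le> x" "x < 1" using q by (auto simp: x_def)
  have e: "1 / (1 - x) = real q / (real q - 1)" using q by (simp add: x_def field_simps)
  have d: "a / real q ^ u = a * x ^ u" for a u by (simp add: x_def power_one_over)
  show "(\<Sum>u\<le>V. real (Suc u) / real q ^ u) \<le> (real q / (real q - 1)) ^ 2"
    using sum_binomial_powers_le[OF x, of 1 V] unfolding d e by (simp add: numeral_2_eq_2)
  have "(\<Sum>u\<le>V. real (Suc u) ^ 2 * x ^ u) \<le> (\<Sum>u\<le>V. real ((u + 3) choose 3) * x ^ u)"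
    using x power2_le_binomial by (intro sum_mono mult_right_mono) auto
  also have "\<dots> \<le> (1 / (1 - x)) ^ Suc 3" by (rule sum_binomial_powers_le[OF x])
  finally show "(\<Sum>u\<le>V. real (Suc u) ^ 2 / real q ^ u) \<le> (real q / (real q - 1)) ^ 4"
    unfolding d e by simp
  have "(\<Sum>u\<le>V. real (Suc u) ^ 4 * x ^ u) \<le> (\<Sum>u\<le>V. real ((u + 15) choose 15) * x ^ u)"
    using x power4_le_binomial by (intro sum_mono mult_right_mono) auto
  also have "\<dots> \<le> (1 / (1 - x)) ^ Suc 15" by (rule sum_binomial_powers_le[OF x])
  finally show "(\<Sum>u\<le>V. real (Suc u) ^ 4 / real q ^ u) \<le> (real q / (real q - 1)) ^ 16"
    unfolding d e by simp
qed

section \<open>Mertens-type estimates for primes\<close>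

lemma power_dvd_fact: "p > 0 \<Longrightarrow> p ^ k dvd (fact (p * k) :: nat)"
proof (induction k)
  case (Suc k)
  define m where "m = p * k + (p - 1)"
  have m: "Suc m = p * Suc k" using Suc.prems by (simp add: m_def)
  have "p ^ k dvd (fact m :: nat)"
  proof (rule dvd_trans)
    show "p ^ k dvd (fact (p * k) :: nat)" using Suc by simp
    show "fact (p * k) dvd (fact m :: nat)" by (rule fact_dvd) (simp add: m_def)
  qed
  then have "p * p ^ k dvd Suc m * fact m" unfolding m by (intro mult_dvd_mono) auto
  also have "Suc m * fact m = (fact (Suc m) :: nat)" by simp
  finally show ?case using m by simp
qed simp

lemma prod_prime_powers_dvd_fact:
  assumes "finite S" "\<And>p. p \<in> S \<Longrightarrow> prime p"
  shows "(\<Prod>p\<in>S. p ^ (n div p)) dvd (fact n :: nat)"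
  using assms
proof (induction S rule: finite_induct)
  case (insert p S)
  have p: "prime p" using insert.prems by simp
  have "p ^ (n div p) dvd (fact (p * (n div p)) :: nat)" using p prime_gt_0_nat power_dvd_fact by blast
  also have "\<dots> dvd fact n" by (rule fact_dvd) simp
  finally have 1: "p ^ (n div p) dvd (fact n :: nat)" .
  have "coprime (p ^ (n div p)) (\<Prod>p\<in>S. p ^ (n div p))"
    using insert p by (intro prod_coprime_right) (auto intro!: primes_coprime)
  then show ?case using 1 insert by (simp add: divides_mult)
qed simp

text \<open>Comparison with \<open>fact n\<close>, taken at \<open>n = K * y\<close> instead of
  \<open>y\<close>. Replacing \<open>n div p\<close> by n/p - 1 costs at most y ln y, even with the
  trivial bound \<open>y\<close> for the number of primes, and after division by \<open>n\<close>
  this is only (ln y) / K. So the leading coefficient 1 + 1/K can be brought as close to 1 as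
  desired.\<close>

lemma sum_ln_div_le:
  assumes "y \<ge> 1" "K \<ge> 1"
  shows "(\<Sum>p\<in>primes_upto y. ln (real p) / real p) \<le> ln (real K) + ln (real y) + ln (real y) / real K"
proof -
  define n where "n = K * y"
  have n: "n > 0" using assms by (simp add: n_def)
  have fin: "finite (primes_upto y)" by simp
  have "(\<Prod>p\<in>primes_upto y. p ^ (n div p)) \<le> (fact n :: nat)"
    by (intro dvd_imp_le prod_prime_powers_dvd_fact) auto
  also have "\<dots> \<le> n ^ n" using fact_le_power[of n, where 'a = nat] by simp
  finally have le: "real (\<Prod>p\<in>primes_upto y. p ^ (n div p)) \<le> real n ^ n"
    by (metis of_nat_le_iff of_nat_power)
  have pos: "real p > 0" if "p \<in> primes_upto y" for p using that prime_gt_0_nat by auto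
  have "(\<Sum>p\<in>primes_upto y. real (n div p) * ln (real p)) = ln (\<Prod>p\<in>primes_upto y. real p ^ (n div p))"
    using pos fin by (subst ln_prod) (auto simp: ln_realpow)
  also have "\<dots> \<le> ln (real n ^ n)"
    using le n pos by (subst ln_le_cancel_iff) (auto intro!: prod_pos)
  also have "\<dots> = real n * ln (real n)" using n by (simp add: ln_realpow)
  finally have A: "(\<Sum>p\<in>primes_upto y. real (n div p) * ln (real p)) \<le> real n * ln (real n)" .
  have "real n * (\<Sum>p\<in>primes_upto y. ln (real p) / real p) - (\<Sum>p\<in>primes_upto y. ln (real p))
     = (\<Sum>p\<in>primes_upto y. (real n / real p - 1) * ln (real p))"
    by (simp add: sum_distrib_left sum_subtractf algebra_simps)
  also have "\<dots> \<le> (\<Sum>p\<in>primes_upto y. real (n div p) * ln (real p))"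
  proof (intro sum_mono mult_right_mono)
    fix p assume p: "p \<in> primes_upto y"
    then have p0: "p > 0" using prime_gt_0_nat by auto
    have "n < p * (n div p) + p"
      using p0 by (metis mult.commute div_mult_mod_eq mod_less_divisor nat_add_left_cancel_less)
    then have "real n < real p * real (n div p) + real p"
      by (metis of_nat_add of_nat_less_iff of_nat_mult)
    then show "real n / real p - 1 \<le> real (n div p)" using p0 by (simp add: field_simps)
    show "0 \<le> ln (real p)" using p0 by simp
  qed
  finally have B: "real n * (\<Sum>p\<in>primes_upto y. ln (real p) / real p)
      \<le> real n * ln (real n) + (\<Sum>p\<in>primes_upto y. ln (real p))"
    using A by linarith
  have "(\<Sum>p\<in>primes_upto y. ln (real p)) \<le> (\<Sum>p\<in>primes_upto y. ln (real y))"
  proof (intro sum_mono)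
    fix p assume "p \<in> primes_upto y"
    then have "0 < p" "p \<le> y" using prime_gt_0_nat by auto
    then show "ln (real p) \<le> ln (real y)" by simp
  qed
  also have "\<dots> = real (card (primes_upto y)) * ln (real y)" by simp
  also have "\<dots> \<le> real y * ln (real y)"
  proof (intro mult_right_mono)
    have "card (primes_upto y) \<le> card {1..y}" by (intro card_mono) (auto simp: Suc_le_eq prime_gt_0_nat)
    then show "real (card (primes_upto y)) \<le> real y" by simp
  qed (use assms in auto)
  finally have "real n * (\<Sum>p\<in>primes_upto y. ln (real p) / real p)
      \<le> real n * ln (real n) + real y * ln (real y)"
    using B by linarith
  also have "real n * ln (real n) + real y * ln (real y)
      = real n * (ln (real n) + ln (real y) / real K)"
    using assms by (simp add: n_def field_simps)
  finally have "(\<Sum>p\<in>primes_upto y. ln (real p) / real p) \<le> ln (real n) + ln (real y) / real K"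
    using n by simp
  also have "ln (real n) = ln (real K) + ln (real y)" using assms by (simp add: n_def ln_mult)
  finally show ?thesis .
qed

text \<open>The right side is the integral of t^(-1-s) from \<open>n\<close> to
  \<open>Suc n\<close>, which dominates the value at the right end. In place of the integral the
  proof uses 1 + u \<le> exp u and ln u \<le> u - 1.\<close>

lemma powr_telescope:
  fixes s :: real
  assumes "s > 0" "n \<ge> 1"
  shows "real (Suc n) powr - (1 + s) \<le> (real n powr - s - real (Suc n) powr - s) / s"
proof -
  define k where "k = real (Suc n)"
  have k: "k \<ge> 2" using assms(2) by (simp add: k_def)
  have "k powr - s * (1 + s / k) \<le> k powr - s * exp (s / k)"
    by (intro mult_left_mono) auto
  also have "\<dots> = exp (- s * (ln k - 1 / k))" using k by (simp add: powr_def algebra_simps flip: exp_add)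
  also have "\<dots> \<le> exp (- s * ln (real n))"
  proof -
    have "ln (real n / k) \<le> real n / k - 1" using assms(2) by (intro ln_le_minus_one) (auto simp: k_def)
    also have "\<dots> = - 1 / k" by (simp add: k_def field_simps)
    finally have "ln (real n) \<le> ln k - 1 / k" using assms(2) k by (simp add: ln_div k_def)
    then show ?thesis using assms(1) by simp
  qed
  also have "\<dots> = real n powr - s" using assms(2) by (simp add: powr_def)
  finally have "k powr - s * (1 + s / k) \<le> real n powr - s" .
  moreover have "k powr - (1 + s) = k powr - s / k"
    using k by (simp add: powr_diff powr_minus_divide flip: powr_add)
  moreover have "k powr - s * (1 + s / k) = k powr - s + (k powr - s / k) * s"
    by (simp add: algebra_simps)
  ultimately have e: "k powr - (1 + s) = k powr - s / k"
    and "(k powr - s / k) * s \<le> real n powr - s - k powr - s"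
    by linarith+
  then have "(k powr - (1 + s)) * s \<le> real n powr - s - k powr - s" unfolding e by blast
  then show ?thesis unfolding k_def using assms(1) by (simp add: pos_le_divide_eq)
qed

lemma partial_zeta_le:
  assumes "s > 0" "n \<ge> 1"
  shows "(\<Sum>k=1..n. real k powr - (1 + s)) \<le> 1 + (1 - real n powr - s) / s"
  using assms(2)
proof (induction n rule: nat_induct_at_least)
  case (Suc n)
  have "(\<Sum>k=1..Suc n. real k powr - (1 + s))
      = (\<Sum>k=1..n. real k powr - (1 + s)) + real (Suc n) powr - (1 + s)"
    using Suc.hyps by (subst sum.nat_ivl_Suc') auto
  then show ?case using Suc.IH powr_telescope[OF assms(1) Suc.hyps]
    unfolding diff_divide_distrib by linarith
qed (use assms(1) in simp)

lemma zeta_tail_le: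
  assumes "s > 0" "n \<ge> 1"
  shows "(\<Sum>k\<in>{n<..n'}. real k powr - (1 + s)) \<le> real n powr - s / s"
proof (cases "n \<le> n'")
  case True
  then have "(\<Sum>k\<in>{n<..n'}. real k powr - (1 + s)) \<le> (real n powr - s - real n' powr - s) / s"
  proof (induction n' rule: dec_induct)
    case (step n')
    have "{n<..Suc n'} = insert (Suc n') {n<..n'}" using step.hyps by auto
    then have "(\<Sum>k\<in>{n<..Suc n'}. real k powr - (1 + s))
        = real (Suc n') powr - (1 + s) + (\<Sum>k\<in>{n<..n'}. real k powr - (1 + s))"
      by simp
    then show ?case
      using step.IH powr_telescope[OF assms(1), of n'] step.hyps assms(2)
        unfolding diff_divide_distrib by linarith
  qed simp
  also have "\<dots> \<le> real n powr - s / s" using assms(1) by (intro divide_right_mono) auto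
  finally show ?thesis .
qed (use assms(1) in simp)

text \<open>Removing the multiples of \<open>p\<close> from the zeta series removes its Euler factor.\<close>

lemma euler_factor_prod_le:
  assumes "finite S" "\<And>p. p \<in> S \<Longrightarrow> prime p" "s > 0"
  shows "(\<Prod>p\<in>S. 1 / (1 - real p powr - (1 + s))) \<le> 1 + 1 / s"
proof -
  define f where "f k = real k powr - (1 + s)" for k :: nat
  define A where "A S = {k::nat. k > 0 \<and> (\<forall>q\<in>S. \<not> q dvd k)}" for S
  have f0: "f k \<ge> 0" for k by (simp add: f_def)
  have sU: "f summable_on UNIV"
    unfolding f_def using assms(3)
      by (subst summable_on_UNIV_nonneg_real_iff) (auto simp: summable_real_powr_iff)
  have sA: "f summable_on X" for X by (rule summable_on_subset_banach[OF sU]) simp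
  have tot: "infsum f (A {}) \<le> 1 + 1 / s"
  proof (rule infsum_le_finite_sums[OF sA])
    fix F assume F: "finite F" "F \<subseteq> A {}"
    define n where "n = Max (insert 1 F)"
    have "F \<subseteq> {1..n}" unfolding n_def using F by (auto simp: A_def)
    then have "sum f F \<le> (\<Sum>k=1..n. f k)" using f0 by (intro sum_mono2) auto
    also have "\<dots> \<le> 1 + (1 - real n powr - s) / s"
      unfolding f_def using F(1) by (intro partial_zeta_le assms(3)) (simp add: n_def)
    also have "\<dots> \<le> 1 + 1 / s" using assms(3) by (intro add_left_mono divide_right_mono) auto
    finally show "sum f F \<le> 1 + 1 / s" .
  qed
  have prod_eq: "infsum f (A S) = infsum f (A {}) * (\<Prod>p\<in>S. 1 - f p)"
    using assms(1,2)
  proof (induction S rule: finite_induct)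
    case (insert p S)
    have p: "prime p" "p > 0" using insert.prems prime_gt_0_nat by auto
    have split: "A S = A (insert p S) \<union> (\<lambda>k. p * k) ` A S"
    proof (intro equalityI subsetI)
      fix k assume k: "k \<in> A S"
      show "k \<in> A (insert p S) \<union> (\<lambda>k. p * k) ` A S"
      proof (cases "p dvd k")
        case True
        then obtain j where j: "k = p * j" by auto
        have "j \<in> A S"
        proof -
          have "p * j > 0" "\<forall>q\<in>S. \<not> q dvd p * j" using k unfolding j A_def by blast+
          then have "j > 0" "\<forall>q\<in>S. \<not> q dvd j" using dvd_mult by (simp, blast)
          then show ?thesis unfolding A_def by blast
        qed
        then show ?thesis using j by blast
      qed (use k in \<open>auto simp: A_def\<close>)
    next
      fix k assume "k \<in> A (insert p S) \<union> (\<lambda>k. p * k) ` A S"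
      then show "k \<in> A S"
      proof
        assume "k \<in> (\<lambda>k. p * k) ` A S"
        then obtain j where j: "k = p * j" "j \<in> A S" by auto
        have "\<not> q dvd k" if "q \<in> S" for q
        proof
          assume "q dvd k"
          then have "q dvd p \<or> q dvd j" using j(1) that insert.prems by (auto simp: prime_dvd_mult_iff)
          then have "q dvd p" using j(2) that by (auto simp: A_def)
          then have "q = p" using that insert.prems p by (simp add: primes_dvd_imp_eq)
          then show False using that insert.hyps by simp
        qed
        then show ?thesis using j p by (auto simp: A_def)
      qed (auto simp: A_def)
    qed
    have "infsum f (A S) = infsum f (A (insert p S)) + infsum f ((\<lambda>k. p * k) ` A S)"
      by (subst split, rule infsum_Un_disjoint[OF sA sA]) (auto simp: A_def)
    also have "infsum f ((\<lambda>k. p * k) ` A S) = infsum (\<lambda>k. f p * f k) (A S)"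
    proof (subst infsum_reindex)
      show "inj_on (\<lambda>k. p * k) (A S)" using p by (auto intro: inj_onI)
      show "infsum (f \<circ> (\<lambda>k. p * k)) (A S) = infsum (\<lambda>k. f p * f k) (A S)"
        by (simp add: o_def f_def powr_mult)
    qed
    also have "\<dots> = f p * infsum f (A S)" by (rule infsum_cmult_right')
    finally have "infsum f (A S) = infsum f (A (insert p S)) + f p * infsum f (A S)" .
    moreover have "infsum f (A S) * (1 - f p) = infsum f (A S) - f p * infsum f (A S)"
      by (simp add: algebra_simps)
    ultimately have "infsum f (A (insert p S)) = infsum f (A S) * (1 - f p)" by linarith
    also have "infsum f (A S) = infsum f (A {}) * (\<Prod>p\<in>S. 1 - f p)"
      by (rule insert.IH) (use insert.prems in auto)
    also have "infsum f (A {}) * (\<Prod>p\<in>S. 1 - f p) * (1 - f p)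
        = infsum f (A {}) * (\<Prod>q\<in>insert p S. 1 - f q)"
      using insert.hyps by simp
    finally show ?case .
  qed simp
  \<comment> \<open>The term k = 1 survives every sieving, so the sifted zeta sum is at least 1;
    with \<open>prod_eq\<close> this bounds the inverse product by the full sum.\<close>
  have ge1: "1 \<le> infsum f (A S)"
  proof -
    have "1 \<in> A S" using assms(2)[of "Suc 0"] by (auto simp: A_def)
    then have "infsum f {1} \<le> infsum f (A S)" using f0 sA by (intro infsum_mono_neutral) auto
    then show ?thesis by (simp add: f_def)
  qed
  have pos: "(\<Prod>p\<in>S. 1 - f p) > 0"
  proof (rule prod_pos)
    fix p assume "p \<in> S"
    then have "real p > 1" using assms(2) prime_gt_1_nat by auto
    then have "f p < real p powr 0" unfolding f_def using assms(3) by (intro powr_less_mono) auto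
    then show "0 < 1 - f p" using \<open>real p > 1\<close> by simp
  qed
  have "infsum f (A {}) * (\<Prod>p\<in>S. 1 - f p) \<le> (1 + 1 / s) * (\<Prod>p\<in>S. 1 - f p)"
    using tot pos by (intro mult_right_mono) auto
  then have "1 \<le> (1 + 1 / s) * (\<Prod>p\<in>S. 1 - f p)" using ge1 prod_eq by linarith
  then have "1 / (\<Prod>p\<in>S. 1 - f p) \<le> 1 + 1 / s" using pos by (simp add: divide_le_eq)
  then show ?thesis by (simp add: f_def prod_dividef)
qed

text \<open>Each p / (p - 1) is compared with the Euler factor of zeta at 1 + s. The ratio is 1 + (1
  - p^(-s)) / (p - 1), at most exp (s ln p / (p - 1)), while the Euler factors multiply to at most 1
  + 1/s.\<close>

lemma euler_prod_le_exp:
  assumes "s > 0"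
  shows "euler_prod (primes_upto y)
      \<le> (1 + 1 / s) * exp (s * (\<Sum>p\<in>primes_upto y. ln (real p) / (real p - 1)))"
proof -
  have "euler_prod (primes_upto y)
      \<le> (\<Prod>p\<in>primes_upto y. 1 / (1 - real p powr - (1 + s)) * exp (s * (ln (real p) / (real p - 1))))"
    unfolding euler_prod_def
  proof (intro prod_mono conjI)
    fix p assume "p \<in> primes_upto y"
    then have p: "real p > 1" using prime_gt_1_nat by auto
    then show "0 \<le> real p / (real p - 1)" by simp
    define t where "t = real p powr - s"
    have t1: "t < 1" using powr_less_mono[of "- s" 0 "real p"] p assms by (simp add: t_def)
    have e: "real p powr - (1 + s) = t / real p"
      using p by (simp add: t_def powr_add powr_minus_divide powr_diff)
    have "exp (- (s * ln (real p))) \<ge> 1 - s * ln (real p)"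
      using exp_ge_add_one_self[of "- (s * ln (real p))"] by simp
    then have "1 - t \<le> s * ln (real p)" using p by (simp add: t_def powr_def)
    then have "1 + (1 - t) / (real p - 1) \<le> 1 + s * (ln (real p) / (real p - 1))"
      using p by (simp add: divide_right_mono)
    also have "\<dots> \<le> exp (s * (ln (real p) / (real p - 1)))" by (rule exp_ge_add_one_self)
    finally have h: "1 + (1 - t) / (real p - 1) \<le> exp (s * (ln (real p) / (real p - 1)))" .
    have d: "1 - t / real p > 0" using p t1 by (simp add: field_simps)
    have "real p / (real p - 1) = 1 / (1 - t / real p) * (1 + (1 - t) / (real p - 1))"
    proof -
      have "1 - t / real p = (real p - t) / real p" using p by (simp add: field_simps)
      moreover have "1 + (1 - t) / (real p - 1) = (real p - t) / (real p - 1)"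
        using p by (simp add: field_simps)
      moreover have "real p - t > 0" using p t1 by simp
      ultimately show ?thesis by simp
    qed
    also have "\<dots> \<le> 1 / (1 - t / real p) * exp (s * (ln (real p) / (real p - 1)))"
      using h d by (intro mult_left_mono) auto
    finally show "real p / (real p - 1)
        \<le> 1 / (1 - real p powr - (1 + s)) * exp (s * (ln (real p) / (real p - 1)))"
      unfolding e .
  qed
  also have "\<dots> = (\<Prod>p\<in>primes_upto y. 1 / (1 - real p powr - (1 + s)))
      * exp (s * (\<Sum>p\<in>primes_upto y. ln (real p) / (real p - 1)))"
    by (simp only: prod.distrib sum_distrib_left exp_sum[OF finite_primes_le])
  also have "\<dots> \<le> (1 + 1 / s) * exp (s * (\<Sum>p\<in>primes_upto y. ln (real p) / (real p - 1)))"
    using assms by (intro mult_right_mono euler_factor_prod_le) auto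
  finally show ?thesis .
qed

text \<open>Taking s = 1 / ln y gives about e * ln y by the Mertens-type sum, and 11/4 lies slightly
  above e. There is little to spare: 11/10 * 11/4 has to stay below the error exponents of the final
  comparison.\<close>

lemma euler_prod_le_ln:
  assumes "ln (real y) \<ge> 10 ^ 8"
  shows "euler_prod (primes_upto y) \<le> 11/4 * ln (real y)"
proof -
  define L where "L = ln (real y)"
  have L: "L \<ge> 10 ^ 8" using assms by (simp add: L_def)
  have y: "y \<ge> 1"
  proof (rule ccontr)
    assume "\<not> y \<ge> 1"
    then have "y = 0" by simp
    then show False using assms by simp
  qed
  have nn: "0 \<le> ln (real p) / real p" "ln (real p) / (real p - 1) \<le> 1" "0 \<le> ln (real p)" "real p \<ge> 2"
    if "p \<in> primes_upto y" for p
  proof -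
    show p: "real p \<ge> 2" using that prime_ge_2_nat by auto
    then show "0 \<le> ln (real p)" "0 \<le> ln (real p) / real p" by auto
    have "ln (real p) \<le> real p - 1" using p by (intro ln_le_minus_one) auto
    then show "ln (real p) / (real p - 1) \<le> 1" using p by simp
  qed
  \<comment> \<open>Beyond 1001, 1 / (p - 1) is at most 1001/1000 * (1 / p); each prime up to 1001
    contributes at most 1.\<close>
  have "(\<Sum>p\<in>primes_upto y. ln (real p) / (real p - 1))
     \<le> (\<Sum>p\<in>primes_upto y. 1001/1000 * (ln (real p) / real p) + of_bool (p \<le> 1001))"
  proof (rule sum_mono)
    fix p assume p: "p \<in> primes_upto y"
    show "ln (real p) / (real p - 1) \<le> 1001/1000 * (ln (real p) / real p) + of_bool (p \<le> 1001)"
    proof (cases "p \<le> 1001")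
      case True
      then have "of_bool (p \<le> 1001) = (1 :: real)" by simp
      moreover have "0 \<le> 1001/1000 * (ln (real p) / real p)" using nn(1)[OF p] by simp
      ultimately show ?thesis using nn(2)[OF p] by linarith
    next
      case False
      then have "1 / (real p - 1) \<le> 1001/1000 * (1 / real p)" by (simp add: field_simps)
      then have "ln (real p) * (1 / (real p - 1)) \<le> ln (real p) * (1001/1000 * (1 / real p))"
        using nn[OF p] by (intro mult_left_mono) auto
      then show ?thesis using False by simp
    qed
  qed
  also have "\<dots> = 1001/1000 * (\<Sum>p\<in>primes_upto y. ln (real p) / real p)
      + real (card {p\<in>primes_upto y. p \<le> 1001})"
    by (simp only: sum.distrib sum_of_bool_card[OF finite_primes_le] sum_distrib_left)
  also have "\<dots> \<le> 1001/1000 * (999 + L + L / 1000) + 1001"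
  proof (intro add_mono mult_left_mono)
    have "ln (1000 :: real) \<le> 1000 - 1" by (rule ln_le_minus_one) simp
    then show "(\<Sum>p\<in>primes_upto y. ln (real p) / real p) \<le> 999 + L + L / 1000"
      using sum_ln_div_le[OF y, of 1000] by (simp add: L_def)
    have "card {p\<in>primes_upto y. p \<le> 1001} \<le> card {1..1001::nat}"
      by (intro card_mono) (auto simp: Suc_le_eq prime_gt_0_nat)
    then show "real (card {p\<in>primes_upto y. p \<le> 1001}) \<le> 1001" by simp
  qed auto
  also have "\<dots> \<le> L * (1003/1000)"
  proof -
    have "L \<ge> 100000000" using L by simp
    then show ?thesis by argo
  qed
  finally have S: "(\<Sum>p\<in>primes_upto y. ln (real p) / (real p - 1)) \<le> L * (1003/1000)" .
  have "euler_prod (primes_upto y)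
      \<le> (1 + 1 / (1 / L)) * exp (1 / L * (\<Sum>p\<in>primes_upto y. ln (real p) / (real p - 1)))"
    using L by (intro euler_prod_le_exp) auto
  also have "\<dots> \<le> (1 + 1 / (1 / L)) * exp (1003/1000)"
    using S L by (intro mult_left_mono) (auto simp: field_simps)
  also have "exp (1003/1000 :: real) = exp 1 * exp (3/1000)" by (simp flip: exp_add)
  also have "\<dots> \<le> (272/100) * (1000/997)"
  proof (intro mult_mono)
    have "1 + (- 3/1000) \<le> exp (- 3/1000 :: real)" by (rule exp_ge_add_one_self)
    then have "997/1000 \<le> 1 / exp (3/1000 :: real)" by (simp add: exp_minus inverse_eq_divide)
    then show "exp (3/1000 :: real) \<le> 1000/997" by (simp add: field_simps)
  qed (use e_less_272 in auto)
  also have "(1 + 1 / (1 / L)) * ((272/100) * (1000/997)) \<le> 11/4 * L" using L by simp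
  finally show ?thesis using L by (simp add: L_def)
qed

subsection \<open>Second moments\<close>

definition cell_factor :: "nat \<Rightarrow> nat \<Rightarrow> nat \<Rightarrow> real" where
  "cell_factor P q t = (if t = 0 then 1 else (if q > P then 2 else 1) / real q ^ t)"

text \<open>Bounds the sum over \<open>v\<close> of \<open>cell_factor P q (max u v)\<close>.\<close>

definition row_factor :: "nat \<Rightarrow> nat \<Rightarrow> nat \<Rightarrow> real" where
  "row_factor P q u =
     (if q > P then real (Suc u) ^ 2 / real q ^ u * (real q / (real q - 1)) ^ 2
      else real (Suc u) / real q ^ u * (real q / (real q - 1)))"

lemma cell_factor_nonneg [simp]: "cell_factor P q t \<ge> 0"
  by (simp add: cell_factor_def)

lemma row_factor_nonneg: "q > 0 \<Longrightarrow> row_factor P q t \<ge> 0"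
  by (simp add: row_factor_def)

lemma cell_weight_eq_prod:
  assumes "finite S" "\<And>p. p \<in> S \<Longrightarrow> prime p" "prime_factors n \<subseteq> S" "n > 0"
  shows "cell_weight P n = (\<Prod>q\<in>S. cell_factor P q (multiplicity q n))"
proof -
  have 0: "multiplicity q n = 0" if "q \<in> S - prime_factors n" for q
    using that assms(2)[of q] by (auto simp: prime_factors_multiplicity)
  have "(\<Prod>q\<in>S. cell_factor P q (multiplicity q n))
      = (\<Prod>q\<in>prime_factors n. cell_factor P q (multiplicity q n))"
    using assms(1,3) 0 by (intro prod.mono_neutral_right) (auto simp: cell_factor_def)
  also have "\<dots> = (\<Prod>q\<in>prime_factors n. (if q > P then 2 else 1) * (1 / real (q ^ multiplicity q n)))"
    by (intro prod.cong refl) (auto simp: cell_factor_def prime_factors_multiplicity)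
  also have "\<dots> = (\<Prod>q\<in>prime_factors n. if q > P then 2 else 1)
      * (1 / (\<Prod>q\<in>prime_factors n. real (q ^ multiplicity q n)))"
    by (simp only: prod.distrib prod_dividef prod.neutral_const)
  also have "(\<Prod>q\<in>prime_factors n. real (q ^ multiplicity q n)) = real n"
    using prime_factorization_nat[OF assms(4)] by (metis of_nat_prod)
  also have "(\<Prod>q\<in>prime_factors n. if q > P then 2 else 1 :: real) = 2 ^ card {q\<in>prime_factors n. q > P}"
    by (simp add: prod.If_cases Int_def)
  finally show ?thesis by (simp add: cell_weight_def)
qed

lemma multiplicity_lcm_nat:
  fixes a b :: nat
  assumes "prime q" "a > 0" "b > 0"
  shows "multiplicity q (lcm a b) = max (multiplicity q a) (multiplicity q b)"
proof -
  have "count (prime_factorization (lcm a b)) q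
      = count (prime_factorization a \<union># prime_factorization b) q"
    using assms by (simp add: prime_factorization_lcm)
  then show ?thesis using assms(1) by (simp add: count_prime_factorization_prime)
qed

lemma multiplicity_prime_free:
  assumes "prime r" "prime q" "q \<noteq> r" "m > 0"
  shows "multiplicity q (prime_free r m) = multiplicity q m"
proof -
  have e: "m = r ^ multiplicity r m * prime_free r m"
    unfolding prime_free_def by (simp add: multiplicity_dvd)
  then have "prime_free r m \<noteq> 0" using assms(4) by (metis mult_0_right less_numeral_extra(3))
  then have "multiplicity q (r ^ multiplicity r m * prime_free r m)
     = multiplicity q (r ^ multiplicity r m) + multiplicity q (prime_free r m)"
    using assms by (intro prime_elem_multiplicity_mult_distrib) auto
  moreover have "multiplicity q (r ^ multiplicity r m) = 0"
    using assms by (simp add: multiplicity_distinct_prime_power)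
  ultimately show ?thesis using e by simp
qed

lemma euler_factor_gt_1: "prime q \<Longrightarrow> real q / (real q - 1) > 1"
  using prime_gt_1_nat[of q] by (simp add: field_simps)

text \<open>Exponents \<open>t\<close> up to \<open>u\<close> repeat one term u + 1 times, the
  larger ones form a geometric tail. With y = q / (q - 1), the factor 2 at primes above
  \<open>P\<close> is absorbed by 1 + 2 (y - 1) \<le> y^2 if u = 0 and by 2 \<le> (u + 1) y
  otherwise; hence the squares in \<open>row_factor\<close>.\<close>

lemma sum_cell_factor_max_le:
  assumes q: "prime q"
  shows "(\<Sum>t\<le>V. cell_factor P q (max u t)) \<le> row_factor P q u"
proof -
  define k where "k = (if q > P then 2 else 1 :: real)"
  define y where "y = real q / (real q - 1)"
  have k: "k \<ge> 0" by (simp add: k_def)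
  have q1: "real q > 1" using prime_gt_1_nat[OF q] by simp
  have y1: "y > 1" using euler_factor_gt_1[OF q] by (simp add: y_def)
  have ye: "1 / real q ^ 1 * y = 1 / (real q - 1)" "y = 1 + 1 / (real q - 1)"
    using q1 by (auto simp: y_def field_simps)
  show ?thesis
  proof (cases "u = 0")
    case True
    have "(\<Sum>t\<le>V. cell_factor P q t) = (\<Sum>t\<in>{0..V}. cell_factor P q t)" by (simp add: atMost_atLeast0)
    also have "\<dots> = cell_factor P q 0 + (\<Sum>t\<in>{1..V}. cell_factor P q t)"
      by (subst sum.atLeast_Suc_atMost) auto
    also have "(\<Sum>t\<in>{1..V}. cell_factor P q t) = k * (\<Sum>t\<in>{1..V}. 1 / real q ^ t)"
      by (auto simp: cell_factor_def k_def sum_distrib_left intro!: sum.cong)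
    also have "\<dots> \<le> k * (1 / real q ^ 1 * y)"
      unfolding y_def using q1 k by (intro mult_left_mono geometric_le) auto
    also have "cell_factor P q 0 = 1" by (simp add: cell_factor_def)
    finally have b: "(\<Sum>t\<le>V. cell_factor P q t) \<le> 1 + k * (y - 1)" unfolding ye(1) using ye(2) by simp
    show ?thesis
    proof (cases "q > P")
      case q: True
      have "0 \<le> (y - 1)\<^sup>2" by simp
      then have "1 + 2 * (y - 1) \<le> y\<^sup>2" by (simp add: power2_eq_square algebra_simps)
      then show ?thesis using b True q by (simp add: row_factor_def k_def flip: y_def)
    next
      case False
      then show ?thesis using b True by (simp add: row_factor_def k_def flip: y_def)
    qed
  next
    case False
    have "(\<Sum>t\<le>V. cell_factor P q (max u t)) = k * (\<Sum>t\<le>V. 1 / real q ^ max u t)"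
      using False by (auto simp: cell_factor_def k_def sum_distrib_left intro!: sum.cong)
    also have "(\<Sum>t\<le>V. 1 / real q ^ max u t) \<le> (\<Sum>t\<in>{..u} \<union> {u<..V}. 1 / real q ^ max u t)"
      using q1 by (intro sum_mono2) auto
    also have "\<dots> = (\<Sum>t\<in>{..u}. 1 / real q ^ max u t) + (\<Sum>t\<in>{u<..V}. 1 / real q ^ max u t)"
      by (rule sum.union_disjoint) auto
    also have "(\<Sum>t\<in>{..u}. 1 / real q ^ max u t) = (\<Sum>t\<in>{..u}. 1 / real q ^ u)" by (intro sum.cong) auto
    also have "\<dots> = real (Suc u) * (1 / real q ^ u)" by simp
    also have "(\<Sum>t\<in>{u<..V}. 1 / real q ^ max u t) = (\<Sum>t\<in>{u<..V}. 1 / real q ^ t)"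
      by (intro sum.cong) auto
    also have "\<dots> \<le> 1 / real q ^ Suc u * y" unfolding y_def using q1 by (intro geometric_le) auto
    also have "\<dots> = 1 / real q ^ u * (1 / real q ^ 1 * y)" by simp
    also have "\<dots> = 1 / real q ^ u * (y - 1)" unfolding ye(1) using ye(2) by simp
    also have "real (Suc u) * (1 / real q ^ u) + 1 / real q ^ u * (y - 1)
        \<le> real (Suc u) / real q ^ u * y"
    proof -
      have "1 / real q ^ u * (y - 1) \<le> real (Suc u) / real q ^ u * (y - 1)"
        using y1 q1 by (intro mult_right_mono divide_right_mono) auto
      moreover have "real (Suc u) / real q ^ u * (y - 1)
          = real (Suc u) / real q ^ u * y - real (Suc u) * (1 / real q ^ u)"
        by (simp only: right_diff_distrib mult_1_right) simp
      ultimately show ?thesis by linarith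
    qed
    finally have b: "(\<Sum>t\<le>V. cell_factor P q (max u t)) \<le> k * (real (Suc u) / real q ^ u * y)"
      using k by (simp add: mult_left_mono)
    show ?thesis
    proof (cases "q > P")
      case q: True
      have "2 * 1 \<le> real (Suc u) * y" using False y1 by (intro mult_mono) auto
      then have "2 * 1 * (real (Suc u) / real q ^ u * y)
          \<le> (real (Suc u) * y) * (real (Suc u) / real q ^ u * y)"
        using y1 q1 by (intro mult_right_mono) auto
      also have "\<dots> = real (Suc u) ^ 2 / real q ^ u * y ^ 2" by (simp add: power2_eq_square)
      finally show ?thesis using b q by (simp add: row_factor_def k_def flip: y_def)
    next
      case q: False
      then show ?thesis using b by (simp add: row_factor_def k_def flip: y_def)
    qed
  qed
qed

text \<open>The largest prime \<open>r\<close> divides every modulus in \<open>top_moduli M r\<close>, so the exponent 0 of \<open>r\<close> does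
  not occur in the sums below.\<close>

definition top_factor :: "nat \<Rightarrow> nat \<Rightarrow> real" where
  "top_factor r t = (if t = 0 then 0 else 1 / real r ^ t)"

lemma top_factor_nonneg [simp]: "top_factor r t \<ge> 0"
  by (simp add: top_factor_def)

lemma sum_top_factor_le:
  assumes "prime r"
  shows "(\<Sum>t\<le>V. top_factor r t) \<le> 1 / (real r - 1)"
proof -
  have r: "real r > 1" using prime_gt_1_nat[OF assms] by simp
  have "(\<Sum>t\<le>V. top_factor r t) = (\<Sum>t\<in>{..V} - {0}. top_factor r t)"
    by (intro sum.mono_neutral_right) (auto simp: top_factor_def)
  also have "\<dots> = (\<Sum>t\<in>{..V} - {0}. 1 / real r ^ t)" by (intro sum.cong) (auto simp: top_factor_def)
  also have "\<dots> \<le> 1 / real r ^ 1 * (real r / (real r - 1))" using r by (intro geometric_le) auto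
  also have "\<dots> = 1 / (real r - 1)" using r by (simp add: field_simps)
  finally show ?thesis .
qed

lemma primes_upto_prime: "prime r \<Longrightarrow> primes_upto r = insert r (primes_upto (r - 1))"
  by (auto simp: prime_gt_0_nat)

text \<open>The Euler product bound over the primes up to \<open>r\<close>, with
  \<open>top_factor\<close> at \<open>r\<close>: the missing exponent 0 there is what gains 1 / (r -
  1).\<close>

lemma top_sum_le:
  fixes h H :: "nat \<Rightarrow> _"
  assumes r: "prime r" and T: "finite T" "T \<subseteq> top_moduli M r" "\<And>m. m \<in> T \<Longrightarrow> m > 0"
    and h: "\<And>q t. prime q \<Longrightarrow> q < r \<Longrightarrow> 0 \<le> h q t" "\<And>q V. prime q \<Longrightarrow> q < r \<Longrightarrow> (\<Sum>t\<le>V. h q t) \<le> H q"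
  shows "(\<Sum>m\<in>T. 1 / real r ^ multiplicity r m * (\<Prod>q\<in>primes_upto (r - 1). h q (multiplicity q m)))
     \<le> 1 / (real r - 1) * (\<Prod>q\<in>primes_upto (r - 1). H q)"
proof -
  define h' where "h' q = (if q = r then top_factor r else h q)" for q
  define H' where "H' q = (if q = r then 1 / (real r - 1) else H q)" for q
  have r0: "r > 0" using r by (rule prime_gt_0_nat)
  have nr: "r \<notin> primes_upto (r - 1)" using r0 by auto
  have split: "(\<Prod>q\<in>primes_upto r. f q) = f r * (\<Prod>q\<in>primes_upto (r - 1). f q)" for f :: "nat \<Rightarrow> real"
    unfolding primes_upto_prime[OF r] using nr by simp
  have "(\<Sum>m\<in>T. 1 / real r ^ multiplicity r m * (\<Prod>q\<in>primes_upto (r - 1). h q (multiplicity q m)))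
     = (\<Sum>m\<in>T. \<Prod>q\<in>primes_upto r. h' q (multiplicity q m))"
  proof (rule sum.cong[OF refl])
    fix m assume m: "m \<in> T"
    then have "multiplicity r m > 0"
      using T(2) r by (auto simp: top_moduli_def prime_factors_multiplicity)
    then have "h' r (multiplicity r m) = 1 / real r ^ multiplicity r m"
      by (simp add: h'_def top_factor_def)
    moreover have "(\<Prod>q\<in>primes_upto (r - 1). h' q (multiplicity q m))
        = (\<Prod>q\<in>primes_upto (r - 1). h q (multiplicity q m))"
      using nr by (intro prod.cong refl) (auto simp: h'_def)
    ultimately show "1 / real r ^ multiplicity r m * (\<Prod>q\<in>primes_upto (r - 1). h q (multiplicity q m))
      = (\<Prod>q\<in>primes_upto r. h' q (multiplicity q m))" by (simp add: split)
  qed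
  also have "\<dots> \<le> (\<Prod>q\<in>primes_upto r. H' q)"
  proof (rule smooth_sum_le)
    show "prime_factors m \<subseteq> primes_upto r" if "m \<in> T" for m
      using T(2) that by (auto simp: top_moduli_def)
    show "0 \<le> h' q t" if "q \<in> primes_upto r" for q t
      using that h(1) by (auto simp: h'_def)
    show "(\<Sum>t\<le>V. h' q t) \<le> H' q" if "q \<in> primes_upto r" for q V
      using that h(2) sum_top_factor_le[OF r] by (auto simp: h'_def H'_def)
  qed (use T in auto)
  also have "\<dots> = 1 / (real r - 1) * (\<Prod>q\<in>primes_upto (r - 1). H q)"
  proof -
    have "(\<Prod>q\<in>primes_upto (r - 1). H' q) = (\<Prod>q\<in>primes_upto (r - 1). H q)"
      using nr by (intro prod.cong refl) (auto simp: H'_def)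
    then show ?thesis by (simp add: split) (simp add: H'_def)
  qed
  finally show ?thesis .
qed

text \<open>Only one of the two moduli is summed out. The other sum is kept, so that it can be
  estimated either absolutely or relative to a density.\<close>

lemma second_moment_row_bound:
  assumes r: "prime r" and T: "finite M" "\<And>m. m \<in> top_moduli M r \<Longrightarrow> m > 0"
  shows "second_moment P M r \<le> 1 / (real r - 1) *
     (\<Sum>m\<in>top_moduli M r. 1 / real r ^ multiplicity r m * (\<Prod>q\<in>primes_upto (r - 1). row_factor P q (multiplicity q m)))"
proof -
  let ?T = "top_moduli M r"
  have fT: "finite ?T" using T(1) by (simp add: top_moduli_def)
  have pfr: "prime_factors m \<subseteq> {..r}" if "m \<in> ?T" for m using that by (simp add: top_moduli_def)
  have cw: "cell_weight P (lcm (prime_free r m) (prime_free r m'))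
      = (\<Prod>q\<in>primes_upto (r - 1). cell_factor P q (max (multiplicity q m) (multiplicity q m')))"
    if "m \<in> ?T" "m' \<in> ?T" for m m'
  proof -
    note f = prime_free_facts[OF r T(2)[OF that(1)] pfr[OF that(1)]]
    note f' = prime_free_facts[OF r T(2)[OF that(2)] pfr[OF that(2)]]
    have pos: "lcm (prime_free r m) (prime_free r m') > 0" using f(2) f'(2) by (simp add: lcm_pos_nat)
    have "prime_factors (lcm (prime_free r m) (prime_free r m'))
        = prime_factors (prime_free r m) \<union> prime_factors (prime_free r m')"
      using f(2) f'(2) by (simp add: prime_factorization_lcm)
    then have sub: "prime_factors (lcm (prime_free r m) (prime_free r m')) \<subseteq> primes_upto (r - 1)"
      using f(3) f'(3) by (auto dest: in_prime_factors_imp_prime)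
    have "cell_weight P (lcm (prime_free r m) (prime_free r m'))
      = (\<Prod>q\<in>primes_upto (r - 1). cell_factor P q (multiplicity q (lcm (prime_free r m) (prime_free r m'))))"
      using sub pos by (intro cell_weight_eq_prod) auto
    also have "\<dots> = (\<Prod>q\<in>primes_upto (r - 1). cell_factor P q (max (multiplicity q m) (multiplicity q m')))"
    proof (rule prod.cong[OF refl])
      fix q assume "q \<in> primes_upto (r - 1)"
      then have q: "prime q" "q \<noteq> r" using prime_gt_0_nat[OF r] by auto
      then show "cell_factor P q (multiplicity q (lcm (prime_free r m) (prime_free r m')))
        = cell_factor P q (max (multiplicity q m) (multiplicity q m'))"
        using f(2) f'(2) r T(2) that by (simp add: multiplicity_lcm_nat multiplicity_prime_free)
    qed
    finally show ?thesis .
  qed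
  have "second_moment P M r = (\<Sum>m\<in>?T. 1 / real r ^ multiplicity r m *
     (\<Sum>m'\<in>?T. 1 / real r ^ multiplicity r m' * (\<Prod>q\<in>primes_upto (r - 1). cell_factor P q (max (multiplicity q m) (multiplicity q m')))))"
    unfolding second_moment_def sum_distrib_left by (intro sum.cong refl) (simp add: cw power_add)
  also have "\<dots> \<le> (\<Sum>m\<in>?T. 1 / real r ^ multiplicity r m *
     (1 / (real r - 1) * (\<Prod>q\<in>primes_upto (r - 1). row_factor P q (multiplicity q m))))"
    by (intro sum_mono mult_left_mono top_sum_le[OF r fT order.refl T(2)] sum_cell_factor_max_le) auto
  also have "\<dots> = 1 / (real r - 1) *
     (\<Sum>m\<in>?T. 1 / real r ^ multiplicity r m * (\<Prod>q\<in>primes_upto (r - 1). row_factor P q (multiplicity q m)))"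
    by (simp add: sum_distrib_left mult_ac)
  finally show ?thesis .
qed

lemma sum_row_factor_le:
  assumes q: "prime q"
  shows "(\<Sum>u\<le>V. row_factor P q u) \<le> (real q / (real q - 1)) ^ 6"
proof -
  define y where "y = real q / (real q - 1)"
  have y1: "y \<ge> 1" using euler_factor_gt_1[OF q] by (simp add: y_def)
  show ?thesis
  proof (cases "q > P")
    case True
    then have "(\<Sum>u\<le>V. row_factor P q u) = (\<Sum>u\<le>V. real (Suc u) ^ 2 / real q ^ u) * y ^ 2"
      by (simp only: row_factor_def y_def if_True sum_distrib_right)
    also have "\<dots> \<le> y ^ 4 * y ^ 2"
      using sum_weighted_geometric_le(2)[OF q, of V] by (intro mult_right_mono) (auto simp: y_def)
    finally show ?thesis by (simp add: y_def flip: power_add)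
  next
    case False
    then have "(\<Sum>u\<le>V. row_factor P q u) = (\<Sum>u\<le>V. real (Suc u) / real q ^ u) * y"
      by (simp only: row_factor_def y_def if_False sum_distrib_right)
    also have "\<dots> \<le> y ^ 2 * y"
      using sum_weighted_geometric_le(1)[OF q, of V] y1 by (intro mult_right_mono) (auto simp: y_def)
    also have "\<dots> = y ^ 3" by (simp add: power2_eq_square power3_eq_cube)
    also have "\<dots> \<le> y ^ 6" using y1 by (intro power_increasing) auto
    finally show ?thesis by (simp add: y_def)
  qed
qed

lemma second_moment_le:
  assumes r: "prime r" and T: "finite M" "\<And>m. m \<in> top_moduli M r \<Longrightarrow> m > 0"
  shows "second_moment P M r \<le> euler_prod (primes_upto (r - 1)) ^ 6 / (real r - 1) ^ 2"
proof -
  let ?T = "top_moduli M r"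
  have r1: "real r > 1" using prime_gt_1_nat[OF r] by simp
  have fT: "finite ?T" using T(1) by (simp add: top_moduli_def)
  have "(\<Sum>m\<in>?T. 1 / real r ^ multiplicity r m
      * (\<Prod>q\<in>primes_upto (r - 1). row_factor P q (multiplicity q m)))
    \<le> 1 / (real r - 1) * (\<Prod>q\<in>primes_upto (r - 1). (real q / (real q - 1)) ^ 6)"
    by (intro top_sum_le[OF r fT order.refl T(2)] sum_row_factor_le row_factor_nonneg) (auto simp: prime_gt_0_nat)
  also have "(\<Prod>q\<in>primes_upto (r - 1). (real q / (real q - 1)) ^ 6)
      = euler_prod (primes_upto (r - 1)) ^ 6"
    by (simp add: euler_prod_def prod_power_distrib)
  finally have "1 / (real r - 1)
      * (\<Sum>m\<in>?T. 1 / real r ^ multiplicity r m * (\<Prod>q\<in>primes_upto (r - 1). row_factor P q (multiplicity q m)))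
    \<le> 1 / (real r - 1) * (1 / (real r - 1) * euler_prod (primes_upto (r - 1)) ^ 6)"
    using r1 by (intro mult_left_mono) auto
  also have "\<dots> = euler_prod (primes_upto (r - 1)) ^ 6 / (real r - 1) ^ 2"
    by (simp add: power2_eq_square)
  finally show ?thesis using second_moment_row_bound[OF assms, of P] by linarith
qed

text \<open>Truncation without case distinction in the application: a value above
  \<open>\<Psi>\<close> is charged to its fourth power.\<close>

lemma threshold_le:
  fixes t :: real
  assumes "t \<ge> 0" "\<Psi> > 0"
  shows "t \<le> \<Psi> + t ^ 4 / \<Psi> ^ 3"
proof (cases "t \<le> \<Psi>")
  case True
  then show ?thesis using assms by (simp add: add_increasing2)
next
  case False
  have "\<Psi> ^ 3 \<le> t ^ 3" using False assms by (intro power_mono) auto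
  then have "t * \<Psi> ^ 3 \<le> t * t ^ 3" using assms by (intro mult_left_mono)
  also have "\<dots> = t ^ 4" by (simp add: power4_eq_xxxx power3_eq_cube)
  finally have "t \<le> t ^ 4 / \<Psi> ^ 3" using assms by (simp add: pos_le_divide_eq)
  then show ?thesis using assms by linarith
qed

lemma primes_upto_split: "P < r \<Longrightarrow> primes_upto (r - 1) = primes_upto P \<union> {q. prime q \<and> P < q \<and> q < r}"
  by auto

text \<open>If \<open>V\<close> contains a class modulo the \<open>P\<close>-smooth part of each modulus, the second moment is bounded
  relative to the density of \<open>V\<close>. The divisor-type weight of the smooth part is bounded by \<open>\<Psi>\<close>, except
  on a set that a fourth moment shows to be negligible.\<close>

lemma second_moment_relative_le:
  assumes r: "prime r" "P < r" and M: "finite M" "\<And>m. m \<in> M \<Longrightarrow> m dvd N" "N > 0"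
    and V: "\<And>m. m \<in> top_moduli M r \<Longrightarrow> \<exists>b. \<forall>x. [x = b] (mod int (smooth_part P m)) \<longrightarrow> x \<in> V"
    and \<Psi>: "\<Psi> > 0"
  defines "E \<equiv> euler_prod (primes_upto (r - 1))" and "\<mu> \<equiv> avg N (\<lambda>x. of_bool (x \<in> V))"
  shows "second_moment P M r \<le> (\<Psi> * \<mu> * E ^ 6 + E ^ 17 / \<Psi> ^ 3) / (real r - 1) ^ 2"
proof -
  let ?T = "top_moduli M r"
  let ?A = "primes_upto P" and ?B = "{q. prime q \<and> P < q \<and> q < r}"
  define E1 where "E1 = euler_prod ?A"
  define E2 where "E2 = euler_prod ?B"
  have r1: "real r > 1" using prime_gt_1_nat[OF r(1)] by simp
  have fT: "finite ?T" using M(1) by (simp add: top_moduli_def)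
  have Tpos: "m > 0" if "m \<in> ?T"
    for m using that M(2,3) by (auto simp: top_moduli_def intro: dvd_pos_nat)
  have fB: "finite ?B" by (rule finite_subset[of _ "{..r}"]) auto
  have AB: "primes_upto (r - 1) = ?A \<union> ?B" "?A \<inter> ?B = {}" using primes_upto_split[OF r(2)] by auto
  have split: "(\<Prod>q\<in>primes_upto (r - 1). f q) = (\<Prod>q\<in>?A. f q) * (\<Prod>q\<in>?B. f q)" for f :: "nat \<Rightarrow> real"
    unfolding AB(1) by (rule prod.union_disjoint[OF finite_primes_le fB AB(2)])
  have E: "E = E1 * E2" unfolding E_def E1_def E2_def euler_prod_def by (rule split)
  have E1: "E1 \<ge> 1" and E2: "E2 \<ge> 1" unfolding E1_def E2_def by (auto intro: euler_prod_ge_1)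
  have \<mu>: "\<mu> \<ge> 0" unfolding \<mu>_def by (intro avg_nonneg) auto
  \<comment> \<open>The number of divisors of the \<open>P\<close>-smooth part of
    \<open>m\<close>.\<close>
  define \<tau> where "\<tau> m = (\<Prod>q\<in>?A. real (Suc (multiplicity q m)))" for m :: nat
  define R where "R m = (\<Prod>q\<in>?B. row_factor P q (multiplicity q m))" for m :: nat
  define a where "a m = smooth_part P m" for m
  have a0: "real (a m) > 0" for m unfolding a_def by simp
  have R0: "R m \<ge> 0"
    for m unfolding R_def by (intro prod_nonneg row_factor_nonneg) (auto simp: prime_gt_0_nat)
  have aprod: "real (a m) = (\<Prod>q\<in>?A. real q ^ multiplicity q m)" for m
    unfolding a_def smooth_part_def by simp
  have row: "(\<Prod>q\<in>primes_upto (r - 1). row_factor P q (multiplicity q m))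
      = \<tau> m * (E1 / real (a m)) * R m" for m
  proof -
    have "(\<Prod>q\<in>?A. row_factor P q (multiplicity q m))
      = (\<Prod>q\<in>?A. real (Suc (multiplicity q m)) * (real q / (real q - 1) / real q ^ multiplicity q m))"
      by (intro prod.cong refl) (auto simp: row_factor_def)
    also have "\<dots> = \<tau> m * (E1 / real (a m))"
      unfolding \<tau>_def E1_def euler_prod_def aprod by (simp only: prod.distrib prod_dividef)
    finally show ?thesis unfolding split R_def by simp
  qed
  \<comment> \<open>In \<open>X\<close> the divisor count is replaced by 1, and the sum is bounded
    through \<mu>; \<open>Y\<close> carries its fourth power and is bounded absolutely.\<close>
  define X where "X = (\<Sum>m\<in>?T. 1 / real r ^ multiplicity r m * (E1 / real (a m) * R m))"
  define Y where "Y = (\<Sum>m\<in>?T. 1 / real r ^ multiplicity r m * (\<tau> m ^ 4 * (E1 / real (a m)) * R m))"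
  have "(\<Sum>m\<in>?T. 1 / real r ^ multiplicity r m
      * (\<Prod>q\<in>primes_upto (r - 1). row_factor P q (multiplicity q m)))
     \<le> (\<Sum>m\<in>?T. 1 / real r ^ multiplicity r m * ((\<Psi> + \<tau> m ^ 4 / \<Psi> ^ 3) * (E1 / real (a m)) * R m))"
    unfolding row
  proof (intro sum_mono mult_left_mono mult_right_mono)
    fix m show "\<tau> m \<le> \<Psi> + \<tau> m ^ 4 / \<Psi> ^ 3"
      using \<Psi> by (intro threshold_le) (auto simp: \<tau>_def intro: prod_nonneg)
  qed (use R0 E1 a0 in \<open>auto intro: divide_nonneg_pos\<close>)
  also have "\<dots> = \<Psi> * X + Y / \<Psi> ^ 3"
    unfolding X_def Y_def sum_distrib_left sum_divide_distrib sum.distrib [symmetric]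
    by (intro sum.cong refl) (simp add: algebra_simps)
  finally have total: "second_moment P M r \<le> 1 / (real r - 1) * (\<Psi> * X + Y / \<Psi> ^ 3)"
    using second_moment_row_bound[OF r(1) M(1) Tpos, of P] r1
    by (smt (verit, best) mult_left_mono divide_nonneg_nonneg)
  \<comment> \<open>At q \<le> P the fourth powers give exponent 16 and the factor belonging to
    \<open>E1\<close> one more; at q > P the row factors stay within exponent 6.\<close>
  have Y: "Y \<le> 1 / (real r - 1) * E ^ 17"
  proof -
    define h where "h q t
        = (if q \<le> P then real q / (real q - 1) * (real (Suc t) ^ 4 / real q ^ t) else row_factor P q t)" for q t
    have "Y = (\<Sum>m\<in>?T. 1 / real r ^ multiplicity r m * (\<Prod>q\<in>primes_upto (r - 1). h q (multiplicity q m)))"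
      unfolding Y_def
    proof (intro sum.cong refl arg_cong[where f = "\<lambda>x. _ * x"])
      fix m
      have "(\<Prod>q\<in>?A. h q (multiplicity q m))
        = (\<Prod>q\<in>?A. real (Suc (multiplicity q m)) ^ 4 * (real q / (real q - 1) / real q ^ multiplicity q m))"
        by (intro prod.cong refl) (auto simp: h_def)
      also have "\<dots> = \<tau> m ^ 4 * (E1 / real (a m))"
        unfolding \<tau>_def E1_def euler_prod_def aprod
          by (simp only: prod.distrib prod_dividef prod_power_distrib)
      finally have 1: "(\<Prod>q\<in>?A. h q (multiplicity q m)) = \<tau> m ^ 4 * (E1 / real (a m))" .
      have "(\<Prod>q\<in>?B. h q (multiplicity q m)) = R m"
        unfolding R_def by (intro prod.cong refl) (auto simp: h_def)
      then show "\<tau> m ^ 4 * (E1 / real (a m)) * R m = (\<Prod>q\<in>primes_upto (r - 1). h q (multiplicity q m))"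
        unfolding split using 1 by simp
    qed
    also have "\<dots> \<le> 1 / (real r - 1) * (\<Prod>q\<in>primes_upto (r - 1). (real q / (real q - 1)) ^ 17)"
    proof (rule top_sum_le[OF r(1) fT order.refl Tpos])
      fix q assume q: "prime q" "q < r"
      have q1: "real q > 1" using prime_gt_1_nat[OF q(1)] by simp
      define y where "y = real q / (real q - 1)"
      have y1: "y \<ge> 1" using euler_factor_gt_1[OF q(1)] by (simp add: y_def)
      show "0 \<le> h q t" for t using q1 row_factor_nonneg[of q P t] by (auto simp: h_def)
      show "(\<Sum>t\<le>V. h q t) \<le> (real q / (real q - 1)) ^ 17" for V
      proof (cases "q \<le> P")
        case True
        then have "(\<Sum>t\<le>V. h q t) = y * (\<Sum>t\<le>V. real (Suc t) ^ 4 / real q ^ t)"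
          by (simp only: h_def y_def if_True sum_distrib_left)
        also have "\<dots> \<le> y * y ^ 16"
          using sum_weighted_geometric_le(3)[OF q(1), of V] y1
            by (intro mult_left_mono) (auto simp: y_def)
        also have "\<dots> = y ^ 17" by (simp add: numeral_eq_Suc)
        finally show ?thesis by (simp add: y_def)
      next
        case False
        then have "(\<Sum>t\<le>V. h q t) \<le> y ^ 6"
          using sum_row_factor_le[OF q(1), of P V] by (simp add: h_def y_def)
        also have "\<dots> \<le> y ^ 17" using y1 by (intro power_increasing) auto
        finally show ?thesis by (simp add: y_def)
      qed
    qed
    also have "(\<Prod>q\<in>primes_upto (r - 1). (real q / (real q - 1)) ^ 17) = E ^ 17"
      by (simp add: E_def euler_prod_def prod_power_distrib)
    finally show ?thesis .
  qed
  have X: "X \<le> 1 / (real r - 1) * (\<mu> * E ^ 6)"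
  proof -
    define d where "d m = m div a m" for m
    have ad: "m = a m * d m" if "m \<in> ?T" for m
      using smooth_part_dvd[of m P] Tpos[OF that] by (simp add: a_def d_def)
    have d0: "d m > 0" if "m \<in> ?T" for m using ad[OF that] Tpos[OF that] by (metis gr0I mult_0_right)
    have dmult: "multiplicity q (d m) = (if q \<le> P then 0 else multiplicity q m)"
      if "m \<in> ?T" "prime q" for m q
    proof -
      have "multiplicity q (a m * d m) = multiplicity q (a m) + multiplicity q (d m)"
        using that(2) d0[OF that(1)] a0[of m] by (intro prime_elem_multiplicity_mult_distrib) auto
      then show ?thesis using ad[OF that(1)] that(2)
        by (auto simp: a_def multiplicity_smooth_part split: if_splits)
    qed
    define g where "g n = 1 / real r ^ multiplicity r n * R n" for n
    have g0: "g n \<ge> 0" for n unfolding g_def using R0 by simp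
    have gd: "1 / real r ^ multiplicity r m * R m = g (d m)" if m: "m \<in> ?T" for m
    proof -
      have "R (d m) = R m" unfolding R_def using dmult[OF m] by (intro prod.cong refl) auto
      then show ?thesis unfolding g_def using dmult[OF m r(1)] r(2) by simp
    qed
    \<comment> \<open>For a fixed cofactor \<open>n\<close> the smooth parts are distinct, and
      \<open>V\<close> contains a class modulo each of them: this is where the density of
      \<open>V\<close> enters.\<close>
    have fib: "(\<Sum>m\<in>{m\<in>?T. d m = n}. 1 / real (a m)) \<le> E1 * \<mu>" for n
    proof -
      let ?F = "{m\<in>?T. d m = n}"
      have inj: "inj_on a ?F" by (rule inj_onI) (metis (mono_tags, lifting) ad mem_Collect_eq)
      have "(\<Sum>m\<in>?F. 1 / real (a m)) = (\<Sum>k\<in>a ` ?F. 1 / real k)" by (simp add: sum.reindex[OF inj])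
      also have "\<dots> \<le> E1 * \<mu>"
        unfolding E1_def \<mu>_def
      proof (rule class_sum_le)
        show "finite (a ` ?F)" using fT by simp
        fix k assume "k \<in> a ` ?F"
        then obtain m where m: "m \<in> ?T" "k = a m" by auto
        have "k dvd m" using ad[OF m(1)] m(2) by (metis dvd_triv_left)
        also have "m dvd N" using m(1) M(2) by (simp add: top_moduli_def)
        finally show "k dvd N" .
        show "prime_factors k \<subseteq> ?A" unfolding m(2) a_def by (rule prime_factors_smooth_part)
        show "\<exists>b. \<forall>x. [x = b] (mod int k) \<longrightarrow> x \<in> V" unfolding m(2) a_def by (rule V[OF m(1)])
      qed (use M(3) in auto)
      finally show ?thesis .
    qed
    have "X = (\<Sum>m\<in>?T. E1 * g (d m) * (1 / real (a m)))"
      unfolding X_def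
    proof (rule sum.cong[OF refl])
      fix m assume m: "m \<in> ?T"
      show "1 / real r ^ multiplicity r m * (E1 / real (a m) * R m) = E1 * g (d m) * (1 / real (a m))"
        unfolding gd[OF m, symmetric] by simp
    qed
    also have "\<dots> = (\<Sum>n\<in>d ` ?T. \<Sum>m\<in>{m\<in>?T. d m = n}. E1 * g (d m) * (1 / real (a m)))"
      by (rule sum.image_gen[OF fT])
    also have "\<dots> = (\<Sum>n\<in>d ` ?T. E1 * g n * (\<Sum>m\<in>{m\<in>?T. d m = n}. 1 / real (a m)))"
      unfolding sum_distrib_left by (intro sum.cong refl) auto
    also have "\<dots> \<le> (\<Sum>n\<in>d ` ?T. E1 * g n * (E1 * \<mu>))"
      using E1 g0 by (intro sum_mono mult_left_mono fib) auto
    also have "\<dots> = E1 ^ 2 * \<mu> * (\<Sum>n\<in>d ` ?T. g n)"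
      by (simp add: sum_distrib_left power2_eq_square mult_ac)
    also have "(\<Sum>n\<in>d ` ?T. g n) \<le> 1 / (real r - 1) * E2 ^ 6"
    proof -
      \<comment> \<open>Cofactors have no prime factor up to \<open>P\<close>, so only exponent 0 is
        counted there, and the product reduces to the primes above \<open>P\<close>.\<close>
      define h where "h q = (if q \<le> P then (\<lambda>t. of_bool (t = 0)) else row_factor P q)" for q
      have "(\<Sum>n\<in>d ` ?T. g n)
          = (\<Sum>n\<in>d ` ?T. 1 / real r ^ multiplicity r n * (\<Prod>q\<in>primes_upto (r - 1). h q (multiplicity q n)))"
      proof (rule sum.cong[OF refl])
        fix n assume "n \<in> d ` ?T"
        then obtain m where m: "m \<in> ?T" "n = d m" by auto
        have "(\<Prod>q\<in>?A. h q (multiplicity q n)) = 1"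
          using dmult[OF m(1)] m(2) by (intro prod.neutral) (auto simp: h_def)
        moreover have "(\<Prod>q\<in>?B. h q (multiplicity q n)) = R n"
          unfolding R_def by (intro prod.cong refl) (auto simp: h_def)
        ultimately show "g n = 1 / real r ^ multiplicity r n
            * (\<Prod>q\<in>primes_upto (r - 1). h q (multiplicity q n))"
          unfolding split g_def by simp
      qed
      also have "\<dots> \<le> 1 / (real r - 1)
          * (\<Prod>q\<in>primes_upto (r - 1). if q \<le> P then 1 else (real q / (real q - 1)) ^ 6)"
      proof (rule top_sum_le[OF r(1), where M = "d ` ?T"])
        show "d ` ?T \<subseteq> top_moduli (d ` ?T) r"
        proof
          fix n assume n: "n \<in> d ` ?T"
          then obtain m where m: "m \<in> ?T" "n = d m" by auto
          have rm: "r \<in> prime_factors m" "prime_factors m \<subseteq> {..r}"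
            using m(1) by (auto simp: top_moduli_def)
          have "multiplicity r n > 0"
            using dmult[OF m(1) r(1)] r m rm(1) by (simp add: prime_factors_multiplicity)
          then have "r \<in> prime_factors n" using r(1) by (simp add: prime_factors_multiplicity)
          moreover have "prime_factors n \<subseteq> prime_factors m"
            using ad[OF m(1)] m(2) Tpos[OF m(1)]
              by (intro dvd_prime_factors) (auto, metis dvd_triv_right)
          ultimately show "n \<in> top_moduli (d ` ?T) r" using n rm(2) by (auto simp: top_moduli_def)
        qed
        fix q assume q: "prime q" "q < r"
        show "0 \<le> h q t" for t
          using row_factor_nonneg[of q P t] prime_gt_0_nat[OF q(1)] by (auto simp: h_def)
        show "(\<Sum>t\<le>V. h q t) \<le> (if q \<le> P then 1 else (real q / (real q - 1)) ^ 6)" for V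
        proof (cases "q \<le> P")
          case True
          have "(\<Sum>t\<le>V. of_bool (t = 0) :: real) = (\<Sum>t\<in>{0::nat}. of_bool (t = 0))"
            by (intro sum.mono_neutral_right) auto
          then show ?thesis using True by (simp add: h_def)
        qed (use sum_row_factor_le[OF q(1), of P V] in \<open>simp add: h_def\<close>)
      qed (use fT d0 in auto)
      also have "(\<Prod>q\<in>primes_upto (r - 1). if q \<le> P then 1 else (real q / (real q - 1)) ^ 6) = E2 ^ 6"
      proof -
        have "(\<Prod>q\<in>?A. if q \<le> P then 1 else (real q / (real q - 1)) ^ 6) = 1"
          by (intro prod.neutral) auto
        moreover have "(\<Prod>q\<in>?B. if q \<le> P then 1 else (real q / (real q - 1)) ^ 6)
            = (\<Prod>q\<in>?B. (real q / (real q - 1)) ^ 6)"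
          by (intro prod.cong refl) auto
        ultimately show ?thesis unfolding split by (simp add: E2_def euler_prod_def prod_power_distrib)
      qed
      finally show ?thesis .
    qed
    finally have "X \<le> E1 ^ 2 * \<mu> * (1 / (real r - 1) * E2 ^ 6)"
      using E1 \<mu> by (simp add: mult_left_mono)
    also have "\<dots> = 1 / (real r - 1) * \<mu> * (E1 ^ 2 * E2 ^ 6)" by simp
    also have "\<dots> \<le> 1 / (real r - 1) * \<mu> * (E1 ^ 6 * E2 ^ 6)"
      using E1 E2 \<mu> r1 by (intro mult_left_mono mult_right_mono power_increasing) auto
    also have "\<dots> = 1 / (real r - 1) * (\<mu> * E ^ 6)" by (simp add: E power_mult_distrib)
    finally show ?thesis .
  qed
  have "\<Psi> * X + Y / \<Psi> ^ 3 \<le> \<Psi> * (1 / (real r - 1) * (\<mu> * E ^ 6)) + (1 / (real r - 1) * E ^ 17) / \<Psi> ^ 3"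
    using X Y \<Psi> by (intro add_mono mult_left_mono divide_right_mono) auto
  also have "\<dots> = 1 / (real r - 1) * (\<Psi> * \<mu> * E ^ 6 + E ^ 17 / \<Psi> ^ 3)" by (simp add: algebra_simps)
  finally have "1 / (real r - 1) * (\<Psi> * X + Y / \<Psi> ^ 3)
     \<le> 1 / (real r - 1) * (1 / (real r - 1) * (\<Psi> * \<mu> * E ^ 6 + E ^ 17 / \<Psi> ^ 3))"
    using r1 by (intro mult_left_mono) auto
  then show ?thesis using total by (simp add: power2_eq_square)
qed

subsection \<open>The sifted set\<close>

text \<open>Rankin's trick: 1 \<le> (m / Y)^s on \<open>T\<close>. The choice of \<open>s\<close>
  means R^s = 3/2, so q^s / q is at most 3 / (2 q) \<le> 3/4 even for q = 2 and the local series
  converges. It is at most 1 + 8 * 3 / (2 q), which Bernoulli's inequality bounds by (q / (q -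
  1))^12.\<close>

lemma rankin_tail:
  assumes T: "finite T" "\<And>m. m \<in> T \<Longrightarrow> m > 0" "\<And>m. m \<in> T \<Longrightarrow> prime_factors m \<subseteq> {..R}"
      "\<And>m. m \<in> T \<Longrightarrow> Y \<le> real m"
    and Y: "Y > 0" and R: "R \<ge> 2" and s: "s = ln (3/2) / ln (real R)"
  shows "(\<Sum>m\<in>T. cell_weight P m) \<le> Y powr - s * euler_prod (primes_upto R) ^ 12"
proof -
  have s0: "s > 0" unfolding s using R by (intro divide_pos_pos) auto
  have Rs: "real R powr s = 3/2" using R by (simp add: s powr_def)
  define h where "h q t = (if t = 0 then 1 else 2 * (real q powr s / real q) ^ t)" for q t :: nat
  have "(\<Sum>m\<in>T. cell_weight P m) \<le> (\<Sum>m\<in>T. Y powr - s * (\<Prod>q\<in>primes_upto R. h q (multiplicity q m)))"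
  proof (rule sum_mono)
    fix m assume m: "m \<in> T"
    note m0 = T(2)[OF m]
    have pf: "prime_factors m \<subseteq> primes_upto R"
      using T(3)[OF m] by (auto dest: in_prime_factors_imp_prime)
    have "real m = (\<Prod>q\<in>primes_upto R. real q ^ multiplicity q m)"
    proof -
      have "real m = (\<Prod>q\<in>prime_factors m. real q ^ multiplicity q m)"
        using prime_factorization_nat[OF m0]
          by (metis (no_types, lifting) of_nat_power of_nat_prod prod.cong)
      also have "\<dots> = (\<Prod>q\<in>primes_upto R. real q ^ multiplicity q m)"
        using pf by (intro prod.mono_neutral_left) (auto simp: prime_factors_multiplicity)
      finally show ?thesis .
    qed
    then have "real m powr s = (\<Prod>q\<in>primes_upto R. real q ^ multiplicity q m) powr s" by simp
    also have "\<dots> = (\<Prod>q\<in>primes_upto R. (real q powr s) ^ multiplicity q m)"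
      unfolding prod_powr_distrib
    proof (rule prod.cong[OF refl])
      fix q assume "q \<in> primes_upto R"
      then have "real q > 0" by (auto simp: prime_gt_0_nat)
      then show "(real q ^ multiplicity q m) powr s = (real q powr s) ^ multiplicity q m"
        by (simp add: powr_power powr_powr mult.commute flip: powr_realpow)
    qed
    finally have ms: "real m powr s = (\<Prod>q\<in>primes_upto R. (real q powr s) ^ multiplicity q m)" .
    have "1 \<le> (real m / Y) powr s" using T(4)[OF m] Y s0 by (intro ge_one_powr_ge_zero) auto
    also have "\<dots> = Y powr - s * real m powr s" using Y m0 by (simp add: powr_divide powr_minus_divide)
    finally have "cell_weight P m \<le> (Y powr - s * real m powr s) * cell_weight P m"
      using mult_right_mono[of 1 _ "cell_weight P m"] by simp
    also have "\<dots> = Y powr - s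
        * (\<Prod>q\<in>primes_upto R. (real q powr s) ^ multiplicity q m * cell_factor P q (multiplicity q m))"
      unfolding ms prod.distrib using cell_weight_eq_prod[OF finite_primes_le _ pf m0, of P] by simp
    also have "\<dots> \<le> Y powr - s * (\<Prod>q\<in>primes_upto R. h q (multiplicity q m))"
    proof (intro mult_left_mono prod_mono conjI)
      fix q assume "q \<in> primes_upto R"
      then have q: "real q > 0" by (auto simp: prime_gt_0_nat)
      show "(real q powr s) ^ multiplicity q m * cell_factor P q (multiplicity q m)
          \<le> h q (multiplicity q m)"
        using q by (auto simp: h_def cell_factor_def power_divide divide_right_mono)
    qed auto
    finally show "cell_weight P m \<le> \<dots>" .
  qed
  also have "\<dots> = Y powr - s * (\<Sum>m\<in>T. \<Prod>q\<in>primes_upto R. h q (multiplicity q m))"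
    by (simp add: sum_distrib_left)
  also have "\<dots> \<le> Y powr - s * (\<Prod>q\<in>primes_upto R. (real q / (real q - 1)) ^ 12)"
  proof (intro mult_left_mono smooth_sum_le)
    show "prime_factors m \<subseteq> primes_upto R" if "m \<in> T" for m
      using T(3)[OF that] by (auto dest: in_prime_factors_imp_prime)
    fix q assume q: "q \<in> primes_upto R"
    then have q2: "real q \<ge> 2" using prime_ge_2_nat by auto
    define x where "x = real q powr s / real q"
    have "real q powr s \<le> real R powr s" using q s0 by (intro powr_mono2) auto
    then have "x \<le> 3/2 / real q" unfolding x_def Rs by (rule divide_right_mono) simp
    moreover have "x > 0" using q2 by (simp add: x_def)
    ultimately have x: "x \<le> 3/2 / real q" "x > 0" by auto
    have "3/2 / real q \<le> 3/4" using q2 by (simp add: field_simps)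
    then have x34: "x \<le> 3/4" using x by linarith
    show "0 \<le> h q t" for t by (simp add: h_def)
    show "(\<Sum>t\<le>V. h q t) \<le> (real q / (real q - 1)) ^ 12" for V
    proof -
      have "(\<Sum>t\<le>V. h q t) = h q 0 + (\<Sum>t\<in>{..V} - {0}. h q t)"
        by (subst sum.remove[of _ 0]) auto
      also have "(\<Sum>t\<in>{..V} - {0}. h q t) = 2 * (\<Sum>t\<in>{..V} - {0}. 1 / (1 / x) ^ t)"
        unfolding sum_distrib_left
        by (intro sum.cong refl) (simp add: h_def power_one_over flip: x_def)
      also have "\<dots> \<le> 2 * (1 / (1 / x) ^ 1 * ((1 / x) / (1 / x - 1)))"
        using x x34 by (intro mult_left_mono geometric_le) auto
      also have "1 / (1 / x) ^ 1 * ((1 / x) / (1 / x - 1)) = x / (1 - x)"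
        using x x34 by (simp add: field_simps)
      also have "\<dots> \<le> 4 * x"
      proof -
        have "x * 1 \<le> x * (4 * (1 - x))" using x x34 by (intro mult_left_mono) auto
        then show ?thesis using x34 by (simp add: pos_divide_le_eq mult_ac)
      qed
      also have "h q 0 + 2 * (4 * x) \<le> 1 + 12 * (1 / (real q - 1))"
      proof -
        have "8 * x \<le> 12 * (1 / real q)" using x by simp
        also have "\<dots> \<le> 12 * (1 / (real q - 1))" using q2 by (intro mult_left_mono divide_left_mono) auto
        finally show ?thesis by (simp add: h_def)
      qed
      also have "\<dots> \<le> (1 + 1 / (real q - 1)) ^ 12"
      proof -
        have "0 \<le> 1 / (real q - 1)" using q2 by simp
        then have "-1 \<le> 1 / (real q - 1)" by linarith
        from Bernoulli_inequality[OF this, of 12] show ?thesis by simp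
      qed
      also have "1 + 1 / (real q - 1) = real q / (real q - 1)" using q2 by (simp add: field_simps)
      finally show ?thesis by simp
    qed
  qed (use T in auto)
  finally show ?thesis by (simp add: euler_prod_def prod_power_distrib)
qed

section \<open>Disjoint classes and the sieve\<close>

lemma cong_pair_solvable:
  fixes m n :: nat
  assumes "[a = b] (mod int (gcd m n))"
  shows "\<exists>x. [x = a] (mod int m) \<and> [x = b] (mod int n)"
proof -
  obtain k where k: "b = a + int (gcd m n) * k" using assms by (metis cong_iff_lin)
  obtain u v where uv: "u * int m + v * int n = int (gcd m n)"
    using bezout_int[of "int m" "int n"] by auto
  define x where "x = a + int m * (u * k)"
  have "x = b - int n * (v * k)" unfolding x_def k uv [symmetric] by (simp add: algebra_simps)
  then have "[x = b] (mod int n)" by (simp add: cong_iff_dvd_diff)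
  moreover have "[x = a] (mod int m)" unfolding x_def by (simp add: cong_iff_dvd_diff)
  ultimately show ?thesis by blast
qed

text \<open>Whether two classes meet is decided modulo \<open>gcd m n\<close>, so the class of
  \<open>a\<close> modulo any multiple \<open>c\<close> of the gcd already misses the other class.
  In the applications \<open>c\<close> is a divisor of \<open>m\<close>; this is how disjointness
  places classes inside a sifted set.\<close>

lemma class_avoids:
  assumes "\<not> (\<exists>x. [x = a] (mod int m) \<and> [x = b] (mod int n))" "gcd m n dvd c"
    and x: "[x = a] (mod int c)"
  shows "\<not> [x = b] (mod int n)"
proof
  assume "[x = b] (mod int n)"
  then have "[x = b] (mod int (gcd m n))" by (rule cong_dvd_modulus) simp
  moreover have "[x = a] (mod int (gcd m n))"
    using x assms(2) by (rule cong_dvd_modulus[OF _ of_nat_dvd_iff[THEN iffD2]])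
  ultimately have "[a = b] (mod int (gcd m n))" using cong_sym cong_trans by blast
  then show False using cong_pair_solvable assms(1) by blast
qed

definition sifted :: "nat set \<Rightarrow> (nat \<Rightarrow> int) \<Rightarrow> nat \<Rightarrow> int set" where
  "sifted M a z = {x. \<forall>m\<in>M. prime_factors m \<subseteq> {..z} \<longrightarrow> \<not> [x = a m] (mod int m)}"

lemma avg_minus_classes:
  assumes "finite T" "\<And>m. m \<in> T \<Longrightarrow> m dvd N" "N > 0"
    and "\<And>x. f x - (\<Sum>m\<in>T. of_bool ([x = a m] (mod int m))) \<le> g x"
  shows "avg N f - (\<Sum>m\<in>T. 1 / real m) \<le> avg N g"
proof -
  have "avg N f \<le> avg N (\<lambda>x. g x + (\<Sum>m\<in>T. of_bool ([x = a m] (mod int m))))"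
    by (rule avg_mono) (use assms(4) in \<open>simp add: diff_le_eq\<close>)
  also have "\<dots> = avg N g + (\<Sum>m\<in>T. avg N (\<lambda>x. of_bool ([x = a m] (mod int m))))"
    by (simp only: avg_add avg_sum)
  also have "(\<Sum>m\<in>T. avg N (\<lambda>x. of_bool ([x = a m] (mod int m)))) = (\<Sum>m\<in>T. 1 / real m)"
    using assms(2,3) by (intro sum.cong refl avg_class)
  finally show ?thesis by simp
qed

text \<open>The moduli divisible by the next prime \<open>p\<close> lie inside the sifted set, which contains a class
  modulo their \<open>p\<close>-free parts; hence they cover only a proportion of it.\<close>

lemma sifted_prime_step:
  assumes M: "finite M" "\<And>m. m \<in> M \<Longrightarrow> m dvd N" "N > 0"
    and disj: "\<And>m n. m \<in> M \<Longrightarrow> n \<in> M \<Longrightarrow> m \<noteq> n \<Longrightarrow> \<not> (\<exists>x. [x = a m] (mod int m) \<and> [x = a n] (mod int n))"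
    and p: "prime (Suc z)"
  defines "\<mu> \<equiv> \<lambda>z. avg N (\<lambda>x. of_bool (x \<in> sifted M a z))"
  shows "\<mu> (Suc z) \<ge> \<mu> z * (1 - euler_prod (primes_upto z) / real z)"
proof -
  define p where "p = Suc z"
  define T where "T = top_moduli M p"
  have pp: "prime p" using p by (simp add: p_def)
  have z0: "real p > 1" "real z = real p - 1" using prime_gt_1_nat[OF pp] by (auto simp: p_def)
  have T: "m dvd N" "m > 0" "prime_factors m \<subseteq> {..p}" "m \<in> M" "multiplicity p m > 0" if "m \<in> T" for m
    using that M(2,3) pp unfolding T_def top_moduli_def
      by (auto intro: dvd_pos_nat simp: prime_factors_multiplicity)
  have fT: "finite T" unfolding T_def top_moduli_def using M(1) by simp
  have \<mu>0: "\<mu> z \<ge> 0" unfolding \<mu>_def by (intro avg_nonneg) auto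
  have E0: "euler_prod (primes_upto z) \<ge> 1" by (rule euler_prod_ge_1) auto
  let ?v = "multiplicity p"
  have pf: "m = p ^ ?v m * prime_free p m" "prime_free p m > 0"
    "prime_factors (prime_free p m) \<subseteq> {..z}" "coprime p (prime_free p m)" if "m \<in> T" for m
    using prime_free_facts[OF pp T(2,3)[OF that]] that by (auto simp: p_def)
  \<comment> \<open>For a fixed exponent of \<open>p\<close> the \<open>p\<close>-free parts are
    distinct, and the bound does not depend on the exponent; summing p^(-v) over v \<ge> 1 then
    gives 1 / (p - 1), that is 1 / z.\<close>
  have fib: "(\<Sum>m\<in>{m\<in>T. ?v m = v}. 1 / real (prime_free p m)) \<le> euler_prod (primes_upto z) * \<mu> z" for v
  proof -
    let ?F = "{m\<in>T. ?v m = v}"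
    have inj: "inj_on (prime_free p) ?F"
      by (rule inj_onI) (metis (mono_tags, lifting) pf(1) mem_Collect_eq)
    have "(\<Sum>m\<in>?F. 1 / real (prime_free p m)) = (\<Sum>k\<in>prime_free p ` ?F. 1 / real k)"
      by (simp add: sum.reindex[OF inj])
    also have "\<dots> \<le> euler_prod (primes_upto z) * \<mu> z"
      unfolding \<mu>_def
    proof (rule class_sum_le)
      show "finite (prime_free p ` ?F)" using fT by simp
      fix k assume "k \<in> prime_free p ` ?F"
      then obtain m where m: "m \<in> T" "k = prime_free p m" by auto
      have "k dvd m" using pf(1)[OF m(1)] m(2) by (metis dvd_triv_right)
      then show "k dvd N" using T(1)[OF m(1)] dvd_trans by blast
      show "prime_factors k \<subseteq> primes_upto z"
        using pf(3)[OF m(1)] m(2) by (auto dest: in_prime_factors_imp_prime)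
      have "x \<in> sifted M a z" if x: "[x = a m] (mod int k)" for x
        unfolding sifted_def
      proof (intro CollectI ballI impI)
        fix n assume n: "n \<in> M" "prime_factors n \<subseteq> {..z}"
        have n0: "n > 0" using n(1) M(2,3) by (auto intro: dvd_pos_nat)
        have np: "\<not> p dvd n" using n(2) pp n0 by (auto simp: p_def prime_factors_dvd)
        then have "m \<noteq> n" using T(5)[OF m(1)] by (auto simp: not_dvd_imp_multiplicity_0)
        \<comment> \<open>All primes of \<open>n\<close> are below \<open>p\<close>, so the power of
          \<open>p\<close> in \<open>m\<close> does not enter the gcd.\<close>
        moreover have "gcd m n dvd k"
        proof -
          have "coprime n (p ^ ?v m)"
            using np pp by (metis coprime_commute coprime_power_right_iff prime_imp_coprime)
          then have "coprime (gcd m n) (p ^ ?v m)" by (meson coprime_divisors dvd_refl gcd_dvd2)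
          moreover have "gcd m n dvd p ^ ?v m * k" using pf(1)[OF m(1)] m(2) by (metis gcd_dvd1)
          ultimately show ?thesis by (simp add: coprime_dvd_mult_right_iff)
        qed
        ultimately show "\<not> [x = a n] (mod int n)"
          using x by (intro class_avoids[OF disj[OF T(4)[OF m(1)] n(1)]])
      qed
      then show "\<exists>b. \<forall>x. [x = b] (mod int k) \<longrightarrow> x \<in> sifted M a z" by blast
    qed (use M(3) in auto)
    finally show ?thesis .
  qed
  have "(\<Sum>m\<in>T. 1 / real m) = (\<Sum>m\<in>T. 1 / real p ^ ?v m * (1 / real (prime_free p m)))"
  proof (rule sum.cong[OF refl])
    fix m assume "m \<in> T"
    then have "real m = real p ^ ?v m * real (prime_free p m)"
      using pf(1) by (metis of_nat_mult of_nat_power)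
    then show "1 / real m = 1 / real p ^ ?v m * (1 / real (prime_free p m))" by simp
  qed
  also have "\<dots> = (\<Sum>v\<in>?v ` T. \<Sum>m\<in>{m\<in>T. ?v m = v}. 1 / real p ^ ?v m * (1 / real (prime_free p m)))"
    by (rule sum.image_gen[OF fT])
  also have "\<dots> = (\<Sum>v\<in>?v ` T. 1 / real p ^ v * (\<Sum>m\<in>{m\<in>T. ?v m = v}. 1 / real (prime_free p m)))"
    unfolding sum_distrib_left by (intro sum.cong refl) auto
  also have "\<dots> \<le> (\<Sum>v\<in>?v ` T. 1 / real p ^ v * (euler_prod (primes_upto z) * \<mu> z))"
    by (intro sum_mono mult_left_mono fib) auto
  also have "\<dots> = (\<Sum>v\<in>?v ` T. 1 / real p ^ v) * (euler_prod (primes_upto z) * \<mu> z)"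
    by (simp add: sum_distrib_right)
  also have "\<dots> \<le> (1 / real p ^ 1 * (real p / (real p - 1))) * (euler_prod (primes_upto z) * \<mu> z)"
    using z0 E0 \<mu>0 fT T(5) by (intro mult_right_mono geometric_le) (auto simp: Suc_le_eq)
  also have "\<dots> = \<mu> z * (euler_prod (primes_upto z) / real z)"
    using z0 by (simp add: mult_ac)
  finally have covered: "(\<Sum>m\<in>T. 1 / real m) \<le> \<mu> z * (euler_prod (primes_upto z) / real z)" .
  have "\<mu> z - (\<Sum>m\<in>T. 1 / real m) \<le> \<mu> (Suc z)"
    unfolding \<mu>_def
  proof (rule avg_minus_classes[OF fT T(1) M(3)])
    fix x
    show "of_bool (x \<in> sifted M a z) - (\<Sum>m\<in>T. of_bool ([x = a m] (mod int m)))
        \<le> (of_bool (x \<in> sifted M a (Suc z)) :: real)"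
    proof (cases "x \<in> sifted M a z \<and> x \<notin> sifted M a (Suc z)")
      case True
      then obtain m where m: "m \<in> M" "prime_factors m \<subseteq> {..Suc z}" "[x = a m] (mod int m)"
        by (auto simp: sifted_def)
      have "m \<in> T"
      proof -
        have "\<not> prime_factors m \<subseteq> {..z}" using True m by (auto simp: sifted_def)
        then have "p \<in> prime_factors m" using m(2) by (auto simp: p_def le_Suc_eq)
        then show ?thesis using m by (auto simp: T_def top_moduli_def p_def)
      qed
      then have "(1 :: real) \<le> (\<Sum>m\<in>T. of_bool ([x = a m] (mod int m)))"
        using m(3) by (intro of_bool_le_sum[OF fT])
      then show ?thesis by (simp add: of_bool_def)
    next
      case False
      have "0 \<le> (\<Sum>m\<in>T. of_bool ([x = a m] (mod int m)) :: real)" by (intro sum_nonneg) auto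
      then show ?thesis using False by (auto simp: of_bool_def)
    qed
  qed
  then have "\<mu> z - \<mu> z * (euler_prod (primes_upto z) / real z) \<le> \<mu> (Suc z)" using covered by linarith
  then show ?thesis by (simp add: algebra_simps)
qed

text \<open>Here the hypothesis on the minimum modulus enters: the powers of 2 contribute at most
  \<open>1/8 + 1/16 + ... = 1/4\<close>, and the 3-smooth multiples of 3 other than 3 itself at most \<open>1 - 1/3\<close>.\<close>

lemma sum_3smooth_le:
  assumes T: "finite T" "\<And>m. m \<in> T \<Longrightarrow> m > 4" "\<And>m. m \<in> T \<Longrightarrow> prime_factors m \<subseteq> {..4}"
  shows "(\<Sum>m\<in>T. 1 / real m) \<le> 11/12"
proof -
  have p23: "p = 2 \<or> p = 3" if "prime p" "p \<le> 4" for p :: nat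
  proof -
    have "\<not> prime (4 :: nat)" using prime_odd_nat[of 4] by auto
    then show ?thesis using prime_ge_2_nat[OF that(1)] that by (cases "p = 4") auto
  qed
  have T0: "m > 0" if "m \<in> T" for m using T(2)[OF that] by simp
  define T3 where "T3 = {m\<in>T. 3 dvd m}"
  define T2 where "T2 = T - T3"
  have u2: "primes_upto (3 - 1) = {2}"
  proof -
    have "p = 2" if "prime p" "p \<le> 2" for p :: nat using prime_ge_2_nat[OF that(1)] that(2) by simp
    then show ?thesis by auto
  qed
  have eq: "real m = real 3 ^ multiplicity 3 m * (\<Prod>q\<in>primes_upto (3 - 1). real q ^ multiplicity q m)"
    if "m > 0" "prime_factors m \<subseteq> {..4}" for m :: nat
  proof -
    have "prime_factors m \<subseteq> {2, 3}" using that(2) p23 by (auto dest: in_prime_factors_imp_prime)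
    then have "(\<Prod>q\<in>{2, 3}. q ^ multiplicity q m) = (\<Prod>q\<in>prime_factors m. q ^ multiplicity q m)"
      by (intro prod.mono_neutral_right) (auto simp: prime_factors_multiplicity)
    also have "\<dots> = m" using prime_factorization_nat[OF that(1)] by simp
    finally have "m = 2 ^ multiplicity 2 m * 3 ^ multiplicity 3 m" by simp
    then have "real m = real (2 ^ multiplicity 2 m * 3 ^ multiplicity 3 m)" by presburger
    then show ?thesis unfolding u2 by simp
  qed
  have "(\<Sum>m\<in>insert 3 T3. 1 / real m)
    = (\<Sum>m\<in>insert 3 T3. 1 / real 3 ^ multiplicity 3 m * (\<Prod>q\<in>primes_upto (3 - 1). 1 / real q ^ multiplicity q m))"
  proof (rule sum.cong[OF refl])
    fix m assume "m \<in> insert 3 T3"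
    then have "m > 0" "prime_factors m \<subseteq> {..4}"
      using T0 T(3) by (auto simp: T3_def prime_prime_factors)
    then show "1 / real m
        = 1 / real 3 ^ multiplicity 3 m * (\<Prod>q\<in>primes_upto (3 - 1). 1 / real q ^ multiplicity q m)"
      using eq[of m] unfolding u2 by simp
  qed
  also have "\<dots> \<le> 1 / (real 3 - 1) * (\<Prod>q\<in>primes_upto (3 - 1). real q / (real q - 1))"
  proof (rule top_sum_le[where M = "insert 3 T3"])
    show "insert 3 T3 \<subseteq> top_moduli (insert 3 T3) 3"
    proof
      fix m assume m: "m \<in> insert 3 T3"
      have m0: "m > 0" "3 dvd m" "prime_factors m \<subseteq> {..4}"
        using m T0 T(3) by (auto simp: T3_def prime_prime_factors)
      have "prime_factors m \<subseteq> {..3}"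
      proof
        fix p assume p: "p \<in> prime_factors m"
        then have "p \<le> 4" using m0(3) by blast
        then show "p \<in> {..3}" using p23[of p] in_prime_factors_imp_prime[OF p] by auto
      qed
      moreover have "3 \<in> prime_factors m" using m0 by (simp add: prime_factors_dvd)
      ultimately show "m \<in> top_moduli (insert 3 T3) 3" using m by (simp add: top_moduli_def)
    qed
    fix q assume q: "prime q" "q < (3::nat)"
    show "(\<Sum>t\<le>V. 1 / real q ^ t) \<le> real q / (real q - 1)" for V
      using geometric_le[of "real q" "{..V}" 0] prime_gt_1_nat[OF q(1)] by simp
  qed (use T(1) T0 in \<open>auto simp: T3_def\<close>)
  also have "\<dots> = 1" unfolding u2 by simp
  finally have "1 / real 3 + (\<Sum>m\<in>T3. 1 / real m) \<le> 1"
    using T(1) T(2)[of 3] by (subst (asm) sum.insert) (auto simp: T3_def)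
  then have s3: "(\<Sum>m\<in>T3. 1 / real m) \<le> 2/3" by simp
  have T2: "m = 2 ^ multiplicity 2 m" "3 \<le> multiplicity 2 m" if "m \<in> T2" for m
  proof -
    have m: "m \<in> T" "\<not> 3 dvd m" using that by (auto simp: T2_def T3_def)
    have "real m = real 2 ^ multiplicity 2 m"
      using eq[of m] T(2,3)[OF m(1)] m(2) unfolding u2 by (simp add: not_dvd_imp_multiplicity_0)
    then have "real m = real (2 ^ multiplicity 2 m)" by simp
    then show e: "m = 2 ^ multiplicity 2 m" by (simp only: of_nat_eq_iff)
    show "3 \<le> multiplicity 2 m"
    proof (rule ccontr)
      assume "\<not> ?thesis"
      then have "(2::nat) ^ multiplicity 2 m \<le> 2 ^ 2" by (intro power_increasing) auto
      then show False using e T(2)[OF m(1)] by simp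
    qed
  qed
  have inj: "inj_on (multiplicity 2) T2" by (rule inj_onI) (metis T2(1))
  have "(\<Sum>m\<in>T2. 1 / real m) = (\<Sum>v\<in>multiplicity 2 ` T2. 1 / (2::real) ^ v)"
    unfolding sum.reindex[OF inj] o_def
  proof (rule sum.cong[OF refl])
    fix m assume "m \<in> T2"
    then have "real m = 2 ^ multiplicity 2 m" using T2(1) by (metis of_nat_numeral of_nat_power)
    then show "1 / real m = 1 / (2::real) ^ multiplicity 2 m" by simp
  qed
  also have "\<dots> \<le> 1 / 2 ^ 3 * (2 / (2 - 1))"
    using T(1) T2(2) by (intro geometric_le) (auto simp: T2_def)
  finally have "(\<Sum>m\<in>T2. 1 / real m) \<le> 1/4" by simp
  moreover have "(\<Sum>m\<in>T. 1 / real m) = (\<Sum>m\<in>T2. 1 / real m) + (\<Sum>m\<in>T3. 1 / real m)"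
    unfolding T2_def using T(1) by (intro sum.subset_diff) (auto simp: T3_def)
  ultimately show ?thesis using s3 by linarith
qed

lemma sifted_density_bound:
  assumes M: "finite M" "\<And>m. m \<in> M \<Longrightarrow> m dvd N" "N > 0" "\<And>m. m \<in> M \<Longrightarrow> m > 4"
    and disj: "\<And>m n. m \<in> M \<Longrightarrow> n \<in> M \<Longrightarrow> m \<noteq> n \<Longrightarrow> \<not> (\<exists>x. [x = a m] (mod int m) \<and> [x = a n] (mod int n))"
    and z: "z \<ge> 362"
  shows "avg N (\<lambda>x. of_bool (x \<in> sifted M a z))
    \<ge> 1/12 * (1/4) ^ 362 * exp (- (11/10 * euler_prod (primes_upto z)))"
proof (rule sieve_lower_bound[OF _ _ _ _ z])
  let ?T = "{m\<in>M. prime_factors m \<subseteq> {..4}}"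
  have "avg N (\<lambda>x. 1) - (\<Sum>m\<in>?T. 1 / real m) \<le> avg N (\<lambda>x. of_bool (x \<in> sifted M a 4))"
  proof (rule avg_minus_classes[of ?T N _ a])
    fix x
    show "1 - (\<Sum>m\<in>?T. of_bool ([x = a m] (mod int m))) \<le> (of_bool (x \<in> sifted M a 4) :: real)"
    proof (cases "x \<in> sifted M a 4")
      case True
      have "0 \<le> (\<Sum>m\<in>?T. of_bool ([x = a m] (mod int m)) :: real)" by (intro sum_nonneg) auto
      then show ?thesis using True by simp
    next
      case False
      then obtain m where "m \<in> ?T" "[x = a m] (mod int m)" by (auto simp: sifted_def)
      then have "(1 :: real) \<le> (\<Sum>m\<in>?T. of_bool ([x = a m] (mod int m)))"
        using M(1) by (intro of_bool_le_sum) auto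
      then show ?thesis using False by simp
    qed
  qed (use M in auto)
  moreover have "(\<Sum>m\<in>?T. 1 / real m) \<le> 11/12" using M by (intro sum_3smooth_le) auto
  ultimately show "1/12 \<le> avg N (\<lambda>x. of_bool (x \<in> sifted M a 4))"
    using avg_const[OF M(3), of 1] by linarith
next
  fix z :: nat assume np: "\<not> prime (Suc z)"
  have "prime_factors m \<subseteq> {..Suc z} \<longleftrightarrow> prime_factors m \<subseteq> {..z}" for m :: nat
    using np le_Suc_eq by (auto simp: subset_iff in_prime_factors_iff)
  then have "sifted M a (Suc z) = sifted M a z" by (simp add: sifted_def)
  then show "avg N (\<lambda>x. of_bool (x \<in> sifted M a z)) \<le> avg N (\<lambda>x. of_bool (x \<in> sifted M a (Suc z)))"
    by simp
next
  fix z assume "prime (Suc z)"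
  then show "avg N (\<lambda>x. of_bool (x \<in> sifted M a z)) * (1 - euler_prod (primes_upto z) / real z)
     \<le> avg N (\<lambda>x. of_bool (x \<in> sifted M a (Suc z)))"
    by (intro sifted_prime_step[OF M(1-3) disj])
qed simp

subsection \<open>Choice of parameters\<close>

text \<open>Each linear factor is at most (x / c)^2 and x / c \<le> exp (x / c), where c = 2 * 6 * 2
  = 24 and c = 2 * 17 * 20 = 680. The second case asks for x \<ge> 22 * 680^2 = 10172800.\<close>

lemma poly_le_exp:
  fixes x :: real
  assumes "x \<ge> 10 ^ 8"
  shows "(11/4 * x) ^ 6 \<le> exp (x / 2)" "(22 * x) ^ 17 \<le> exp (x / 20)"
proof -
  have x: "x \<ge> 100000000" using assms by simp
  have "11/4 * x \<le> (x / 24) ^ 2"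
  proof -
    have "x * 1584 \<le> x * x" using x by (intro mult_left_mono) auto
    then show ?thesis by (simp add: power2_eq_square)
  qed
  also have "\<dots> \<le> exp (x / 24) ^ 2"
  proof (intro power_mono)
    show "x / 24 \<le> exp (x / 24)" using exp_ge_add_one_self[of "x / 24"] by linarith
  qed (use x in auto)
  finally have "(11/4 * x) ^ 6 \<le> (exp (x / 24) ^ 2) ^ 6" using x by (intro power_mono) auto
  also have "\<dots> = exp (x / 2)" by (simp flip: power_mult exp_of_nat_mult)
  finally show "(11/4 * x) ^ 6 \<le> exp (x / 2)" .
  have "22 * x \<le> (x / 680) ^ 2"
  proof -
    have "x * 10172800 \<le> x * x" using x by (intro mult_left_mono) auto
    then show ?thesis by (simp add: power2_eq_square)
  qed
  also have "\<dots> \<le> exp (x / 680) ^ 2"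
  proof (intro power_mono)
    show "x / 680 \<le> exp (x / 680)" using exp_ge_add_one_self[of "x / 680"] by linarith
  qed (use x in auto)
  finally have "(22 * x) ^ 17 \<le> (exp (x / 680) ^ 2) ^ 17" using x by (intro power_mono) auto
  also have "\<dots> = exp (x / 20)" by (simp flip: power_mult exp_of_nat_mult)
  finally show "(22 * x) ^ 17 \<le> exp (x / 20)" .
qed

lemma numeric_contradiction:
  fixes L \<mu> :: real
  assumes L: "L \<ge> 10 ^ 8"
    and lower: "\<mu> \<ge> 1/12 * (1/4) ^ 362 * exp (- (11/10 * (11/4 * L)))"
    and upper: "\<mu> \<le> 2 * exp (- L)
        * (exp (9/10 * L) * \<mu> * (22 * L) ^ 6 + (22 * L) ^ 17 / exp (9/10 * L) ^ 3)
        + 4 * exp (- 4 * L) + exp (- 10/3 * L) * (22 * L) ^ 12"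
  shows False
proof -
  \<comment> \<open>The exponent 3.2 separates the two sides: the density has 11/10 * 11/4 = 3.025,
    and the largest error term not proportional to \<mu> has 10/3 - 1/20, about 3.28.\<close>
  define e where "e = exp (- 32/10 * L)"
  have L': "L \<ge> 100000000" using L by simp
  have "0 \<le> 1/12 * (1/4) ^ 362 * exp (- (11/10 * (11/4 * L)))" by simp
  then have \<mu>0: "\<mu> \<ge> 0" using lower by linarith
  have p17: "(22 * L) ^ 17 \<le> exp (L / 20)" by (rule poly_le_exp(2)[OF L])
  have p6: "(22 * L) ^ 6 \<le> exp (L / 20)" and p12: "(22 * L) ^ 12 \<le> exp (L / 20)"
    using p17 L' power_increasing[of 6 17 "22 * L"] power_increasing[of 12 17 "22 * L"] by linarith+
  have t1: "2 * exp (- L) * (exp (9/10 * L) * \<mu> * (22 * L) ^ 6) \<le> \<mu> / 4"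
  proof -
    have "2 * exp (- L) * (exp (9/10 * L) * \<mu> * (22 * L) ^ 6)
        \<le> 2 * exp (- L) * (exp (9/10 * L) * \<mu> * exp (L / 20))"
      using p6 \<mu>0 by (intro mult_left_mono) auto
    also have "\<dots> = 2 * \<mu> * (exp (- L) * exp (9/10 * L) * exp (L / 20))" by (simp add: mult_ac)
    also have "exp (- L) * exp (9/10 * L) * exp (L / 20) = exp (- (L / 20))" by (simp flip: exp_add)
    also have "exp (- (L / 20)) \<le> 1/8"
    proof -
      have "8 \<le> exp (L / 20)" using L' exp_ge_add_one_self[of "L / 20"] by linarith
      then show ?thesis by (simp add: exp_minus inverse_eq_divide divide_le_eq)
    qed
    finally show ?thesis using \<mu>0 by (simp add: mult_left_mono)
  qed
  have t2: "2 * exp (- L) * ((22 * L) ^ 17 / exp (9/10 * L) ^ 3) \<le> 2 * e"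
  proof -
    have e3: "exp (9/10 * L) ^ 3 = exp (27/10 * L)" by (simp flip: exp_of_nat_mult)
    have "2 * exp (- L) * ((22 * L) ^ 17 / exp (9/10 * L) ^ 3)
        \<le> 2 * exp (- L) * (exp (L / 20) / exp (27/10 * L))"
      unfolding e3 using p17 by (intro mult_left_mono divide_right_mono) auto
    also have "2 * exp (- L) * (exp (L / 20) / exp (27/10 * L)) = 2 * exp (- L + L / 20 - 27/10 * L)"
      by (simp only: exp_diff exp_add times_divide_eq_right mult.assoc)
    also have "\<dots> \<le> 2 * e" unfolding e_def using L' by simp
    finally show ?thesis .
  qed
  have t3: "4 * exp (- 4 * L) \<le> 4 * e" unfolding e_def using L' by simp
  have t4: "exp (- 10/3 * L) * (22 * L) ^ 12 \<le> e"
  proof -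
    have "exp (- 10/3 * L) * (22 * L) ^ 12 \<le> exp (- 10/3 * L) * exp (L / 20)"
      using p12 by (intro mult_left_mono) auto
    also have "\<dots> = exp (- 10/3 * L + L / 20)" by (simp only: exp_add)
    also have "\<dots> \<le> e" unfolding e_def using L' by simp
    finally show ?thesis .
  qed
  have "2 * exp (- L) * (exp (9/10 * L) * \<mu> * (22 * L) ^ 6 + (22 * L) ^ 17 / exp (9/10 * L) ^ 3)
    = 2 * exp (- L) * (exp (9/10 * L) * \<mu> * (22 * L) ^ 6) + 2 * exp (- L) * ((22 * L) ^ 17 / exp (9/10 * L) ^ 3)"
    by (rule distrib_left)
  then have "\<mu> \<le> \<mu> / 4 + 7 * e" using upper t1 t2 t3 t4 by linarith
  then have up: "\<mu> \<le> 28/3 * e" by linarith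
  \<comment> \<open>724 = 2 * 362, from 4 \<le> exp 2.\<close>
  have "exp (- 724) \<le> (1/4 :: real) ^ 362"
  proof -
    have "(2 :: real) ^ 2 \<le> exp 1 ^ 2" using exp_ge_add_one_self[of 1] by (intro power_mono) auto
    then have "4 \<le> exp (2 :: real)" by (simp flip: exp_of_nat_mult)
    then have "exp (- 2) \<le> (1/4 :: real)" by (simp add: exp_minus inverse_eq_divide divide_le_eq)
    then have "exp (- 2) ^ 362 \<le> (1/4 :: real) ^ 362" by (intro power_mono) auto
    then show ?thesis by (simp flip: exp_of_nat_mult)
  qed
  then have "1/12 * exp (- 724) * exp (- (11/10 * (11/4 * L)))
      \<le> 1/12 * (1/4) ^ 362 * exp (- (11/10 * (11/4 * L)))"
    by (intro mult_right_mono mult_left_mono) auto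
  then have "1/12 * exp (- 724) * exp (- (11/10 * (11/4 * L))) \<le> 28/3 * e" using lower up by linarith
  then have "exp (- 724) * exp (- (11/10 * (11/4 * L))) \<le> 112 * e" by simp
  then have "exp (- 724) * exp (- (11/10 * (11/4 * L))) * exp (32/10 * L) \<le> 112 * e * exp (32/10 * L)"
    by (intro mult_right_mono) auto
  then have "exp (- 724 + - (11/10 * (11/4 * L)) + 32/10 * L) \<le> 112"
    by (simp add: e_def mult.assoc flip: exp_add)
  moreover have "1 + (- 724 + - (11/10 * (11/4 * L)) + 32/10 * L)
      \<le> exp (- 724 + - (11/10 * (11/4 * L)) + 32/10 * L)"
    by (rule exp_ge_add_one_self)
  ultimately show False using L' by linarith
qed

text \<open>Second moments carry r - 1, so the zeta tail is taken over r - 1 > n; hence the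
  hypothesis \<open>Suc n < r\<close>.\<close>

lemma sum_shifted_tail_le:
  assumes "s > 0" "n \<ge> 1" "finite F" "\<And>r. r \<in> F \<Longrightarrow> Suc n < r"
  shows "(\<Sum>r\<in>F. (real r - 1) powr - (1 + s)) \<le> real n powr - s / s"
proof -
  define z where "z = Max (insert 0 F)"
  have inj: "inj_on (\<lambda>r. r - 1) F"
    using assms(4) by (intro inj_onI) (metis Suc_lessD diff_Suc_1 less_imp_Suc_add)
  have "(\<Sum>r\<in>F. (real r - 1) powr - (1 + s)) = (\<Sum>r\<in>F. real (r - 1) powr - (1 + s))"
  proof (rule sum.cong[OF refl])
    fix r assume "r \<in> F"
    then have "real (r - 1) = real r - 1" using assms(4)[of r] by (simp add: of_nat_diff)
    then show "(real r - 1) powr - (1 + s) = real (r - 1) powr - (1 + s)" by simp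
  qed
  also have "\<dots> = (\<Sum>k\<in>(\<lambda>r. r - 1) ` F. real k powr - (1 + s))"
    by (subst sum.reindex[OF inj]) (simp add: o_def)
  also have "\<dots> \<le> (\<Sum>k\<in>{n<..z}. real k powr - (1 + s))"
  proof (intro sum_mono2)
    show "(\<lambda>r. r - 1) ` F \<subseteq> {n<..z}"
    proof
      fix k assume "k \<in> (\<lambda>r. r - 1) ` F"
      then obtain r where r: "r \<in> F" "k = r - 1" by auto
      have "r \<le> z" unfolding z_def using r assms(3) by (intro Max_ge) auto
      then show "k \<in> {n<..z}" using assms(4)[OF r(1)] r(2) by auto
    qed
  qed auto
  also have "\<dots> \<le> real n powr - s / s" by (rule zeta_tail_le[OF assms(1,2)])
  finally show ?thesis .
qed

text \<open>A weight of total \<mu> living on the sifted set \<open>V\<close> would have to be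
  covered by the classes of \<open>M1\<close> and \<open>tail\<close>, but these capture too little
  of it.\<close>

lemma no_disjoint_cover:
  assumes M: "finite M" "\<And>m. m \<in> M \<Longrightarrow> m > 4"
    and cover: "\<And>x. \<exists>m\<in>M. [x = a m] (mod int m)"
    and L: "L = ln (real P)" "L \<ge> 10 ^ 8"
    and disj: "\<And>m n. m \<in> M \<Longrightarrow> n \<in> M \<Longrightarrow> m \<noteq> n \<Longrightarrow> real m \<le> exp (80 * L\<^sup>2) \<Longrightarrow> real n \<le> exp (80 * L\<^sup>2)
      \<Longrightarrow> \<not> (\<exists>x. [x = a m] (mod int m) \<and> [x = a n] (mod int n))"
  shows False
proof -
  define N where "N = \<Prod>M"
  define R where "R = P ^ 8"
  define Y where "Y = exp (80 * L\<^sup>2)"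
  define \<Psi> where "\<Psi> = exp (9/10 * L)"
  define M' where "M' = {m\<in>M. real m \<le> Y}"
  define V where "V = sifted M' a P"
  define \<mu> where "\<mu> = avg N (\<lambda>x. of_bool (x \<in> V))"
  \<comment> \<open>Moduli above \<open>Y\<close> enter only with a prime factor above
    \<open>R\<close>. So for r \<le> R the moduli with largest prime \<open>r\<close> are at most
    \<open>Y\<close>, where disjointness is available.\<close>
  define M1 where "M1 = {m\<in>M. \<not> prime_factors m \<subseteq> {..P} \<and> (real m \<le> Y \<or> \<not> prime_factors m \<subseteq> {..R})}"
  define tail where "tail = {m\<in>M. Y < real m \<and> prime_factors m \<subseteq> {..R}}"
  \<comment> \<open>No modulus has a prime factor beyond \<open>N\<close>, so at \<open>z\<close>
    all of \<open>M1\<close> has been treated; the maximum ensures P \<le> z.\<close>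
  define z where "z = max N P"
  have L': "L \<ge> 100000000" using L(2) by simp
  have Mpos: "m > 0" if "m \<in> M" for m using M(2)[OF that] by simp
  have N: "N > 0" unfolding N_def using Mpos by (intro prod_pos) auto
  have MN: "m dvd N" if "m \<in> M" for m unfolding N_def using M(1) that by (rule dvd_prodI)
  have P0: "P > 0" using L by (cases "P = 0") auto
  have PL: "real P = exp L" using P0 L(1) by simp
  have Pbig: "real P \<ge> 100000000" using PL L' exp_ge_add_one_self[of L] by linarith
  have P362: "P \<ge> 362" using Pbig by linarith
  have PR: "P \<le> R" unfolding R_def using P0 by (intro self_le_power) auto
  have lnR: "ln (real R) = 8 * L" unfolding R_def using P0 by (simp add: ln_realpow L(1))
  have RL: "real R = exp (8 * L)"
    using lnR P0 PR by (metis exp_ln of_nat_0_less_iff order_less_le_trans)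
  have Eb: "euler_prod (primes_upto n) \<le> 11/4 * ln (real n)" if "n \<ge> P" for n
  proof (rule euler_prod_le_ln)
    have "ln (real P) \<le> ln (real n)" using that P0 by simp
    then show "10 ^ 8 \<le> ln (real n)" using L by simp
  qed
  have ER: "euler_prod (primes_upto R) \<le> 22 * L" using Eb[OF PR] lnR by simp
  have fin: "finite M'" "finite M1" "finite tail" unfolding M'_def M1_def tail_def using M(1) by auto
  have disj': "\<not> (\<exists>x. [x = a m] (mod int m) \<and> [x = a n] (mod int n))"
    if "m \<in> M'" "n \<in> M'" "m \<noteq> n" for m n
    using disj[of m n] that unfolding M'_def Y_def by blast
  have lower: "\<mu> \<ge> 1/12 * (1/4) ^ 362 * exp (- (11/10 * (11/4 * L)))"
  proof -
    have "1/12 * (1/4) ^ 362 * exp (- (11/10 * (11/4 * L)))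
      \<le> 1/12 * (1/4) ^ 362 * exp (- (11/10 * euler_prod (primes_upto P)))"
      using Eb[of P] L(1) by (intro mult_left_mono) auto
    also have "\<dots> \<le> \<mu>"
      unfolding \<mu>_def V_def
      by (rule sifted_density_bound) (use fin(1) M(2) MN N disj' P362 in \<open>auto simp: M'_def\<close>)
    finally show ?thesis .
  qed
  have \<mu>0: "\<mu> \<ge> 0" unfolding \<mu>_def by (intro avg_nonneg) auto
  have Vper: "periodic (smooth_part P N) (\<lambda>x. of_bool (x \<in> V) :: real)"
  proof -
    have "periodic (smooth_part P N) (\<lambda>x. covered M' a P x)"
      using MN N by (intro periodic_class_union dvd_smooth_part) (auto simp: M'_def)
    then have "periodic (smooth_part P N) (\<lambda>x. of_bool (\<not> covered M' a P x) :: real)"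
      by (rule periodic_comp)
    moreover have "x \<in> V \<longleftrightarrow> \<not> covered M' a P x" for x
      unfolding V_def sifted_def by blast
    ultimately show ?thesis by simp
  qed
  have M1N: "m dvd N" if "m \<in> M1" for m using that MN by (simp add: M1_def)
  have "\<not> prime_factors m \<subseteq> {..P}" if "m \<in> M1" for m using that by (simp add: M1_def)
  moreover have "0 \<le> (of_bool (x \<in> V) :: real)" "(of_bool (x \<in> V) :: real) \<le> 1" for x by auto
  moreover have "P \<le> z" by (simp add: z_def)
  ultimately obtain w :: "int \<Rightarrow> real" where
    w: "\<And>x. 0 \<le> w x" "\<And>x. (of_bool (x \<in> V) :: real) = 0 \<Longrightarrow> w x = 0" "avg N w = \<mu>"
    and cell: "\<And>l c. l dvd smooth_part z N
        \<Longrightarrow> avg N (\<lambda>x. w x * of_bool ([x = c] (mod int l))) \<le> cell_weight P l"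
    and loss: "avg N (\<lambda>x. w x * of_bool (covered M1 a z x))
        \<le> (\<Sum>r\<in>primes_between P z. second_moment P M1 r)"
    using distortion[OF fin(2) M1N N _ _ _ Vper, of z a] unfolding \<mu>_def by blast
  have pfz: "prime_factors m \<subseteq> {..z}" if "m \<in> M" for m
  proof
    fix p assume "p \<in> prime_factors m"
    then have "p dvd N" using MN[OF that] dvd_trans by blast
    then show "p \<in> {..z}" using N by (auto simp: z_def dest: dvd_imp_le)
  qed
  have "\<mu> \<le> avg N (\<lambda>x. w x * of_bool (covered M1 a z x)
      + (\<Sum>m\<in>tail. w x * of_bool ([x = a m] (mod int m))))"
    unfolding w(3)[symmetric]
  proof (rule avg_mono)
    fix x
    have s0: "0 \<le> (\<Sum>m\<in>tail. w x * of_bool ([x = a m] (mod int m)))"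
      using w(1) by (intro sum_nonneg) auto
    show "w x \<le> w x * of_bool (covered M1 a z x) + (\<Sum>m\<in>tail. w x * of_bool ([x = a m] (mod int m)))"
    proof (cases "x \<in> V")
      case False
      then show ?thesis using w(2)[of x] by simp
    next
      case True
      obtain m where m: "m \<in> M" "[x = a m] (mod int m)" using cover by blast
      show ?thesis
      proof (cases "m \<in> tail")
        case t: True
        have "w x * 1 \<le> w x * (\<Sum>m\<in>tail. of_bool ([x = a m] (mod int m)))"
          using w(1) of_bool_le_sum[where P = "\<lambda>m. [x = a m] (mod int m)", OF fin(3) t m(2)]
          by (intro mult_left_mono) auto
        moreover have "0 \<le> w x * of_bool (covered M1 a z x)" using w(1) by simp
        ultimately show ?thesis unfolding sum_distrib_left by linarith
      next
        case t: False
        have "m \<in> M1"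
        proof (cases "real m \<le> Y")
          case True
          have "\<not> prime_factors m \<subseteq> {..P}"
            using \<open>x \<in> V\<close> m True unfolding V_def sifted_def M'_def by blast
          then show ?thesis using m(1) True by (simp add: M1_def)
        next
          case False
          then have nr: "\<not> prime_factors m \<subseteq> {..R}" using t m(1) by (simp add: tail_def)
          moreover have "{..P} \<subseteq> {..R}" using PR by simp
          ultimately show ?thesis using m(1) by (auto simp: M1_def)
        qed
        then have "covered M1 a z x" using m pfz by blast
        then show ?thesis using s0 by simp
      qed
    qed
  qed
  also have "\<dots> = avg N (\<lambda>x. w x * of_bool (covered M1 a z x))
      + (\<Sum>m\<in>tail. avg N (\<lambda>x. w x * of_bool ([x = a m] (mod int m))))"
    by (simp only: avg_add avg_sum)
  also have "\<dots> \<le> (\<Sum>r\<in>primes_between P z. second_moment P M1 r) + (\<Sum>m\<in>tail. cell_weight P m)"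
  proof (intro add_mono loss sum_mono cell)
    fix m assume "m \<in> tail"
    then have "m \<in> M" by (simp add: tail_def)
    then show "m dvd smooth_part z N" using MN pfz N by (intro dvd_smooth_part) auto
  qed
  finally have split: "\<mu> \<le> (\<Sum>r\<in>primes_between P z. second_moment P M1 r) + (\<Sum>m\<in>tail. cell_weight P m)" .
  have tail_bound: "(\<Sum>m\<in>tail. cell_weight P m) \<le> exp (- 10/3 * L) * (22 * L) ^ 12"
  proof -
    define s where "s = ln (3/2) / ln (real R)"
    have "(\<Sum>m\<in>tail. cell_weight P m) \<le> Y powr - s * euler_prod (primes_upto R) ^ 12"
      using fin(3) Mpos P362 PR by (intro rankin_tail) (auto simp: tail_def s_def Y_def)
    also have "\<dots> \<le> exp (- 10/3 * L) * (22 * L) ^ 12"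
    proof (intro mult_mono power_mono ER)
      have "ln (1 / (3/2)) \<le> 1 / (3/2) - (1 :: real)" by (rule ln_le_minus_one) simp
      then have l: "1/3 \<le> ln (3/2 :: real)" by (simp add: ln_div)
      \<comment> \<open>80 L^2 * s = 10 L ln (3/2), since ln R = 8 L.\<close>
      have "Y powr - s = exp (- (10 * L * ln (3/2)))"
        using L' by (simp add: Y_def powr_def s_def lnR power2_eq_square)
      also have "\<dots> \<le> exp (- 10/3 * L)"
      proof -
        have "10 * L * (1/3) \<le> 10 * L * ln (3/2)" using l L' by (intro mult_left_mono) auto
        then show ?thesis by simp
      qed
      finally show "Y powr - s \<le> exp (- 10/3 * L)" .
    qed (use euler_prod_ge_1[of "primes_upto R"] in auto)
    finally show ?thesis .
  qed
  define A where "A = \<Psi> * \<mu> * (22 * L) ^ 6 + (22 * L) ^ 17 / \<Psi> ^ 3"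
  have \<Psi>0: "\<Psi> > 0" by (simp add: \<Psi>_def)
  have A0: "A \<ge> 0" unfolding A_def using \<Psi>0 \<mu>0 L' by (intro add_nonneg_nonneg) auto
  have mid: "second_moment P M1 r \<le> A * (real r - 1) powr - (1 + 1)"
    if r: "prime r" "P < r" "r \<le> R" for r
  proof -
    define E where "E = euler_prod (primes_upto (r - 1))"
    have E1: "E \<ge> 1" unfolding E_def by (rule euler_prod_ge_1) auto
    have "E \<le> euler_prod (primes_upto R)" unfolding E_def using r(3) by (intro euler_prod_mono) simp
    then have E: "E \<le> 22 * L" using ER by linarith
    have "second_moment P M1 r \<le> (\<Psi> * \<mu> * E ^ 6 + E ^ 17 / \<Psi> ^ 3) / (real r - 1) ^ 2"
      unfolding E_def \<mu>_def
    proof (rule second_moment_relative_le[OF r(1,2) fin(2) M1N N _ \<Psi>0])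
      fix m assume m: "m \<in> top_moduli M1 r"
      then have mM: "m \<in> M" "prime_factors m \<subseteq> {..r}" "r \<in> prime_factors m"
        by (auto simp: top_moduli_def M1_def)
      have "prime_factors m \<subseteq> {..R}" using mM(2) r(3) by auto
      then have "m \<in> M'" using m by (auto simp: top_moduli_def M1_def M'_def)
      have "x \<in> V" if x: "[x = a m] (mod int (smooth_part P m))" for x
        unfolding V_def sifted_def
      proof (intro CollectI ballI impI)
        fix n assume n: "n \<in> M'" "prime_factors n \<subseteq> {..P}"
        have "m \<noteq> n" using n(2) mM(3) r(2) by auto
        \<comment> \<open>The gcd divides \<open>m\<close> and inherits \<open>P\<close>-smoothness
          from \<open>n\<close>.\<close>
        have "gcd m n dvd smooth_part P m"
        proof (rule dvd_smooth_part)
          have "n > 0" using n(1) Mpos by (simp add: M'_def)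
          then show "prime_factors (gcd m n) \<subseteq> {..P}"
            using n(2) dvd_prime_factors[of n "gcd m n"] by auto
        qed (use Mpos mM(1) in auto)
        then show "\<not> [x = a n] (mod int n)"
          using x by (intro class_avoids[OF disj'[OF \<open>m \<in> M'\<close> n(1) \<open>m \<noteq> n\<close>]])
      qed
      then show "\<exists>b. \<forall>x. [x = b] (mod int (smooth_part P m)) \<longrightarrow> x \<in> V" by blast
    qed
    also have "\<dots> \<le> A / (real r - 1) ^ 2"
      unfolding A_def using E E1 \<Psi>0 \<mu>0
      by (intro divide_right_mono add_mono mult_left_mono power_mono) auto
    also have "\<dots> = A * (real r - 1) powr - (1 + 1)"
      using r(2) Pbig by (simp add: powr_minus_divide powr_numeral)
    finally show ?thesis .
  qed
  \<comment> \<open>Here moduli may exceed \<open>Y\<close>, so the absolute bound is used; the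
    sixth power of the Euler product is at most the square root of r - 1, which leaves the summable
    exponent 3/2.\<close>
  have large: "second_moment P M1 r \<le> (real r - 1) powr - (1 + 1/2)" if r: "prime r" "R < r" for r
  proof -
    define n where "n = r - 1"
    have n: "n \<ge> P" "real n = real r - 1" "n > 0" using r PR P0 by (auto simp: n_def of_nat_diff)
    have ln: "ln (real n) \<ge> 10 ^ 8"
    proof -
      have "ln (real P) \<le> ln (real n)" using n P0 by simp
      then show ?thesis using L by simp
    qed
    have "second_moment P M1 r \<le> euler_prod (primes_upto n) ^ 6 / (real r - 1) ^ 2"
      unfolding n_def using Mpos
        by (intro second_moment_le[OF r(1) fin(2)]) (auto simp: top_moduli_def M1_def)
    also have "\<dots> \<le> exp (ln (real n) / 2) / (real r - 1) ^ 2"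
    proof (intro divide_right_mono)
      have "euler_prod (primes_upto n) ^ 6 \<le> (11/4 * ln (real n)) ^ 6"
        using Eb[OF n(1)] euler_prod_ge_1[of "primes_upto n"] by (intro power_mono) auto
      also have "\<dots> \<le> exp (ln (real n) / 2)" by (rule poly_le_exp(1)[OF ln])
      finally show "euler_prod (primes_upto n) ^ 6 \<le> exp (ln (real n) / 2)" .
    qed simp
    also have "\<dots> = real n powr (1/2) / real n powr 2"
    proof -
      have "exp (ln (real n) / 2) = real n powr (1/2)" using n by (simp only: powr_def) simp
      then show ?thesis using n by (simp add: powr_numeral)
    qed
    also have "\<dots> = (real r - 1) powr - (1 + 1/2)"
      unfolding n(2)[symmetric] by (simp only: powr_diff [symmetric]) simp
    finally show ?thesis .
  qed
  let ?F1 = "{r. prime r \<and> P < r \<and> r \<le> z \<and> r \<le> R}" and ?F2 = "{r. prime r \<and> R < r \<and> r \<le> z}"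
  have finF: "finite ?F1" "finite ?F2" by (rule finite_subset[of _ "{..z}"]; auto)+
  have "primes_between P z = ?F1 \<union> ?F2" using PR by auto
  then have "(\<Sum>r\<in>primes_between P z. second_moment P M1 r)
     = (\<Sum>r\<in>?F1. second_moment P M1 r) + (\<Sum>r\<in>?F2. second_moment P M1 r)"
    using finF by (simp add: sum.union_disjoint disjoint_iff)
  also have "\<dots> \<le> (\<Sum>r\<in>?F1. A * (real r - 1) powr - (1 + 1)) + (\<Sum>r\<in>?F2. (real r - 1) powr - (1 + 1/2))"
    using mid large by (intro add_mono sum_mono) auto
  also have "\<dots> = A * (\<Sum>r\<in>?F1. (real r - 1) powr - (1 + 1)) + (\<Sum>r\<in>?F2. (real r - 1) powr - (1 + 1/2))"
    by (simp add: sum_distrib_left)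
  also have "\<dots> \<le> A * (2 * exp (- L)) + 4 * exp (- 4 * L)"
  proof (intro add_mono mult_left_mono A0)
    have "(\<Sum>r\<in>?F1. (real r - 1) powr - (1 + 1)) \<le> real (P - 1) powr - 1 / 1"
      using P362 by (intro sum_shifted_tail_le finF) auto
    also have "\<dots> = 1 / (real P - 1)" using P362 by (simp add: powr_minus_divide of_nat_diff)
    also have "\<dots> \<le> 2 / real P" using Pbig by (simp add: field_simps)
    also have "\<dots> = 2 * exp (- L)" by (simp add: PL exp_minus inverse_eq_divide)
    finally show "(\<Sum>r\<in>?F1. (real r - 1) powr - (1 + 1)) \<le> 2 * exp (- L)" .
    have R4: "real R \<ge> 4" using PR P362 by linarith
    have "(\<Sum>r\<in>?F2. (real r - 1) powr - (1 + 1/2)) \<le> real (R - 1) powr - (1/2) / (1/2)"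
      using P362 PR by (intro sum_shifted_tail_le finF) auto
    \<comment> \<open>R - 1 \<ge> R / 4 costs a factor 4^(1/2) = 2, which together with the division
      by 1/2 makes 4.\<close>
    also have "\<dots> \<le> (real R / 4) powr - (1/2) / (1/2)"
    proof (intro divide_right_mono powr_mono2')
      show "real R / 4 \<le> real (R - 1)" using R4 by (simp add: of_nat_diff)
    qed (use R4 in auto)
    also have "\<dots> = 4 * exp (- 4 * L)"
    proof -
      have h: "(4 :: real) powr - (1/2) = 1/2" by (simp add: powr_minus_divide powr_half_sqrt)
      have R: "real R powr - (1/2) = exp (- 4 * L)" using R4 by (simp add: powr_def lnR)
      have "(real R / 4) powr - (1/2) = real R powr - (1/2) / 4 powr - (1/2)"
        by (rule powr_divide)
      then have "(real R / 4) powr - (1/2) = exp (- 4 * L) / (1/2)" unfolding h R .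
      then show ?thesis by simp
    qed
    finally show "(\<Sum>r\<in>?F2. (real r - 1) powr - (1 + 1/2)) \<le> 4 * exp (- 4 * L)" .
  qed
  finally have "\<mu> \<le> A * (2 * exp (- L)) + 4 * exp (- 4 * L) + exp (- 10/3 * L) * (22 * L) ^ 12"
    using split tail_bound by linarith
  also have "A * (2 * exp (- L))
      = 2 * exp (- L) * (exp (9/10 * L) * \<mu> * (22 * L) ^ 6 + (22 * L) ^ 17 / exp (9/10 * L) ^ 3)"
    unfolding A_def \<Psi>_def by (rule mult.commute)
  finally show False by (rule numeric_contradiction[OF L(2) lower])
qed

section \<open>An overlapping pair and the final estimate\<close>

text \<open>The number of classes containing \<open>x\<close> is at least 1 everywhere and at least
  2 on a class modulo \<open>lcm m n\<close>; its average is the sum of the reciprocals.\<close>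

lemma overlap_sum_ge:
  assumes M: "finite M" "\<And>m. m \<in> M \<Longrightarrow> m > 0"
    and cover: "\<And>x. \<exists>m\<in>M. [x = a m] (mod int m)"
    and mn: "m \<in> M" "n \<in> M" "m \<noteq> n" "[x0 = a m] (mod int m)" "[x0 = a n] (mod int n)"
  shows "(\<Sum>k\<in>M. 1 / real k) \<ge> 1 + 1 / (real m * real n)"
proof -
  define N where "N = \<Prod>M"
  have N: "N > 0" unfolding N_def using M(2) by (intro prod_pos) auto
  have MN: "k dvd N" if "k \<in> M" for k unfolding N_def using M(1) that by (rule dvd_prodI)
  have l: "lcm m n dvd N" using MN mn(1,2) by (intro lcm_least)
  have "1 / (real m * real n) \<le> 1 / real (lcm m n)"
  proof (rule divide_left_mono)
    have "lcm m n \<le> m * n" using M(2) mn(1,2) by (intro dvd_imp_le) (auto intro: lcm_least)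
    then show "real (lcm m n) \<le> real m * real n" by (metis of_nat_le_iff of_nat_mult)
    show "0 < (real m * real n) * real (lcm m n)" using M(2) mn(1,2) by (simp add: lcm_pos_nat)
  qed simp
  also have "1 + 1 / real (lcm m n) = avg N (\<lambda>x. 1 + of_bool ([x = x0] (mod int (lcm m n))))"
    using avg_class[OF l N, of x0] avg_const[OF N, of 1] by (simp only: avg_add)
  also have "\<dots> \<le> avg N (\<lambda>x. \<Sum>k\<in>M. of_bool ([x = a k] (mod int k)))"
  proof (rule avg_mono)
    fix x
    show "1 + of_bool ([x = x0] (mod int (lcm m n))) \<le> (\<Sum>k\<in>M. of_bool ([x = a k] (mod int k)) :: real)"
    proof (cases "[x = x0] (mod int (lcm m n))")
      case True
      then have "[x = x0] (mod int m)" "[x = x0] (mod int n)"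
        by (auto intro: cong_dvd_modulus)
      then have "[x = a m] (mod int m)" "[x = a n] (mod int n)" using mn(4,5) cong_trans by blast+
      then have "(2 :: real) = (\<Sum>k\<in>{m, n}. of_bool ([x = a k] (mod int k)))" using mn(3) by simp
      also have "\<dots> \<le> (\<Sum>k\<in>M. of_bool ([x = a k] (mod int k)))"
        using M(1) mn(1,2) by (intro sum_mono2) auto
      finally show ?thesis using True by simp
    next
      case False
      obtain k where "k \<in> M" "[x = a k] (mod int k)" using cover by blast
      then have "(1 :: real) \<le> (\<Sum>k\<in>M. of_bool ([x = a k] (mod int k)))"
        by (rule of_bool_le_sum[OF M(1)])
      then show ?thesis using False by simp
    qed
  qed
  also have "\<dots> = (\<Sum>k\<in>M. avg N (\<lambda>x. of_bool ([x = a k] (mod int k))))" by (rule avg_sum)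
  also have "\<dots> = (\<Sum>k\<in>M. 1 / real k)" using MN N by (intro sum.cong refl avg_class)
  finally show ?thesis by simp
qed

theorem theorem1:
  fixes s :: nat and a :: "nat \<Rightarrow> int" and m :: "nat \<Rightarrow> nat"
  assumes "distinct_covering_system {1..s} a m"
    and "\<forall>j\<in>{1..s}. m j > 4"
  shows "(\<Sum>j=1..s. 1 / real (m j)) \<ge> 1 + exp (- (3.363054 * 10 ^ 21) :: real)"
proof -
  define M where "M = m ` {1..s}"
  \<comment> \<open>As the moduli are distinct, each class can be indexed by its modulus.\<close>
  define b where "b k = a (inv_into {1..s} m k)" for k
  have inj: "inj_on m {1..s}" using assms(1) by (simp add: distinct_covering_system_def)
  have b: "b (m j) = a j" if "j \<in> {1..s}" for j
    using inv_into_f_f[OF inj that] by (simp add: b_def)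
  have fM: "finite M" by (simp add: M_def)
  have M4: "k > 4" if "k \<in> M" for k using that assms(2) by (auto simp: M_def)
  have cover: "\<exists>k\<in>M. [x = b k] (mod int k)" for x
  proof -
    obtain j where "j \<in> {1..s}" "[x = a j] (mod int (m j))"
      using assms(1) unfolding distinct_covering_system_def covering_system_def by blast
    then show ?thesis using b unfolding M_def by force
  qed
  have sum_eq: "(\<Sum>j=1..s. 1 / real (m j)) = (\<Sum>k\<in>M. 1 / real k)"
    unfolding M_def by (subst sum.reindex[OF inj]) simp
  \<comment> \<open>Rounding up to an integer keeps \<open>L\<close> between 10^8 and 10^8 +
    1.\<close>
  define P where "P = nat \<lceil>exp (10 ^ 8 :: real)\<rceil>"
  define L where "L = ln (real P)"
  have P: "exp (10 ^ 8) \<le> real P" "real P \<le> exp (10 ^ 8) + 1"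
  proof -
    have "0 \<le> \<lceil>exp (10 ^ 8 :: real)\<rceil>" using exp_gt_zero[of "10 ^ 8 :: real"] by linarith
    then have P: "real P = of_int \<lceil>exp (10 ^ 8 :: real)\<rceil>" by (simp add: P_def)
    show "exp (10 ^ 8) \<le> real P" "real P \<le> exp (10 ^ 8) + 1"
      unfolding P by (simp_all only: le_of_int_ceiling of_int_ceiling_le_add_one)
  qed
  have "(0 :: real) < exp (10 ^ 8)" by simp
  then have P0: "real P > 0" using P(1) by linarith
  have L: "10 ^ 8 \<le> L" unfolding L_def using P(1) P0 by (simp add: ln_ge_iff)
  have "real P \<le> exp (10 ^ 8) * exp 1"
  proof -
    have "(1 :: real) \<le> exp (10 ^ 8)" by simp
    moreover have "exp (10 ^ 8) * 2 \<le> exp (10 ^ 8) * exp (1 :: real)"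
      using exp_ge_add_one_self[of 1] by (intro mult_left_mono) auto
    ultimately show ?thesis using P(2) by linarith
  qed
  then have "real P \<le> exp (10 ^ 8 + 1)" by (simp only: exp_add)
  then have L2: "L \<le> 10 ^ 8 + 1" unfolding L_def using P0 by (metis ln_exp ln_le_cancel_iff exp_gt_zero)
  obtain k n where kn: "k \<in> M" "n \<in> M" "k \<noteq> n" "real k \<le> exp (80 * L\<^sup>2)" "real n \<le> exp (80 * L\<^sup>2)"
    and ex: "\<exists>x. [x = b k] (mod int k) \<and> [x = b n] (mod int n)"
    using no_disjoint_cover[OF fM M4 cover L_def L] by blast
  from ex obtain x0 where x0: "[x0 = b k] (mod int k)" "[x0 = b n] (mod int n)" by blast
  \<comment> \<open>160 (10^8 + 1)^2 is about 1.6 * 10^18, well below 3.363054 * 10^21.\<close>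
  have "exp (- (3.363054 * 10 ^ 21) :: real) \<le> exp (- (160 * L\<^sup>2))"
  proof -
    have "L\<^sup>2 \<le> (10 ^ 8 + 1)\<^sup>2" using L L2 by (intro power_mono) auto
    then show ?thesis by simp
  qed
  also have "\<dots> = 1 / (exp (80 * L\<^sup>2) * exp (80 * L\<^sup>2))"
    by (simp add: exp_minus inverse_eq_divide flip: exp_add)
  also have "\<dots> \<le> 1 / (real k * real n)"
    using kn(4,5) M4[OF kn(1)] M4[OF kn(2)] by (intro divide_left_mono mult_mono mult_pos_pos) auto
  finally have "1 + exp (- (3.363054 * 10 ^ 21) :: real) \<le> 1 + 1 / (real k * real n)" by simp
  also have "\<dots> \<le> (\<Sum>k\<in>M. 1 / real k)"
  proof (rule overlap_sum_ge[OF fM _ cover kn(1-3) x0])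
    show "k > 0" if "k \<in> M" for k using M4[OF that] by simp
  qed
  finally show ?thesis unfolding sum_eq .
qed

end
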